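(* Let $m$ be an odd positive integer, $n\ge1$, $\gamma_m=\frac{m-1}{2}$, let $D\subset\mathbb{C}^n$ be open and symmetric, and let $f\in\mathcal{S}(\Omega_D)$. Fix any $H\in\mathcal{P}(n)$. Then: 1. We can decompose $f$ (on $\Omega_{D_H}$) as $$f(x)=\sum_{K\subset H}(-1)^{|H\setminus K|}(\overline{x})_{H\setminus K}\odot\mathcal{S}^H_K(f)(x),$$ where $(\overline{x})_T=\overline{x}_{t_1}\cdots\overline{x}_{t_s}$ if $T=\{t_1<\dots<t_s\}$. If $H=\llbracket q\rrbracket=\{1,\dots,q\}$ with $1\le q\le n$, this becomes, with pointwise products, $$f(x)=\sum_{K\in\mathcal{P}(q)}(-1)^{|K^c|}(\overline{x})_{K^c}\,\mathcal{S}^{\llbracket q\rrbracket}_K(f)(x),\qquad K^c=\{1,\dots,q\}\setminus K.$$ 2. If $H\ne\llbracket n\rrbracket$, then $\mathcal{S}^H_K(f)\in\mathcal{S}_{c,H}(\Omega_{D_H})\cap\mathcal{S}_p(\Omega_{D_H})$ for every $K\subset H$, where $p=\min H^c$ and $H^c=\{1,\dots,n\}\setminus H$; while $\mathcal{S}^{\llbracket n\rrbracket}_K(f)\in\mathcal{S}_{c,\llbracket n\rrbracket}(\Omega_{D_{\llbracket n\rrbracket}})$ for every $K\in\mathcal{P}(n)$. 3. If $f\in\mathcal{SR}(\Omega_D)$, then $\Delta_{m+1,h}^{\gamma_m}\mathcal{S}^H_K(f)=0$ for all $h\in H$ and all $K\subset H$. 4. $f\in\mathcal{SR}(\Omega_D)$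 if and only if $\mathcal{S}^{H}_K(f)\in\mathcal{SR}_p(\Omega_{D_{H}})$ for all $H\in\mathcal{P}(n)$ with $H\neq\{1,\dots,n\}$ and all $K\subset H$, where $p=\min H^c$. 5. $f\in\mathcal{S}_{\mathbb{R}}(\Omega_D)$ if and only if $\mathcal{S}^{\llbracket n\rrbracket}_K(f)$ is real valued for every $K\in\mathcal{P}(n)$.
   Context: $\mathbb{R}_m$ is the real Clifford algebra generated by $e_1,\dots,e_m$ with $e_ie_j+e_je_i=-2\delta_{ij}$; $\mathbb{R}^{m+1}$ is identified with the paravectors $x_0+\sum_{i=1}^m x_ie_i$, with conjugation $\overline{x_0+\sum x_ie_i}=x_0-\sum x_ie_i$; $\mathbb{S}=\{x\in\mathbb{R}^{m+1}:x_0=0,\ \sum_{i=1}^m x_i^2=1\}$. Every $x\in\mathbb{R}^{m+1}$ is $\alpha+J\beta$ with $\alpha\in\mathbb{R}$, $\beta\ge0$, $J\in\mathbb{S}$. One-variable notions. For $D\subset\mathbb{C}$ open and conjugation-invariant, $\Omega_D=\{\alpha+J\beta:\alpha+i\beta\in D,J\in\mathbb{S}\}$. A function $g:\Omega_D\to\mathbb{R}_m$ is slice if $g(\alpha+J\beta)=G_0(\alpha+i\beta)+JG_1(\alpha+i\beta)$ with $G_0,G_1:D\to\mathbb{R}_m$ respectively even and odd in $\beta$; slice regular if moreover $G_0,G_1$ are $C^1$ and $\partial_\alpha G_0=\partial_\beta G_1$, $\partial_\beta G_0=-\partial_\alpha G_1$; circular if it is slice with $G_1=0$. Several variables. $\mathcal{P}(n)$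 is the set of subsets of $\{1,\dots,n\}$ (similarly $\mathcal{P}(q)$); $\{\varepsilon_K\}_{K\in\mathcal{P}(n)}$ is a basis of $\mathbb{R}^{2^n}$. $D\subset\mathbb{C}^n$ is symmetric if it is invariant under conjugation of each single variable, $z\mapsto\bar z^h$. $\Omega_D=\{(\alpha_l+J_l\beta_l)_{l=1}^n:(\alpha_l+i\beta_l)_l\in D,\ J_1,\dots,J_n\in\mathbb{S}\}\subset(\mathbb{R}^{m+1})^n$. A stem function is $F=\sum_K\varepsilon_KF_K:D\to\mathbb{R}_m\otimes\mathbb{R}^{2^n}$ with $F_K(\bar z^h)=F_K(z)$ if $h\notin K$, $F_K(\bar z^h)=-F_K(z)$ if $h\in K$. For $K=\{k_1<\dots<k_p\}$, $[J_K,a]=J_{k_1}\cdots J_{k_p}a$. $F$ induces the slice function $\mathcal{I}(F)(x)=\sum_K[J_K,F_K(z)]$, $x=(\alpha_l+J_l\beta_l)_l$, $z=(\alpha_l+i\beta_l)_l$; $\mathcal{S}(\Omega_D)$ is the set of slice functions. $f=\mathcal{I}(F)$ is slice regular ($f\in\mathcal{SR}(\Omega_D)$) if $F$ is $C^1$ and $\partial_{\alpha_h}F_K=\partial_{\beta_h}F_{K\cup\{h\}}$, $\partial_{\beta_h}F_K=-\partial_{\alpha_h}F_{K\cup\{h\}}$ for all $h$ and all $K\not\ni h$. $f$ is slice preserving ($f\in\mathcal{S}_{\mathbb{R}}(\Omega_D)$) if all $F_K$ are real valued. The slice product is $\mathcal{I}(F)\odot\mathcal{I}(G)=\mathcal{I}(F\otimes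 G)$, $F\otimes G=\sum_{H,K}(-1)^{|H\cap K|}\varepsilon_{H\Delta K}F_HG_K$ ($H\Delta K$ symmetric difference). A slice function $f\in\mathcal{S}(\Omega_D)$ is slice (resp. slice regular, circular) with respect to $x_h$ if for every $y\in\Omega_D$ the one-variable function $x\mapsto f(y_1,\dots,y_{h-1},x,y_{h+1},\dots,y_n)$ is slice (resp. slice regular, circular) on its natural domain; the corresponding sets are $\mathcal{S}_h$, $\mathcal{SR}_h$, $\mathcal{S}_{c,h}$, and $\mathcal{S}_{c,H}=\bigcap_{h\in H}\mathcal{S}_{c,h}$ (all of $\mathcal S$ if $H=\emptyset$). For $H\in\mathcal{P}(n)$, $\Omega_{D_H}=\{x\in\Omega_D: x_h\notin\mathbb{R}\ \forall h\in H\}$ and $D_H=\{z\in D:\beta_h\neq0\ \forall h\in H\}$. The spherical $H$-derivative of $f=\mathcal{I}(F)$ is $f'_{s,H}=\mathcal{I}(F'_H)$ on $\Omega_{D_H}$, $F'_H=\sum_{K\subset H^c}\varepsilon_K\beta_H^{-1}F_{K\cup H}$, $\beta_H=\prod_{h\in H}\beta_h$. For $K=\{k_1<\dots<k_p\}\subset H$, $\mathcal{S}^H_K(f):=(x_{k_1}\odot\cdots\odot x_{k_p}\odot f)'_{s,H}$ on $\Omega_{D_H}$, where $x_j$ (resp. $\overline{x}_j$) denotes the slice function induced by the stem function $\alpha_j+\varepsilon_{\{j\}}\beta_j$ (resp. $\alpha_j-\varepsilon_{\{j\}}\beta_j$); $\mathcal{S}^\emptyset_\emptyset(f)=f$. $\Delta_{m+1,h}$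 is the Laplacian in the $m+1$ real coordinates of $x_h$.
   Formalization: Item 3 is stated for odd m ≥ 3 (it fails for m = 1, where γ_m = 0); in item 5 the direction from real-valued S_K to f slice preserving assumes f continuous on Ω_D, and for arbitrary f the equivalence is given on Ω_{D_[[n]]}, since it fails for discontinuous f. *)

theory Defs
  imports "HOL-Analysis.Analysis"
begin

section \<open>The real Clifford algebra\<close>

text \<open>
  The algebra with generators indexed by \<open>'m\<close> (so \<open>m = CARD('m)\<close>) is built on its standard
  basis \<open>e_A = e_{a_1} \<cdots> e_{a_k}\<close>, \<open>A = {a_1 < \<dots> < a_k} \<subseteq> 'm\<close>.  Reordering \<open>e_A e_B\<close> costs a
  factor \<open>-1\<close> for every pair \<open>i \<in> A\<close>, \<open>j \<in> B\<close> with \<open>j < i\<close> (anticommutation) and for every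
  \<open>i \<in> A \<inter> B\<close> (\<open>e_i\<^sup>2 = -1\<close>), so that \<open>e_A e_B = cl_sign A B e_{A \<Delta> B}\<close>.
\<close>

typedef (overloaded) 'm clifford = "UNIV :: (real ^ ('m::{finite,linorder}) set) set"
  morphisms cl_vec Clifford by auto

setup_lifting type_definition_clifford

definition cl_coeff :: "'m::{finite,linorder} clifford \<Rightarrow> 'm set \<Rightarrow> real" where
  "cl_coeff a A = cl_vec a $ A"

definition cl_sign :: "'m::{finite,linorder} set \<Rightarrow> 'm set \<Rightarrow> real" where
  "cl_sign A B = (\<Prod>i\<in>A. \<Prod>j\<in>B. if j \<le> i then - 1 else 1)"

lemma clifford_eqI: "(\<And>A. cl_coeff a A = cl_coeff b A) \<Longrightarrow> a = b"
  by (auto simp: cl_coeff_def vec_eq_iff cl_vec_inject[symmetric])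

instantiation clifford :: ("{finite,linorder}") real_algebra_1
begin

lift_definition zero_clifford :: "'a clifford" is 0 .
lift_definition one_clifford :: "'a clifford" is "\<chi> A. if A = {} then 1 else 0" .
lift_definition uminus_clifford :: "'a clifford \<Rightarrow> 'a clifford" is uminus .
lift_definition plus_clifford :: "'a clifford \<Rightarrow> 'a clifford \<Rightarrow> 'a clifford" is "(+)" .
lift_definition minus_clifford :: "'a clifford \<Rightarrow> 'a clifford \<Rightarrow> 'a clifford" is "(-)" .
lift_definition scaleR_clifford :: "real \<Rightarrow> 'a clifford \<Rightarrow> 'a clifford" is "(*\<^sub>R)" .
lift_definition times_clifford :: "'a clifford \<Rightarrow> 'a clifford \<Rightarrow> 'a clifford" is
  "\<lambda>a b. \<chi> C. \<Sum>A\<in>UNIV. \<Sum>B\<in>UNIV. if sym_diff A B = C then cl_sign A B * (a $ A) * (b $ B) else 0" .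

lemma cl_coeff_simps [simp]:
  "cl_coeff 0 A = 0"
  "cl_coeff 1 A = (if A = {} then 1 else 0)"
  "cl_coeff (- a) A = - cl_coeff a A"
  "cl_coeff (a + b) A = cl_coeff a A + cl_coeff b A"
  "cl_coeff (a - b) A = cl_coeff a A - cl_coeff b A"
  "cl_coeff (r *\<^sub>R a) A = r * cl_coeff a A"
  unfolding cl_coeff_def by (transfer, simp)+

lemma cl_coeff_times:
  "cl_coeff (a * b) C = (\<Sum>A\<in>UNIV. cl_sign A (sym_diff A C) * cl_coeff a A * cl_coeff b (sym_diff A C))"
proof -
  have "cl_coeff (a * b) C = (\<Sum>A\<in>UNIV. \<Sum>B\<in>UNIV.
      if sym_diff A B = C then cl_sign A B * cl_coeff a A * cl_coeff b B else 0)"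
    unfolding cl_coeff_def by transfer simp
  also have "\<dots> = (\<Sum>A\<in>UNIV. \<Sum>B\<in>UNIV.
      if B = sym_diff A C then cl_sign A B * cl_coeff a A * cl_coeff b B else 0)"
    by (intro sum.cong refl if_cong) auto
  finally show ?thesis by simp
qed

lemma prod_sym_diff:
  fixes f :: "'b::finite \<Rightarrow> real"
  assumes "\<And>x. f x * f x = 1"
  shows "prod f (sym_diff A B) = prod f A * prod f B"
proof -
  have A: "prod f A = prod f (A - B) * prod f (A \<inter> B)"
    by (subst prod.union_disjoint[symmetric]) (auto intro!: prod.cong)
  have B: "prod f B = prod f (B - A) * prod f (A \<inter> B)"
    by (subst prod.union_disjoint[symmetric]) (auto intro!: prod.cong)
  have I: "prod f (A \<inter> B) * prod f (A \<inter> B) = 1"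
    by (simp add: prod.distrib[symmetric] assms)
  have "prod f (sym_diff A B) = prod f (A - B) * prod f (B - A)"
    by (subst prod.union_disjoint) auto
  moreover have "prod f A * prod f B = prod f (A - B) * prod f (B - A) * (prod f (A \<inter> B) * prod f (A \<inter> B))"
    by (simp only: A B) (simp only: ac_simps)
  ultimately show ?thesis by (simp add: I)
qed

lemma cl_sign_sym_diff_left: "cl_sign (sym_diff A B) C = cl_sign A C * cl_sign B C"
  unfolding cl_sign_def
  by (rule prod_sym_diff) (auto simp: prod.distrib[symmetric] intro!: prod.neutral)

lemma cl_sign_sym_diff_right: "cl_sign A (sym_diff B C) = cl_sign A B * cl_sign A C"
proof -
  have "cl_sign A (sym_diff B C) = (\<Prod>i\<in>A. (\<Prod>j\<in>B. if j \<le> i then - 1 else 1) * (\<Prod>j\<in>C. if j \<le> i then - 1 else 1))"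
    unfolding cl_sign_def by (intro prod.cong refl prod_sym_diff) auto
  thus ?thesis by (simp add: cl_sign_def prod.distrib)
qed

lemma cl_sign_empty [simp]: "cl_sign {} A = 1" "cl_sign A {} = 1"
  by (auto simp: cl_sign_def)

lemma sum_sym_diff:
  fixes g :: "'b::finite set \<Rightarrow> real"
  shows "(\<Sum>A\<in>UNIV. g (sym_diff B A)) = (\<Sum>A\<in>UNIV. g A)"
  by (rule sum.reindex_bij_witness[of _ "sym_diff B" "sym_diff B"])
     (auto intro!: arg_cong[where f = g])

instance
proof
  fix a b c :: "'a clifford" and r s :: real
  show "a * b * c = a * (b * c)"
  proof (rule clifford_eqI)
    fix X :: "'a set"
    let ?\<sigma> = "cl_sign :: 'a set \<Rightarrow> 'a set \<Rightarrow> real"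
    have D: "sym_diff (sym_diff A B) X = sym_diff B (sym_diff A X)"
        "sym_diff A (sym_diff A B) = B" for A B :: "'a set"
      by auto
    have "cl_coeff (a * b * c) X = (\<Sum>B\<in>UNIV. \<Sum>A\<in>UNIV. ?\<sigma> B (sym_diff B X) *
        (?\<sigma> A (sym_diff A B) * cl_coeff a A * cl_coeff b (sym_diff A B)) * cl_coeff c (sym_diff B X))"
      by (simp add: cl_coeff_times sum_distrib_left sum_distrib_right)
    also have "\<dots> = (\<Sum>A\<in>UNIV. \<Sum>B\<in>UNIV. ?\<sigma> B (sym_diff B X) *
        (?\<sigma> A (sym_diff A B) * cl_coeff a A * cl_coeff b (sym_diff A B)) * cl_coeff c (sym_diff B X))"
      by (rule sum.swap)
    also have "\<dots> = (\<Sum>A\<in>UNIV. \<Sum>B\<in>UNIV. ?\<sigma> (sym_diff A B) (sym_diff (sym_diff A B) X) *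
        (?\<sigma> A (sym_diff A (sym_diff A B)) * cl_coeff a A * cl_coeff b (sym_diff A (sym_diff A B)))
        * cl_coeff c (sym_diff (sym_diff A B) X))"
      by (intro sum.cong refl sum_sym_diff[symmetric])
    also have "\<dots> = (\<Sum>A\<in>UNIV. \<Sum>B\<in>UNIV. ?\<sigma> A (sym_diff A X) * cl_coeff a A *
        (?\<sigma> B (sym_diff B (sym_diff A X)) * cl_coeff b B * cl_coeff c (sym_diff B (sym_diff A X))))"
    proof (intro sum.cong refl)
      fix A B :: "'a set"
      have E: "?\<sigma> (sym_diff A B) (sym_diff B (sym_diff A X)) * ?\<sigma> A B =
          ?\<sigma> A (sym_diff A X) * ?\<sigma> B (sym_diff B (sym_diff A X))"
      proof -
        have "?\<sigma> A B * ?\<sigma> A B = 1"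
          using cl_sign_sym_diff_right[of A B B] by simp
        thus ?thesis
          by (simp only: cl_sign_sym_diff_left cl_sign_sym_diff_right[of _ B])
             (simp add: algebra_simps)
      qed
      show "?\<sigma> (sym_diff A B) (sym_diff (sym_diff A B) X) *
        (?\<sigma> A (sym_diff A (sym_diff A B)) * cl_coeff a A * cl_coeff b (sym_diff A (sym_diff A B)))
        * cl_coeff c (sym_diff (sym_diff A B) X) = ?\<sigma> A (sym_diff A X) * cl_coeff a A *
        (?\<sigma> B (sym_diff B (sym_diff A X)) * cl_coeff b B * cl_coeff c (sym_diff B (sym_diff A X)))"
        unfolding D using arg_cong[OF E, of "\<lambda>t. t * (cl_coeff a A * cl_coeff b B * cl_coeff c (sym_diff B (sym_diff A X)))"]
        by (simp only: ac_simps)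
    qed
    also have "\<dots> = cl_coeff (a * (b * c)) X"
      by (simp add: cl_coeff_times sum_distrib_left)
    finally show "cl_coeff (a * b * c) X = cl_coeff (a * (b * c)) X" .
  qed
  show "1 * a = a"
    by (rule clifford_eqI) (simp add: cl_coeff_times if_distrib if_distribR cong: if_cong)
  show "a * 1 = a"
  proof (rule clifford_eqI)
    fix X :: "'a set"
    have "sym_diff A X = {} \<longleftrightarrow> A = X" for A by auto
    thus "cl_coeff (a * 1) X = cl_coeff a X"
      by (simp add: cl_coeff_times if_distrib cong: if_cong)
  qed
  show "(0::'a clifford) \<noteq> 1"
    by (metis cl_coeff_simps(1,2) zero_neq_one)
qed (rule clifford_eqI; simp add: cl_coeff_times algebra_simps sum.distrib sum_distrib_left)+

end

definition cl_gen :: "'m::{finite,linorder} \<Rightarrow> 'm clifford" where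
  "cl_gen i = Clifford (axis {i} 1)"

lemma cl_gen_anticommute:
  "cl_gen i * cl_gen j + cl_gen j * cl_gen i = (if i = j then - 2 else 0)"
proof -
  have c: "cl_coeff (cl_gen k) A = (if A = {k} then 1 else 0)" for k :: 'a and A
    by (simp add: cl_coeff_def cl_gen_def Clifford_inverse axis_def)
  have t: "cl_coeff (2 :: 'a clifford) A = (if A = {} then 2 else 0)" for A
    using cl_coeff_simps(4)[of "1 :: 'a clifford" 1 A] by auto
  have m: "cl_coeff (cl_gen k * cl_gen l) C =
      (if C = sym_diff {k} {l} then (if l \<le> k then -1 else 1) else 0)" for k l :: 'a and C
  proof -
    have "cl_coeff (cl_gen k * cl_gen l) C = (\<Sum>A\<in>UNIV. if A = {k}
        then cl_sign {k} (sym_diff {k} C) * cl_coeff (cl_gen l) (sym_diff {k} C) else 0)"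
      unfolding cl_coeff_times c[of k] by (intro sum.cong refl) simp
    also have "\<dots> = cl_sign {k} (sym_diff {k} C) * (if sym_diff {k} C = {l} then 1 else 0)"
      by (simp add: c)
    also have "sym_diff {k} C = {l} \<longleftrightarrow> C = sym_diff {k} {l}" by auto
    also have "cl_sign {k} (sym_diff {k} C) * (if C = sym_diff {k} {l} then 1 else 0) =
        (if C = sym_diff {k} {l} then cl_sign {k} {l} else 0)"
    proof (cases "C = sym_diff {k} {l}")
      case True
      hence "sym_diff {k} C = {l}" by auto
      with True show ?thesis by simp
    qed simp
    finally show ?thesis by (simp add: cl_sign_def)
  qed
  show ?thesis
    by (rule clifford_eqI) (auto simp: m t)
qed

text \<open>
  As a normed space the algebra is \<open>\<real>\<^bsup>2^m\<^esup>\<close> with its Euclidean structure.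
\<close>

instantiation clifford :: ("{finite,linorder}") euclidean_space
begin

definition "inner_clifford a b = inner (cl_vec a) (cl_vec b)"
definition "norm_clifford a = norm (cl_vec a)"
definition "dist_clifford a b = norm (a - b :: 'a clifford)"
definition "sgn_clifford a = (a :: 'a clifford) /\<^sub>R norm a"
definition "uniformity_clifford =
  (INF e\<in>{0<..}. principal {(x, y :: 'a clifford). dist x y < e})"
definition "open_clifford (U :: 'a clifford set) \<longleftrightarrow>
  (\<forall>x\<in>U. eventually (\<lambda>(x', y). x' = x \<longrightarrow> y \<in> U) uniformity)"
definition "Basis_clifford = Clifford ` Basis"

instance
proof
  fix x y z :: "'a clifford" and r :: real and U :: "'a clifford set"
  show "dist x y = norm (x - y)" by (rule dist_clifford_def)
  show "sgn x = x /\<^sub>R norm x" by (rule sgn_clifford_def)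
  show "uniformity = (INF e\<in>{0<..}. principal {(x, y :: 'a clifford). dist x y < e})"
    by (rule uniformity_clifford_def)
  show "open U \<longleftrightarrow> (\<forall>x\<in>U. eventually (\<lambda>(x', y). x' = x \<longrightarrow> y \<in> U) uniformity)"
    by (rule open_clifford_def)
  show "inner x y = inner y x" by (simp add: inner_clifford_def inner_commute)
  show "inner (x + y) z = inner x z + inner y z"
    by (simp add: inner_clifford_def plus_clifford.rep_eq inner_add_left)
  show "inner (r *\<^sub>R x) y = r * inner x y"
    by (simp add: inner_clifford_def scaleR_clifford.rep_eq)
  show "0 \<le> inner x x" by (simp add: inner_clifford_def)
  show "inner x x = 0 \<longleftrightarrow> x = 0"
    by (simp add: inner_clifford_def zero_clifford.rep_eq flip: cl_vec_inject)
  show "norm x = sqrt (inner x x)"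
    by (simp add: norm_clifford_def inner_clifford_def norm_eq_sqrt_inner)
  show "(Basis :: 'a clifford set) \<noteq> {}" "finite (Basis :: 'a clifford set)"
    by (simp_all add: Basis_clifford_def)
  show "inner u v = (if u = v then 1 else 0)" if "u \<in> Basis" "v \<in> Basis" for u v :: "'a clifford"
    using that by (auto simp: Basis_clifford_def inner_clifford_def Clifford_inverse
        Clifford_inject inner_Basis)
  show "(\<forall>u\<in>Basis. inner x u = 0) \<longleftrightarrow> x = 0"
    by (auto simp: Basis_clifford_def inner_clifford_def Clifford_inverse
        zero_clifford.rep_eq euclidean_all_zero_iff simp flip: cl_vec_inject)
qed

end


section \<open>Paravectors and the imaginary sphere\<close>

text \<open>
  \<open>\<real>\<^bsup>m+1\<^esup>\<close> is the subspace of paravectors of \<open>'m clifford\<close>; a paravector is always presented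
  as \<open>\<alpha> + J \<beta>\<close> with \<open>J\<close> in the following sphere.
\<close>

definition imag_sphere :: "'m::{finite,linorder} clifford set" where
  "imag_sphere = {\<Sum>i\<in>UNIV. v i *\<^sub>R cl_gen i | v. (\<Sum>i\<in>UNIV. (v i)\<^sup>2) = 1}"

definition slice_pt1 :: "'m::{finite,linorder} clifford \<Rightarrow> complex \<Rightarrow> 'm clifford" where
  "slice_pt1 J w = of_real (Re w) + J * of_real (Im w)"


section \<open>Slice functions of one variable\<close>

definition C1_on :: "'a::real_normed_vector set \<Rightarrow> ('a \<Rightarrow> 'b::real_normed_vector) \<Rightarrow> bool" where
  "C1_on S f \<longleftrightarrow> (\<exists>f' :: 'a \<Rightarrow> 'a \<Rightarrow>\<^sub>L 'b.
     (\<forall>x\<in>S. (f has_derivative blinfun_apply (f' x)) (at x)) \<and> continuous_on S f')"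

definition Omega1 :: "complex set \<Rightarrow> 'm::{finite,linorder} clifford set" where
  "Omega1 E = {slice_pt1 J w | J w. w \<in> E \<and> J \<in> imag_sphere}"

definition slice_pair1 ::
  "complex set \<Rightarrow> ('m::{finite,linorder} clifford \<Rightarrow> 'm clifford) \<Rightarrow>
   (complex \<Rightarrow> 'm clifford) \<Rightarrow> (complex \<Rightarrow> 'm clifford) \<Rightarrow> bool" where
  "slice_pair1 E g G0 G1 \<longleftrightarrow> open E \<and> (\<forall>w\<in>E. cnj w \<in> E) \<and>
     (\<forall>w\<in>E. G0 (cnj w) = G0 w \<and> G1 (cnj w) = - G1 w) \<and>
     (\<forall>w\<in>E. \<forall>J\<in>imag_sphere. g (slice_pt1 J w) = G0 w + J * G1 w)"

text \<open>
  In the next three definitions \<open>X\<close> is the domain of \<open>g\<close>; it has to be of the form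
  \<open>\<Omega>_E\<close>, and \<open>E\<close> is then determined by \<open>X\<close>.
\<close>

definition is_slice1 ::
  "'m::{finite,linorder} clifford set \<Rightarrow> ('m clifford \<Rightarrow> 'm clifford) \<Rightarrow> bool" where
  "is_slice1 X g \<longleftrightarrow> (\<exists>E G0 G1. X = Omega1 E \<and> slice_pair1 E g G0 G1)"

definition is_slice_regular1 ::
  "'m::{finite,linorder} clifford set \<Rightarrow> ('m clifford \<Rightarrow> 'm clifford) \<Rightarrow> bool" where
  "is_slice_regular1 X g \<longleftrightarrow> (\<exists>E G0 G1. X = Omega1 E \<and> slice_pair1 E g G0 G1 \<and>
     C1_on E G0 \<and> C1_on E G1 \<and>
     (\<forall>w\<in>E. frechet_derivative G0 (at w) 1 = frechet_derivative G1 (at w) \<i> \<and>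
            frechet_derivative G0 (at w) \<i> = - frechet_derivative G1 (at w) 1))"

definition is_circular1 ::
  "'m::{finite,linorder} clifford set \<Rightarrow> ('m clifford \<Rightarrow> 'm clifford) \<Rightarrow> bool" where
  "is_circular1 X g \<longleftrightarrow> (\<exists>E G0 G1. X = Omega1 E \<and> slice_pair1 E g G0 G1 \<and> (\<forall>w\<in>E. G1 w = 0))"


section \<open>Slice functions of several variables\<close>

text \<open>
  The variables are indexed by a finite linearly ordered type \<open>'n\<close> with \<open>n = CARD('n)\<close>; the
  order only matters for the order of products and for minima.  All functions are total, but only
  their values on the relevant domain are significant.
\<close>

type_synonym ('m, 'n) slice_fun = "'m clifford ^ 'n \<Rightarrow> 'm clifford"

text \<open>\<open>F K\<close> is the component of \<open>\<epsilon>_K\<close>.\<close>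
type_synonym ('m, 'n) stem = "'n set \<Rightarrow> complex ^ 'n \<Rightarrow> 'm clifford"

definition cnj_at :: "'n::finite \<Rightarrow> complex ^ 'n \<Rightarrow> complex ^ 'n" where
  "cnj_at h z = (\<chi> l. if l = h then cnj (z $ l) else z $ l)"

definition symmetric :: "(complex ^ 'n::finite) set \<Rightarrow> bool" where
  "symmetric D \<longleftrightarrow> (\<forall>z\<in>D. \<forall>h. cnj_at h z \<in> D)"

definition slice_pt ::
  "('n::finite \<Rightarrow> 'm::{finite,linorder} clifford) \<Rightarrow> complex ^ 'n \<Rightarrow> 'm clifford ^ 'n" where
  "slice_pt J z = (\<chi> l. slice_pt1 (J l) (z $ l))"

definition Omega :: "(complex ^ 'n::finite) set \<Rightarrow> ('m::{finite,linorder} clifford ^ 'n) set" where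
  "Omega D = {slice_pt J z | J z. z \<in> D \<and> (\<forall>l. J l \<in> imag_sphere)}"

definition is_stem ::
  "(complex ^ 'n::finite) set \<Rightarrow> ('m::{finite,linorder}, 'n) stem \<Rightarrow> bool" where
  "is_stem D F \<longleftrightarrow> (\<forall>z\<in>D. \<forall>h K. F K (cnj_at h z) = (if h \<in> K then - F K z else F K z))"

definition ordered_prod :: "('n::linorder \<Rightarrow> 'a::monoid_mult) \<Rightarrow> 'n set \<Rightarrow> 'a" where
  "ordered_prod J K = prod_list (map J (sorted_list_of_set K))"

text \<open>
  \<open>slice_ind D F\<close> is the induced function \<open>\<I>(F)\<close> on \<open>Omega D\<close>.  For a stem function the value does
  not depend on the presentation \<open>x = slice_pt J z\<close>, which is what justifies \<open>THE\<close>.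
\<close>

definition slice_ind ::
  "(complex ^ 'n::{finite,linorder}) set \<Rightarrow> ('m::{finite,linorder}, 'n) stem \<Rightarrow> ('m, 'n) slice_fun" where
  "slice_ind D F x = (THE v. \<exists>J z. z \<in> D \<and> (\<forall>l. J l \<in> imag_sphere) \<and> x = slice_pt J z \<and>
     v = (\<Sum>K\<in>UNIV. ordered_prod J K * F K z))"

definition induced_by ::
  "(complex ^ 'n::{finite,linorder}) set \<Rightarrow> ('m::{finite,linorder}, 'n) slice_fun \<Rightarrow> ('m, 'n) stem \<Rightarrow> bool" where
  "induced_by D f F \<longleftrightarrow> is_stem D F \<and> (\<forall>x\<in>Omega D. f x = slice_ind D F x)"

definition slice_fns ::
  "(complex ^ 'n::{finite,linorder}) set \<Rightarrow> ('m::{finite,linorder}, 'n) slice_fun set" where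
  "slice_fns D = {f. \<exists>F. induced_by D f F}"

definition slice_regular_fns ::
  "(complex ^ 'n::{finite,linorder}) set \<Rightarrow> ('m::{finite,linorder}, 'n) slice_fun set" where
  "slice_regular_fns D = {f. \<exists>F. induced_by D f F \<and> (\<forall>K. C1_on D (F K)) \<and>
     (\<forall>z\<in>D. \<forall>h K. h \<notin> K \<longrightarrow>
        frechet_derivative (F K) (at z) (axis h 1) =
          frechet_derivative (F (insert h K)) (at z) (axis h \<i>) \<and>
        frechet_derivative (F K) (at z) (axis h \<i>) =
          - frechet_derivative (F (insert h K)) (at z) (axis h 1))}"

definition slice_preserving_fns ::
  "(complex ^ 'n::{finite,linorder}) set \<Rightarrow> ('m::{finite,linorder}, 'n) slice_fun set" where
  "slice_preserving_fns D = {f. \<exists>F. induced_by D f F \<and> (\<forall>K. \<forall>z\<in>D. F K z \<in> \<real>)}"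

text \<open>
  The stem function inducing \<open>f\<close> is unique on \<open>D\<close> for open symmetric \<open>D\<close>; off \<open>D\<close> its values are
  arbitrary and never used.
\<close>

definition stem_of ::
  "(complex ^ 'n::{finite,linorder}) set \<Rightarrow> ('m::{finite,linorder}, 'n) slice_fun \<Rightarrow> ('m, 'n) stem" where
  "stem_of D f = (SOME F. induced_by D f F)"

definition stem_prod ::
  "('m::{finite,linorder}, 'n::finite) stem \<Rightarrow> ('m, 'n) stem \<Rightarrow> ('m, 'n) stem" where
  "stem_prod F G L z = (\<Sum>(H, K) \<in> {(H, K). sym_diff H K = L}. (- 1) ^ card (H \<inter> K) * F H z * G K z)"

definition slice_prod ::
  "(complex ^ 'n::{finite,linorder}) set \<Rightarrow> ('m::{finite,linorder}, 'n) slice_fun \<Rightarrow>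
   ('m, 'n) slice_fun \<Rightarrow> ('m, 'n) slice_fun" where
  "slice_prod D f g = slice_ind D (stem_prod (stem_of D f) (stem_of D g))"

definition coord ::
  "(complex ^ 'n::{finite,linorder}) set \<Rightarrow> 'n \<Rightarrow> ('m::{finite,linorder}, 'n) slice_fun" where
  "coord D j = slice_ind D (\<lambda>K z. if K = {} then of_real (Re (z $ j))
     else if K = {j} then of_real (Im (z $ j)) else 0)"

definition coord_cnj ::
  "(complex ^ 'n::{finite,linorder}) set \<Rightarrow> 'n \<Rightarrow> ('m::{finite,linorder}, 'n) slice_fun" where
  "coord_cnj D j = slice_ind D (\<lambda>K z. if K = {} then of_real (Re (z $ j))
     else if K = {j} then - of_real (Im (z $ j)) else 0)"

text \<open>The pointwise product of the conjugate coordinates \<open>coord_cnj D t\<close>, \<open>t \<in> T\<close>, in increasing order.\<close>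

definition coord_cnj_prod ::
  "(complex ^ 'n::{finite,linorder}) set \<Rightarrow> 'n set \<Rightarrow> ('m::{finite,linorder}, 'n) slice_fun" where
  "coord_cnj_prod D T x = ordered_prod (\<lambda>t. coord_cnj D t x) T"


subsection \<open>Slice, slice regular and circular with respect to one variable\<close>

definition subst_at :: "'n::finite \<Rightarrow> 'a ^ 'n \<Rightarrow> 'a \<Rightarrow> 'a ^ 'n" where
  "subst_at h y x = (\<chi> l. if l = h then x else y $ l)"

definition section_dom ::
  "(complex ^ 'n::{finite,linorder}) set \<Rightarrow> 'n \<Rightarrow>
   'm::{finite,linorder} clifford ^ 'n::{finite,linorder} \<Rightarrow> 'm clifford set" where
  "section_dom D h y = {x. subst_at h y x \<in> Omega D}"

definition slice_fns_at ::
  "'n \<Rightarrow> (complex ^ 'n::{finite,linorder}) set \<Rightarrow> ('m::{finite,linorder}, 'n) slice_fun set" where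
  "slice_fns_at h D = {f \<in> slice_fns D.
     \<forall>y\<in>Omega D. is_slice1 (section_dom D h y) (\<lambda>x. f (subst_at h y x))}"

definition slice_regular_fns_at ::
  "'n \<Rightarrow> (complex ^ 'n::{finite,linorder}) set \<Rightarrow> ('m::{finite,linorder}, 'n) slice_fun set" where
  "slice_regular_fns_at h D = {f \<in> slice_fns D.
     \<forall>y\<in>Omega D. is_slice_regular1 (section_dom D h y) (\<lambda>x. f (subst_at h y x))}"

definition circular_fns_at ::
  "'n \<Rightarrow> (complex ^ 'n::{finite,linorder}) set \<Rightarrow> ('m::{finite,linorder}, 'n) slice_fun set" where
  "circular_fns_at h D = {f \<in> slice_fns D.
     \<forall>y\<in>Omega D. is_circular1 (section_dom D h y) (\<lambda>x. f (subst_at h y x))}"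

definition circular_fns ::
  "'n set \<Rightarrow> (complex ^ 'n::{finite,linorder}) set \<Rightarrow> ('m::{finite,linorder}, 'n) slice_fun set" where
  "circular_fns H D = slice_fns D \<inter> (\<Inter>h\<in>H. circular_fns_at h D)"


subsection \<open>Spherical derivatives\<close>

text \<open>\<open>nonreal D H\<close> is the set \<open>D_H\<close>, and \<open>Omega (nonreal D H)\<close> is \<open>\<Omega>_{D_H}\<close>.\<close>

definition nonreal :: "(complex ^ 'n::finite) set \<Rightarrow> 'n set \<Rightarrow> (complex ^ 'n) set" where
  "nonreal D H = {z \<in> D. \<forall>h\<in>H. Im (z $ h) \<noteq> 0}"

definition spherical_stem ::
  "'n::finite set \<Rightarrow> ('m::{finite,linorder}, 'n) stem \<Rightarrow> ('m, 'n) stem" where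
  "spherical_stem H F K z =
     (if K \<subseteq> - H then inverse (\<Prod>h\<in>H. Im (z $ h)) *\<^sub>R F (K \<union> H) z else 0)"

definition spherical_deriv ::
  "(complex ^ 'n::{finite,linorder}) set \<Rightarrow> 'n set \<Rightarrow> ('m::{finite,linorder}, 'n) slice_fun \<Rightarrow> ('m, 'n) slice_fun" where
  "spherical_deriv D H f = slice_ind (nonreal D H) (spherical_stem H (stem_of D f))"

text \<open>
  \<open>S_comp D H K f\<close> is \<open>\<S>\<^sup>H_K(f) = (x_{k_1} \<odot> \<cdots> \<odot> x_{k_p} \<odot> f)'_{s,H}\<close> with the product associated
  to the right.  For \<open>H = K = {}\<close> it is \<open>f\<close> on \<open>Omega D\<close>, without a separate convention.
\<close>

definition S_comp ::
  "(complex ^ 'n::{finite,linorder}) set \<Rightarrow> 'n set \<Rightarrow> 'n set \<Rightarrow>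
   ('m::{finite,linorder}, 'n) slice_fun \<Rightarrow> ('m, 'n) slice_fun" where
  "S_comp D H K f =
     spherical_deriv D H (foldr (\<lambda>k g. slice_prod D (coord D k) g) (sorted_list_of_set K) f)"


subsection \<open>The Laplacian in one paravector variable\<close>

definition partial_dir ::
  "'n::finite \<Rightarrow> 'm::{finite,linorder} clifford \<Rightarrow> ('m, 'n) slice_fun \<Rightarrow> ('m, 'n) slice_fun" where
  "partial_dir h v g x = vector_derivative (\<lambda>t. g (x + t *\<^sub>R axis h v)) (at 0)"

text \<open>The \<open>m + 1\<close> real coordinates of \<open>x_h\<close> are those along \<open>1\<close> and the generators.\<close>

definition laplacian ::
  "'n::finite \<Rightarrow> ('m::{finite,linorder}, 'n) slice_fun \<Rightarrow> ('m, 'n) slice_fun" where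
  "laplacian h g x = partial_dir h 1 (partial_dir h 1 g) x +
     (\<Sum>i\<in>UNIV. partial_dir h (cl_gen i) (partial_dir h (cl_gen i) g) x)"

definition first_indices :: "nat \<Rightarrow> 'n::{finite,linorder} set" where
  "first_indices q = {h. card {..h} \<le> q}"

end

theory Submission
  imports Defs "HOL-Complex_Analysis.Conformal_Mappings"
begin

text \<open>
The stem components are recovered from the values of a slice function by flipping the signs of the
imaginary units, since the characters of \<open>(\<int>/2)\<^sup>n\<close> are orthogonal. On stem functions,
multiplication by \<open>x\<^sub>h\<close> and the spherical derivative \<open>\<partial>\<^sub>h\<close> satisfy \<open>\<partial>\<^sub>h x\<^sub>h - x\<^sub>h\<^sup>c \<partial>\<^sub>h = id\<close>,
where \<open>x\<^sub>h\<^sup>c\<close> is the conjugate coordinate;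
multiplying these identities over \<open>h \<in> H\<close> gives the decomposition in part 1.

As a function of \<open>x\<^sub>h\<close> with \<open>h \<in> H\<close>, a component is \<open>B / r\<close> with \<open>B\<close> harmonic in \<open>(\<alpha>, r)\<close>. The Laplacian
in \<open>m + 1\<close> variables sends \<open>((1/r) \<partial>\<^sub>r)\<^sup>k (B / r)\<close> to a multiple of the next such iterate, with a factor
\<open>m - 3 - 2k\<close>, which vanishes at the last of the \<open>(m - 1) / 2\<close> steps.

In the converse of part 4 the hypotheses only say that \<open>\<Phi> = \<Sum>\<^sub>K i\<^bsup>|K|\<^esup> F\<^sub>K\<close> is holomorphic in each
\<open>z\<^sub>q\<close> separately, at points where the earlier variables are not real. That \<open>F\<close> is jointly \<open>C\<^sup>1\<close> is
therefore Hartogs' theorem on separate holomorphy, in a form that allows an exceptional real line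
in each variable. A Baire argument bounds \<open>\<Phi>\<close> on a smaller polydisc; the Taylor coefficients along
complex lines are controlled with a two-constants estimate for measurable exceptional sets.
The Cauchy-Riemann equations on the excluded lines then follow by continuity.
\<close>

subsection \<open>A two-constants theorem\<close>

text \<open>Part 4 is the analytic part. The set \<open>{..<p}\<close> has a complement with minimum
  p, so its components control the variable p, for every p, but they do so in that variable alone
  and only at points whose earlier coordinates are not real. Passing to joint regularity is an
  interpolation problem. The Taylor coefficients in the other variables obey a weak bound that is
  uniform in the parameter \<zeta>, and a strong bound whose constant depends on \<zeta> and may
  blow up at the exceptional line. The sets where that constant is large shrink to a null set, and
  averaging log |f| over small squares merges both bounds into a uniform one, with an arbitrarily
  small loss in the exponent. Minima of complements occur in parts 2 and 4 because a function is
  slice in one variable only if the imaginary unit of that variable can be written to the left of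
  everything else. The units are multiplied in increasing order, and a component for H involves no
  unit with index in H, so the unit with index min of the complement comes first.\<close>

lemma max_modulus_centre:
  assumes "f holomorphic_on ball 0 r" "1 < r"
  obtains z :: complex where "norm z = 1" "norm (f 0) \<le> norm (f z)"
proof -
  have c: "continuous_on (cball 0 1) f"
    by (intro holomorphic_on_imp_continuous_on holomorphic_on_subset[OF assms(1)]) (use assms in auto)
  have "compact (sphere (0::complex) 1)" "sphere (0::complex) 1 \<noteq> {}" by auto
  moreover have "continuous_on (sphere 0 1) (\<lambda>z. norm (f z))"
    by (intro continuous_intros continuous_on_subset[OF c]) auto
  ultimately obtain z where z: "z \<in> sphere 0 1" "\<And>w. w \<in> sphere 0 1 \<Longrightarrow> norm (f w) \<le> norm (f z)"
    by (metis continuous_attains_sup)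
  have "norm (f 0) \<le> norm (f z)"
  proof (rule maximum_modulus_frontier[of f "cball 0 1"])
    show "f holomorphic_on interior (cball 0 1)"
      using assms by (auto intro: holomorphic_on_subset)
  qed (use c z in auto)
  with z that show ?thesis by auto
qed

text \<open>The exponent k is the integer part of arg z divided by 2 pi / N. What remains is a point
  on the arc of that length starting at 1, and a chord is no longer than its arc.\<close>

lemma unit_rotate_near_one:
  assumes "norm z = 1" "0 < N"
  obtains k z' where "z = cis (2 * pi / real N) ^ k * z'" "norm (z' - 1) \<le> 2 * pi / real N"
    "norm z' = 1"
proof -
  define t where "t = Arg2pi z"
  have z: "z = cis t" "0 \<le> t"
    using assms(1) unfolding t_def by (simp_all add: cis_conv_exp Arg2pi_eq[symmetric] Arg2pi_ge_0)
      (metis Arg2pi_eq mult_1 of_real_1 mult.commute)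
  define d where "d = 2 * pi / real N"
  have d: "0 < d" using assms by (simp add: d_def)
  define k where "k = nat \<lfloor>t / d\<rfloor>"
  have k: "real k * d \<le> t" "t < real k * d + d"
  proof -
    have "0 \<le> t / d" using z d by simp
    hence "real k = of_int \<lfloor>t / d\<rfloor>" by (simp add: k_def)
    thus "real k * d \<le> t" "t < real k * d + d"
      using floor_divide_lower[OF d, of t] floor_divide_upper[OF d, of t] by (simp_all add: algebra_simps)
  qed
  have "norm (cis (t - real k * d) - 1) \<le> \<bar>t - real k * d\<bar>"
    using dist_exp_i_1[of "t - real k * d"] abs_sin_x_le_abs_x[of "(t - real k * d)/2"]
    by (simp add: cis_conv_exp mult.commute)
  moreover have "z = cis d ^ k * cis (t - real k * d)"
    unfolding z(1) Complex.DeMoivre cis_mult by simp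
  ultimately show ?thesis using that[of k "cis (t - real k * d)"] k by (simp add: d_def)
qed

text \<open>The product of the rotates \<open>f (c + a \<omega>\<^sup>j z)\<close> over the \<open>N\<close>-th roots of unity is invariant under
  \<open>z \<mapsto> \<omega> z\<close>, so the maximum principle may be used near \<open>z = 1\<close> only.\<close>

lemma log_submean_roots_of_unity:
  fixes f :: "complex \<Rightarrow> complex"
  assumes hol: "f holomorphic_on ball c R" and s: "0 < s" "s < R" and "0 < \<eta>" "0 < \<epsilon>"
  defines "\<psi> \<equiv> \<lambda>z. ln (max (norm (f z)) \<eta>)"
  obtains N where "0 < N"
    "\<And>a. norm a \<le> s \<Longrightarrow> \<psi> c \<le> (\<Sum>j<N. \<psi> (c + cis (2 * pi / real N) ^ j * a)) / real N + \<epsilon>"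
proof -
  have cf: "continuous_on (cball c s) f"
    by (intro holomorphic_on_imp_continuous_on holomorphic_on_subset[OF hol]) (use s in auto)
  have c\<psi>: "continuous_on (cball c s) \<psi>"
    unfolding \<psi>_def using \<open>0 < \<eta>\<close> by (intro continuous_intros cf) (auto simp: max_def)
  hence "uniformly_continuous_on (cball c s) \<psi>"
    by (simp add: compact_uniformly_continuous)
  then obtain \<delta> where \<delta>: "0 < \<delta>"
    "\<And>x y. x \<in> cball c s \<Longrightarrow> y \<in> cball c s \<Longrightarrow> dist x y < \<delta> \<Longrightarrow> dist (\<psi> x) (\<psi> y) < \<epsilon>"
    using \<open>0 < \<epsilon>\<close> unfolding uniformly_continuous_on_def by metis
  \<comment> \<open>Arcs of length 2 pi s / N are then shorter than \<delta>. As only |a| \<le> s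
    enters, one N serves all a.\<close>
  obtain N :: nat where N: "2 * pi * s / \<delta> < real N" using reals_Archimedean2 by blast
  have N0: "0 < N"
    using N \<delta> s by (metis divide_pos_pos gr0I less_asym' mult_pos_pos of_nat_0 pi_gt_zero zero_less_numeral)
  define \<omega> where "\<omega> = cis (2 * pi / real N)"
  have "\<omega> ^ N = cis (2 * pi)" using N0 by (simp add: \<omega>_def Complex.DeMoivre del: cis_2pi)
  hence wN: "\<omega> ^ N = 1" and nw: "norm \<omega> = 1" by (simp_all add: \<omega>_def)
  show ?thesis
  proof (rule that[OF N0], unfold \<omega>_def[symmetric])
    fix a :: complex assume a: "norm a \<le> s"
    define F where "F z = (\<Prod>j<N. f (c + \<omega> ^ j * a * z))" for z
    have inv: "F (\<omega> * z) = F z" for z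
    proof -
      have "F (\<omega> * z) = (\<Prod>j<N. f (c + \<omega> ^ Suc j * a * z))"
        unfolding F_def by (intro prod.cong refl) (simp add: algebra_simps)
      also have "\<dots> = F z"
      proof -
        obtain M where M: "N = Suc M" using N0 by (metis Suc_pred)
        have "(\<Prod>j<N. f (c + \<omega> ^ Suc j * a * z)) = (\<Prod>j<M. f (c + \<omega> ^ Suc j * a * z)) * f (c + \<omega> ^ N * a * z)"
          by (simp add: M)
        also have "\<dots> = f (c + \<omega> ^ 0 * a * z) * (\<Prod>j<M. f (c + \<omega> ^ Suc j * a * z))"
          by (simp add: wN)
        also have "\<dots> = F z"
          unfolding F_def M by (simp only: prod.lessThan_Suc_shift o_def)
        finally show ?thesis .
      qed
      finally show ?thesis .
    qed
    have invk: "F (\<omega> ^ k * z) = F z" for k z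
      by (induction k) (simp_all add: inv mult.assoc)
    have "\<exists>z. norm z = 1 \<and> norm (F 0) \<le> norm (F z)"
    proof (rule max_modulus_centre)
      show "F holomorphic_on ball 0 (R / s)"
        unfolding F_def
      proof (intro holomorphic_on_prod)
        fix j assume "j \<in> {..<N}"
        have "(\<lambda>z. c + \<omega> ^ j * a * z) ` ball 0 (R / s) \<subseteq> ball c R"
        proof clarsimp
          fix z :: complex assume z: "norm z < R / s"
          have "norm (\<omega> ^ j * a * z) = norm a * norm z" by (simp add: norm_mult norm_power nw)
          also have "\<dots> \<le> s * norm z" using a by (simp add: mult_right_mono)
          also have "\<dots> < R" using z s by (simp add: field_simps)
          finally show "dist c (c + \<omega> ^ j * a * z) < R" by (simp add: dist_norm)
        qed
        thus "(\<lambda>z. f (c + \<omega> ^ j * a * z)) holomorphic_on ball 0 (R / s)"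
          by (intro holomorphic_on_compose_gen[OF _ hol, unfolded o_def] holomorphic_intros)
      qed
      show "1 < R / s" using s by simp
    qed blast
    then obtain z where z: "norm z = 1" "norm (F 0) \<le> norm (F z)" by blast
    obtain k z' where k: "z = \<omega> ^ k * z'" "norm (z' - 1) \<le> 2 * pi / real N" "norm z' = 1"
      using unit_rotate_near_one[OF z(1) N0] unfolding \<omega>_def by metis
    let ?g = "\<lambda>z. max (norm (f z)) \<eta>"
    have gpos: "?g z > 0" for z using \<open>0 < \<eta>\<close> by auto
    \<comment> \<open>Truncation at \<eta> keeps the logarithm finite at zeros of f. If |f c| \<le>
      \<eta>, every factor is at least \<eta> anyway; otherwise this is the maximum principle for F,
      transported to z' by rotation invariance.\<close>
    have "?g c ^ N \<le> (\<Prod>j<N. ?g (c + \<omega> ^ j * a * z'))"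
    proof (cases "norm (f c) \<le> \<eta>")
      case True
      have "\<eta> ^ N = (\<Prod>j<N. \<eta>)" by simp
      also have "\<dots> \<le> (\<Prod>j<N. ?g (c + \<omega> ^ j * a * z'))"
        using \<open>0 < \<eta>\<close> by (intro prod_mono) auto
      finally show ?thesis using True by (simp add: max_def)
    next
      case False
      hence "?g c ^ N = norm (F 0)" by (simp add: F_def norm_power)
      also have "\<dots> \<le> norm (F z')" using z(2) by (simp add: k(1) invk)
      also have "\<dots> \<le> (\<Prod>j<N. ?g (c + \<omega> ^ j * a * z'))"
        unfolding F_def prod_norm[symmetric] by (intro prod_mono) auto
      finally show ?thesis .
    qed
    hence "ln (?g c ^ N) \<le> ln (\<Prod>j<N. ?g (c + \<omega> ^ j * a * z'))"
      using gpos by (subst ln_le_cancel_iff) (auto intro!: prod_pos zero_less_power)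
    also have "\<dots> = (\<Sum>j<N. \<psi> (c + \<omega> ^ j * a * z'))"
      unfolding \<psi>_def by (rule ln_prod) (simp, metis gpos less_irrefl)
    \<comment> \<open>Replacing z' by 1 moves each sample point by less than \<delta>, which changes
      \<psi> by less than \<epsilon>.\<close>
    also have "\<dots> \<le> (\<Sum>j<N. \<psi> (c + \<omega> ^ j * a) + \<epsilon>)"
    proof (intro sum_mono)
      fix j
      have n: "norm (\<omega> ^ j * a * w) \<le> s" if "norm w = 1" for w
        using a that by (simp add: norm_mult norm_power nw)
      have "\<omega> ^ j * a * z' - \<omega> ^ j * a = \<omega> ^ j * a * (z' - 1)" by (simp add: algebra_simps)
      hence "norm (\<omega> ^ j * a * z' - \<omega> ^ j * a) = norm a * norm (z' - 1)"
        by (simp only: norm_mult norm_power nw) simp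
      also have "\<dots> \<le> s * (2 * pi / real N)" using a k(2) s by (intro mult_mono) auto
      also have "\<dots> < \<delta>" using N \<delta> N0 by (simp add: field_simps)
      finally have "dist (c + \<omega> ^ j * a * z') (c + \<omega> ^ j * a) < \<delta>" by (simp add: dist_norm)
      hence "dist (\<psi> (c + \<omega> ^ j * a * z')) (\<psi> (c + \<omega> ^ j * a)) < \<epsilon>"
        using n[OF k(3)] n[of 1] by (intro \<delta>(2)) (auto simp: dist_norm)
      thus "\<psi> (c + \<omega> ^ j * a * z') \<le> \<psi> (c + \<omega> ^ j * a) + \<epsilon>" by (simp add: dist_real_def)
    qed
    also have "\<dots> = (\<Sum>j<N. \<psi> (c + \<omega> ^ j * a)) + real N * \<epsilon>" by (simp add: sum.distrib)
    finally have "real N * \<psi> c \<le> (\<Sum>j<N. \<psi> (c + \<omega> ^ j * a)) + real N * \<epsilon>"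
      using gpos[of c] by (simp add: \<psi>_def ln_realpow)
    thus "\<psi> c \<le> (\<Sum>j<N. \<psi> (c + \<omega> ^ j * a)) / real N + \<epsilon>" using N0 by (simp add: field_simps)
  qed
qed

lemma integral_le_on_large_subset:
  fixes \<psi> :: "'a::euclidean_space \<Rightarrow> real"
  assumes "continuous_on (cbox a b) \<psi>" "bad \<in> lmeasurable" "bad \<subseteq> cbox a b"
    "\<And>x. x \<in> cbox a b \<Longrightarrow> \<psi> x \<le> 0" "\<And>x. x \<in> cbox a b - bad \<Longrightarrow> \<psi> x \<le> L"
  shows "integral (cbox a b) \<psi> \<le> L * (measure lebesgue (cbox a b) - measure lebesgue bad)"
proof -
  have m: "cbox a b - bad \<in> lmeasurable" using assms(2) by (simp add: fmeasurable.Diff)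
  have "((\<lambda>x. 1::real) has_integral measure lebesgue (cbox a b - bad)) (cbox a b - bad)"
    using m lmeasurable_iff_integrable_on lmeasure_integral[OF m] by (metis integrable_integral)
  hence "((\<lambda>x. L * 1) has_integral L * measure lebesgue (cbox a b - bad)) (cbox a b - bad)"
    by (rule has_integral_mult_right)
  hence I: "((\<lambda>x. if x \<in> cbox a b - bad then L else 0) has_integral L * measure lebesgue (cbox a b - bad)) (cbox a b)"
    by (subst has_integral_restrict) auto
  have "integral (cbox a b) \<psi> \<le> L * measure lebesgue (cbox a b - bad)"
    using assms by (intro has_integral_le[OF integrable_integral I] integrable_continuous) auto
  also have "measure lebesgue (cbox a b - bad) = measure lebesgue (cbox a b) - measure lebesgue bad"
    using assms by (intro measurable_measure_Diff) auto
  finally show ?thesis .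
qed

text \<open>Areas are computed on \<open>real^2\<close>, where rotations are orthogonal
  transformations and preserve Lebesgue measure.\<close>

definition cplx2 :: "real^2 \<Rightarrow> complex" where "cplx2 p = Complex (p $ 1) (p $ 2)"

lemma continuous_cplx2 [continuous_intros]:
  "continuous_on S g \<Longrightarrow> continuous_on S (\<lambda>x. cplx2 (g x))"
  unfolding cplx2_def by (intro continuous_intros)

lemma norm_cplx2: "norm (cplx2 p) = norm p"
  by (simp add: cplx2_def norm_vec_def L2_set_def sum_2 cmod_def)

text \<open>Since |u| = 1, the map p to \<zeta> + u p is an isometry of the plane, and S lies in the
  preimage of B. The inverse is multiplication by \<open>cnj u\<close> after a translation.\<close>

lemma measure_rotated_preimage_le:
  fixes u \<zeta> :: complex
  assumes u: "norm u = 1" and B: "B \<in> lmeasurable" and S: "S \<in> lmeasurable"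
    and sub: "\<And>p. p \<in> S \<Longrightarrow> \<exists>q\<in>B. \<zeta> + u * cplx2 p = cplx2 q"
  shows "measure lebesgue S \<le> measure lebesgue B"
proof -
  define q0 :: "real^2" where "q0 = vector [Re \<zeta>, Im \<zeta>]"
  define \<rho> :: "real^2 \<Rightarrow> real^2"
    where "\<rho> p = vector [Re (cnj u * cplx2 p), Im (cnj u * cplx2 p)]" for p
  have c\<rho>: "cplx2 (\<rho> p) = cnj u * cplx2 p" for p by (simp add: \<rho>_def cplx2_def complex_eq_iff)
  have q0: "cplx2 q0 = \<zeta>" by (simp add: q0_def cplx2_def)
  have inj: "p = q" if "cplx2 p = cplx2 q" for p q
    using that by (simp add: cplx2_def vec_eq_iff forall_2)
  have uu: "cnj u * u = 1" using complex_norm_square[of u] u by (simp add: mult.commute)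
  have lin: "linear \<rho>"
    by (rule linearI) (simp_all add: \<rho>_def vec_eq_iff forall_2 cplx2_def algebra_simps)
  have orth: "orthogonal_transformation \<rho>"
    unfolding orthogonal_transformation using lin u
    by (auto simp: norm_cplx2[symmetric] c\<rho> norm_mult)
  have "S \<subseteq> \<rho> ` ((\<lambda>x. x - q0) ` B)"
  proof
    fix p assume "p \<in> S"
    then obtain q where q: "q \<in> B" "\<zeta> + u * cplx2 p = cplx2 q" using sub by blast
    have "cplx2 (q - q0) = u * cplx2 p"
      using q(2) q0 by (simp add: cplx2_def complex_eq_iff algebra_simps) 
    hence "cplx2 (\<rho> (q - q0)) = cplx2 p" by (simp add: c\<rho> mult.assoc[symmetric] uu)
    hence "p = \<rho> (q - q0)" using inj by metis
    thus "p \<in> \<rho> ` ((\<lambda>x. x - q0) ` B)" using q by blast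
  qed
  hence "measure lebesgue S \<le> measure lebesgue (\<rho> ` ((\<lambda>x. x - q0) ` B))"
    using S measurable_orthogonal_image[OF orth measurable_translation_subtract[OF B]]
    by (intro measure_mono_fmeasurable) auto
  also have "\<dots> = measure lebesgue B"
    by (simp add: measure_orthogonal_image[OF orth measurable_translation_subtract[OF B]]
        measure_translation_subtract)
  finally show ?thesis .
qed

text \<open>Continuity of measure from above: the complements decrease to a subset of the horizontal
  line Im = c, which is a null set.\<close>

lemma exhausting_closed_small_complement:
  fixes A :: "nat \<Rightarrow> complex set"
  assumes cl: "\<And>t. closed (A t)" and mono: "incseq A"
    and cov: "\<And>\<zeta>. norm \<zeta> \<le> 1 \<Longrightarrow> Im \<zeta> \<noteq> c \<Longrightarrow> \<exists>t. \<zeta> \<in> A t" and e: "0 < e"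
  obtains t where "{p. norm p \<le> 1 \<and> cplx2 p \<notin> A t} \<in> lmeasurable"
    "measure lebesgue {p. norm p \<le> 1 \<and> cplx2 p \<notin> A t} < e"
proof -
  define B where "B t = {p. norm p \<le> 1 \<and> cplx2 p \<notin> A t}" for t
  have B: "B t \<in> lmeasurable" for t
  proof -
    have "B t = cball 0 1 - cplx2 -` A t" by (auto simp: B_def)
    moreover have "closed (cplx2 -` A t)"
      by (rule closed_vimage[OF cl]) (intro continuous_intros)
    ultimately show ?thesis
      by (simp only:) (intro fmeasurable_Diff lmeasurable_cball, simp add: borel_closed)
  qed
  have "(\<lambda>t. measure lebesgue (B t)) \<longlonglongrightarrow> measure lebesgue (\<Inter>t. B t)"
  proof (rule Lim_measure_decseq)
    show "range B \<subseteq> sets lebesgue" using B by auto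
    show "decseq B" using mono by (auto simp: decseq_def incseq_def B_def)
    show "emeasure lebesgue (B i) \<noteq> \<infinity>" for i
      using B[of i] by (auto simp: fmeasurable_def)
  qed
  moreover have "measure lebesgue (\<Inter>t. B t) = 0"
  proof -
    have "negligible {p :: real^2. axis 2 1 \<bullet> p = c}"
      by (rule negligible_hyperplane) auto
    moreover have "(\<Inter>t. B t) \<subseteq> {p :: real^2. axis 2 1 \<bullet> p = c}"
    proof
      fix p assume p: "p \<in> (\<Inter>t. B t)"
      hence "Im (cplx2 p) = c" using cov[of "cplx2 p"] by (auto simp: B_def norm_cplx2)
      thus "p \<in> {p. axis 2 1 \<bullet> p = c}" by (simp add: cplx2_def inner_axis' )
    qed
    ultimately have "negligible (\<Inter>t. B t)" by (rule negligible_subset)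
    thus ?thesis by (simp add: negligible_imp_measure0)
  qed
  ultimately have "\<forall>\<^sub>F t in sequentially. measure lebesgue (B t) < e"
    using e by (simp add: order_tendsto_iff)
  then obtain t where "measure lebesgue (B t) < e"
    by (meson eventually_sequentially order_refl)
  thus ?thesis using that B unfolding B_def by blast
qed


text \<open>The function log max(|f|, \<eta>) is at most 0 on the disc and at most ln \<eta> on
  \<open>A t\<close>. Averaging the sub-mean inequality over a square gives at most (1 - \<epsilon>)
  ln \<eta>, once the complement of \<open>A t\<close> takes up at most the fraction \<epsilon> of
  every rotated square. The index t depends on \<open>A\<close> and \<epsilon> only and is fixed
  before f and \<eta>, so it can be used for infinitely many functions at once.\<close>

lemma two_constants:
  fixes A :: "nat \<Rightarrow> complex set"
  assumes cl: "\<And>t. closed (A t)" and mono: "incseq A"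
    and cov: "\<And>\<zeta>. norm \<zeta> \<le> 1 \<Longrightarrow> Im \<zeta> \<noteq> c \<Longrightarrow> \<exists>t. \<zeta> \<in> A t" and e: "0 < \<epsilon>"
  obtains t where "\<And>(f :: complex \<Rightarrow> complex) \<eta> (\<zeta> :: complex). \<lbrakk>f holomorphic_on ball 0 1; \<And>\<zeta>. \<zeta> \<in> ball 0 1 \<Longrightarrow> norm (f \<zeta>) \<le> 1;
    0 < \<eta>; \<eta> < 1; \<And>\<zeta>. \<zeta> \<in> A t \<inter> ball 0 1 \<Longrightarrow> norm (f \<zeta>) \<le> \<eta>; norm \<zeta> < 1/4\<rbrakk>
    \<Longrightarrow> norm (f \<zeta>) \<le> \<eta> powr (1 - \<epsilon>)"
proof -
  \<comment> \<open>The side 1/4 gives |a| \<le> 1/2 on the square, so \<zeta> + u a stays in the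
    disc of radius 3/4 when |\<zeta>| < 1/4. The area 1/16 is the reason for the threshold
    \<epsilon> / 16 below.\<close>
  define Q :: "(real^2) set" where "Q = cbox 0 (\<chi> i. 1/4)"
  have Qn: "norm a \<le> 1/2" if "a \<in> Q" for a
  proof -
    have "norm a \<le> (\<Sum>i\<in>UNIV. \<bar>a $ i\<bar>)" by (rule norm_le_l1_cart)
    also have "\<dots> \<le> (\<Sum>i\<in>(UNIV::2 set). 1/4)"
      using that by (intro sum_mono) (auto simp: Q_def mem_box_cart)
    finally show ?thesis by simp
  qed
  have mQ: "measure lebesgue Q = 1/16"
    unfolding Q_def by (simp add: content_cbox_cart interval_ne_empty_cart prod_2 power2_eq_square)
  obtain t where t: "{p. norm p \<le> 1 \<and> cplx2 p \<notin> A t} \<in> lmeasurable"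
    "measure lebesgue {p. norm p \<le> 1 \<and> cplx2 p \<notin> A t} < \<epsilon> / 16"
  proof (rule exhausting_closed_small_complement[of A c "\<epsilon> / 16"])
    show "\<exists>t. \<zeta> \<in> A t" if "norm \<zeta> \<le> 1" "Im \<zeta> \<noteq> c" for \<zeta>
      using cov that by blast
  qed (use cl mono e in simp_all)
  show ?thesis
  proof (rule that[of t])
    fix f :: "complex \<Rightarrow> complex" and \<eta> and \<zeta> :: complex
    assume hol: "f holomorphic_on ball 0 1" and f1: "\<And>\<zeta>. \<zeta> \<in> ball 0 1 \<Longrightarrow> norm (f \<zeta>) \<le> 1"
      and \<eta>: "0 < \<eta>" "\<eta> < (1::real)" and fA: "\<And>\<zeta>. \<zeta> \<in> A t \<inter> ball 0 1 \<Longrightarrow> norm (f \<zeta>) \<le> \<eta>"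
      and z: "norm \<zeta> < 1/4"
    define \<psi> where "\<psi> z = ln (max (norm (f z)) \<eta>)" for z
    have in1: "\<zeta> + u * cplx2 a \<in> ball 0 1" if "a \<in> Q" "norm u = 1" for u a
    proof -
      have "norm (\<zeta> + u * cplx2 a) \<le> norm \<zeta> + norm (u * cplx2 a)" by (rule norm_triangle_ineq)
      also have "\<dots> < 1" using z Qn[OF that(1)] that(2) by (simp add: norm_mult norm_cplx2)
      finally show ?thesis by simp
    qed
    have \<psi>c: "continuous_on (ball 0 1) \<psi>"
      unfolding \<psi>_def using \<eta> holomorphic_on_imp_continuous_on[OF hol]
      by (intro continuous_intros) (auto simp: max_def)
    have \<psi>Q: "continuous_on Q (\<lambda>a. \<psi> (\<zeta> + u * cplx2 a))" if "norm u = 1" for u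
      by (rule continuous_on_compose2[OF \<psi>c]) (use in1 that in \<open>auto intro!: continuous_intros\<close>)
    have int: "integral Q (\<lambda>a. \<psi> (\<zeta> + u * cplx2 a)) \<le> ln \<eta> * (1 - \<epsilon>) / 16" if u: "norm u = 1" for u
    proof -
      let ?bad = "{a \<in> Q. \<zeta> + u * cplx2 a \<notin> A t}"
      have bm: "?bad \<in> lmeasurable"
      proof -
        have "?bad = Q - (\<lambda>a. \<zeta> + u * cplx2 a) -` A t" by auto
        moreover have "closed ((\<lambda>a. \<zeta> + u * cplx2 a) -` A t)"
          by (rule closed_vimage[OF cl]) (intro continuous_intros)
        ultimately show ?thesis
          unfolding Q_def by (simp only:) (intro fmeasurable_Diff lmeasurable_cbox, simp add: borel_closed)
      qed
      \<comment> \<open>The bad part of the square is carried isometrically into the complement of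
        \<open>A t\<close> in the unit disc, so the same t works for all centres \<zeta> and all
        rotations u.\<close>
      have "measure lebesgue ?bad \<le> measure lebesgue {p. norm p \<le> 1 \<and> cplx2 p \<notin> A t}"
      proof (rule measure_rotated_preimage_le[OF u t(1) bm])
        fix p assume p: "p \<in> ?bad"
        define q :: "real^2" where "q = vector [Re (\<zeta> + u * cplx2 p), Im (\<zeta> + u * cplx2 p)]"
        have q: "cplx2 q = \<zeta> + u * cplx2 p" by (simp add: q_def cplx2_def complex_eq_iff)
        moreover have "norm q \<le> 1" using in1[of p u] p u q by (simp flip: norm_cplx2)
        ultimately show "\<exists>q\<in>{p. norm p \<le> 1 \<and> cplx2 p \<notin> A t}. \<zeta> + u * cplx2 p = cplx2 q"
          using p by (intro bexI[of _ q]) auto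
      qed
      hence bad: "measure lebesgue ?bad \<le> \<epsilon> / 16" using t by linarith
      have "integral Q (\<lambda>a. \<psi> (\<zeta> + u * cplx2 a)) \<le> ln \<eta> * (measure lebesgue Q - measure lebesgue ?bad)"
      proof (rule integral_le_on_large_subset[of "0 :: real^2" "\<chi> i. 1/4", folded Q_def])
        fix a assume a: "a \<in> Q"
        show "\<psi> (\<zeta> + u * cplx2 a) \<le> 0"
          unfolding \<psi>_def using f1[OF in1[OF a u]] \<eta> by (subst ln_le_zero_iff) auto
      next
        fix a assume a: "a \<in> Q - ?bad"
        hence "norm (f (\<zeta> + u * cplx2 a)) \<le> \<eta>" using in1[of a u] u by (intro fA) auto
        thus "\<psi> (\<zeta> + u * cplx2 a) \<le> ln \<eta>" by (simp add: \<psi>_def max_def)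
      qed (use \<psi>Q[OF u] bm in auto)
      also have "\<dots> \<le> ln \<eta> * (1/16 - \<epsilon> / 16)"
        using bad \<eta> mQ by (intro mult_left_mono_neg) auto
      finally show ?thesis by (simp add: algebra_simps)
    qed
    have "\<psi> \<zeta> \<le> ln \<eta> * (1 - \<epsilon>) + e'" if e': "0 < e'" for e'
    proof -
      have "f holomorphic_on ball \<zeta> (3/4)"
      proof (rule holomorphic_on_subset[OF hol])
        show "ball \<zeta> (3/4) \<subseteq> ball 0 1" using z by (simp add: ball_subset_ball_iff dist_norm)
      qed
      then obtain N where N: "0 < N" "\<And>a. norm a \<le> 1/2 \<Longrightarrow>
          \<psi> \<zeta> \<le> (\<Sum>j<N. \<psi> (\<zeta> + cis (2 * pi / real N) ^ j * a)) / real N + e'"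
        using log_submean_roots_of_unity[of f \<zeta> "3/4" "1/2" \<eta> e'] \<eta> e' unfolding \<psi>_def by auto
      define w where "w j = cis (2 * pi / real N) ^ j" for j :: nat
      have w: "norm (w j) = 1" for j by (simp add: w_def norm_power)
      have iw: "(\<lambda>a. \<psi> (\<zeta> + w j * cplx2 a)) integrable_on Q" for j
        unfolding Q_def by (intro integrable_continuous \<psi>Q[unfolded Q_def] w)
      have ic: "(\<lambda>a. k::real) integrable_on Q" for k
        unfolding Q_def by (intro integrable_continuous continuous_intros)
      have "integral Q (\<lambda>a. k::real) = measure lebesgue Q * k" for k by (simp add: Q_def)
      hence ik: "integral Q (\<lambda>a. k::real) = k / 16" for k unfolding mQ by simp
      \<comment> \<open>The sub-mean inequality is integrated over a in the square. Each of the N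
        rotations contributes an integral bounded by \<open>int\<close>, hence so does their
        mean.\<close>
      have "integral Q (\<lambda>a. \<psi> \<zeta>) \<le> integral Q (\<lambda>a. (\<Sum>j<N. \<psi> (\<zeta> + w j * cplx2 a)) / real N + e')"
        using N(2) Qn by (intro integral_le ic integrable_add integrable_sum integrable_on_divide iw)
          (auto simp: w_def norm_cplx2)
      also have "\<dots> = (\<Sum>j<N. integral Q (\<lambda>a. \<psi> (\<zeta> + w j * cplx2 a))) / real N + integral Q (\<lambda>a. e')"
        by (subst integral_add) (auto intro!: integrable_sum integrable_on_divide iw ic simp: integral_sum iw)
      also have "\<dots> \<le> (\<Sum>j<N. ln \<eta> * (1 - \<epsilon>) / 16) / real N + integral Q (\<lambda>a. e')"
        by (intro add_right_mono divide_right_mono sum_mono int w) simp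
      finally have "\<psi> \<zeta> / 16 \<le> ln \<eta> * (1 - \<epsilon>) / 16 + e' / 16"
        unfolding ik using N(1) by simp
      thus ?thesis by simp
    qed
    hence "\<psi> \<zeta> \<le> ln \<eta> * (1 - \<epsilon>)" by (rule field_le_epsilon)
    hence "exp (\<psi> \<zeta>) \<le> exp (ln \<eta> * (1 - \<epsilon>))" by simp
    moreover have "exp (\<psi> \<zeta>) = max (norm (f \<zeta>)) \<eta>"
      unfolding \<psi>_def using \<eta> by (intro exp_ln) auto
    ultimately show "norm (f \<zeta>) \<le> \<eta> powr (1 - \<epsilon>)"
      using \<eta> by (simp add: powr_def mult.commute)
  qed
qed

section \<open>Cauchy estimates in one variable\<close>

lemma Cauchy_coeff_bound:
  assumes hol: "f holomorphic_on ball c r" and "0 < r" and B: "\<And>z. z \<in> ball c r \<Longrightarrow> norm (f z) \<le> B"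
  shows "norm ((deriv ^^ n) f c / fact n) \<le> B / r ^ n"
proof -
  have B0: "0 \<le> B" using B[of c] \<open>0 < r\<close> by (smt (verit) centre_in_ball norm_ge_zero)
  have *: "norm ((deriv ^^ n) f c / fact n) * s ^ n \<le> B" if s: "0 < s" "s < r" for s
  proof -
    have "norm ((deriv ^^ n) f c) \<le> fact n * B / s ^ n"
    proof (rule Cauchy_inequality)
      show "f holomorphic_on ball c s" by (rule holomorphic_on_subset[OF hol]) (use s in auto)
      show "continuous_on (cball c s) f"
        by (rule holomorphic_on_imp_continuous_on, rule holomorphic_on_subset[OF hol]) (use s in auto)
      show "norm (f x) \<le> B" if "norm (c - x) = s" for x using that s by (intro B) (auto simp: dist_norm)
    qed (use s in auto)
    thus ?thesis using s by (simp add: norm_divide field_simps)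
  qed
  \<comment> \<open>Nothing is known about f on the boundary circle, so Cauchy's inequality is taken
    on circles of radius s < r and s then tends to r.\<close>
  have "((\<lambda>s. norm ((deriv ^^ n) f c / fact n) * s ^ n) \<longlongrightarrow> norm ((deriv ^^ n) f c / fact n) * r ^ n) (at_left r)"
    by (intro tendsto_intros)
  hence "norm ((deriv ^^ n) f c / fact n) * r ^ n \<le> B"
  proof (rule tendsto_upperbound)
    show "\<forall>\<^sub>F s in at_left r. norm ((deriv ^^ n) f c / fact n) * s ^ n \<le> B"
      using eventually_at_left[OF \<open>0 < r\<close>] * \<open>0 < r\<close> by blast
  qed simp
  thus ?thesis using \<open>0 < r\<close> by (simp add: field_simps)
qed

text \<open>Cauchy's bounds dominate the tail by B (|z| / r)^k times a geometric series of ratio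
  1/2, whose sum is the factor 2.\<close>

lemma Taylor_remainder_bound:
  assumes hol: "f holomorphic_on ball 0 r" and r: "0 < r" and B: "\<And>z. z \<in> ball 0 r \<Longrightarrow> norm (f z) \<le> B"
    and z: "norm z \<le> r / 2"
  shows "norm (f z - (\<Sum>i<k. (deriv ^^ i) f 0 / fact i * z ^ i)) \<le> 2 * B * (norm z / r) ^ k"
proof -
  define a where "a i = (deriv ^^ i) f 0 / fact i" for i
  have B0: "0 \<le> B" using B[of 0] r by (smt (verit) centre_in_ball norm_ge_zero)
  have "(\<lambda>i. a i * (z - 0) ^ i) sums f z"
    unfolding a_def by (rule holomorphic_power_series[OF hol]) (use z r in auto)
  hence s: "(\<lambda>i. a (i + k) * z ^ (i + k)) sums (f z - (\<Sum>i<k. a i * z ^ i))"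
    by (subst sums_iff_shift) simp
  have q: "norm z / r \<le> 1/2" "0 \<le> norm z / r" using z r by (auto simp: field_simps)
  have t: "norm (a (i + k) * z ^ (i + k)) \<le> B * (norm z / r) ^ k * (1/2) ^ i" for i
  proof -
    have "norm (a (i + k) * z ^ (i + k)) \<le> B / r ^ (i + k) * norm z ^ (i + k)"
      unfolding a_def norm_mult norm_power
      by (intro mult_right_mono Cauchy_coeff_bound hol r B) auto
    also have "\<dots> = B * (norm z / r) ^ k * (norm z / r) ^ i"
      by (simp add: power_add power_divide field_simps)
    also have "\<dots> \<le> B * (norm z / r) ^ k * (1/2) ^ i"
      using q B0 by (intro mult_left_mono power_mono) auto
    finally show ?thesis .
  qed
  have g: "(\<lambda>i. B * (norm z / r) ^ k * (1/2) ^ i) sums (B * (norm z / r) ^ k * 2)"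
    using sums_mult[OF geometric_sums[of "1/2::real"], of "B * (norm z / r) ^ k"] by simp
  have "norm (\<Sum>i. a (i + k) * z ^ (i + k)) \<le> (\<Sum>i. B * (norm z / r) ^ k * (1/2) ^ i)"
    by (rule norm_suminf_le[OF t sums_summable[OF g]])
  thus ?thesis using sums_unique[OF s] sums_unique[OF g] by (simp add: a_def mult_ac)
qed

text \<open>A disc of radius r/2 fits around each point of the half disc, so Cauchy's estimate
  bounds the derivative there by 2 B / r.\<close>

lemma bounded_holomorphic_Lipschitz:
  assumes hol: "f holomorphic_on ball c r" and r: "0 < r" and B: "\<And>z. z \<in> ball c r \<Longrightarrow> norm (f z) \<le> B"
    and xy: "x \<in> ball c (r/2)" "y \<in> ball c (r/2)"
  shows "norm (f x - f y) \<le> 2 * B / r * norm (x - y)"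
proof (rule field_differentiable_bound[of "ball c (r/2)"])
  fix z assume z: "z \<in> ball c (r/2)"
  have sub: "ball z (r/2) \<subseteq> ball c r"
  proof
    fix w assume "w \<in> ball z (r/2)"
    thus "w \<in> ball c r" using z dist_triangle[of c w z] by auto
  qed
  have "f field_differentiable (at z)"
    by (rule holomorphic_on_imp_differentiable_at[OF hol open_ball]) (use z r in simp)
  thus "(f has_field_derivative deriv f z) (at z within ball c (r/2))"
    by (simp add: DERIV_deriv_iff_field_differentiable has_field_derivative_at_within)
  have "norm ((deriv ^^ 1) f z / fact 1) \<le> B / (r/2) ^ 1"
  proof (rule Cauchy_coeff_bound[OF holomorphic_on_subset[OF hol sub]])
    show "norm (f w) \<le> B" if "w \<in> ball z (r/2)" for w using B that sub by blast
  qed (use r in simp)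
  thus "norm (deriv f z) \<le> 2 * B / r" by (simp add: mult.commute)
qed (use xy in auto)

subsection \<open>Separately holomorphic functions\<close>

lemma axis_add: "axis l (a + b) = axis l a + axis l (b :: complex)"
  by (simp add: vec_eq_iff axis_def)

lemma norm_axis: "norm (axis l a) = norm (a :: complex)"
  by (simp add: norm_eq_sqrt_inner inner_axis_axis)

lemma continuous_axis [continuous_intros]:
  "continuous_on S f \<Longrightarrow> continuous_on S (\<lambda>x. axis l (f x :: complex))"
  unfolding axis_def
proof (intro continuous_on_vec_lambda)
  fix i assume "continuous_on S f"
  thus "continuous_on S (\<lambda>x. if i = l then f x else 0)" by (cases "i = l") auto
qed

lemma axis_0 [simp]: "axis l 0 = 0"
  by (simp add: vec_eq_iff axis_def)

definition sep_hol :: "(complex^'n) set \<Rightarrow> (complex^'n \<Rightarrow> complex) \<Rightarrow> bool" where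
  "sep_hol D \<Phi> \<longleftrightarrow> (\<forall>z\<in>D. \<forall>l. (\<lambda>w. \<Phi> (z + axis l w)) field_differentiable (at 0))"

definition pdiff :: "(complex^'n \<Rightarrow> complex) \<Rightarrow> 'n \<Rightarrow> complex^'n \<Rightarrow> complex" where
  "pdiff \<Phi> l z = deriv (\<lambda>w. \<Phi> (z + axis l w)) 0"

text \<open>Writing the differential through \<open>pdiff\<close> reduces continuous
  differentiability to the continuity of finitely many scalar functions.\<close>

definition hol_n :: "(complex^'n) set \<Rightarrow> (complex^'n \<Rightarrow> complex) \<Rightarrow> bool" where
  "hol_n D \<Phi> \<longleftrightarrow> (\<forall>z\<in>D. (\<Phi> has_derivative (\<lambda>v. \<Sum>l\<in>UNIV. v $ l * pdiff \<Phi> l z)) (at z)) \<and>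
     (\<forall>l. continuous_on D (pdiff \<Phi> l))"

lemma sep_hol_line_deriv:
  assumes "sep_hol D \<Phi>" "z + axis l w \<in> D"
  shows "((\<lambda>w. \<Phi> (z + axis l w)) has_field_derivative pdiff \<Phi> l (z + axis l w)) (at w)"
proof -
  have "((\<lambda>t. \<Phi> ((z + axis l w) + axis l t)) has_field_derivative pdiff \<Phi> l (z + axis l w)) (at 0)"
    using assms unfolding sep_hol_def pdiff_def by (simp add: DERIV_deriv_iff_field_differentiable)
  hence "((\<lambda>t. (\<lambda>w. \<Phi> (z + axis l w)) (t + w)) has_field_derivative pdiff \<Phi> l (z + axis l w)) (at 0)"
    by (simp add: axis_add add_ac)
  thus ?thesis by (subst (asm) DERIV_shift[symmetric]) simp
qed

lemma sep_hol_line: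
  assumes "sep_hol D \<Phi>" "\<And>w. w \<in> S \<Longrightarrow> z + axis l w \<in> D" "open S"
  shows "(\<lambda>w. \<Phi> (z + axis l w)) holomorphic_on S"
  using assms sep_hol_line_deriv by (subst holomorphic_on_open) blast+

lemma hol_n_mono: "hol_n D \<Phi> \<Longrightarrow> E \<subseteq> D \<Longrightarrow> hol_n E \<Phi>"
  unfolding hol_n_def by (blast intro: continuous_on_subset)

lemma hol_n_continuous: "hol_n D \<Phi> \<Longrightarrow> continuous_on D \<Phi>"
  unfolding hol_n_def
  by (meson continuous_at_imp_continuous_on has_derivative_continuous)

text \<open>The partial derivative is a locally uniform limit of difference quotients, which are
  continuous. The Taylor remainder of order 2 gives a rate of convergence depending only on a local
  bound B, not on the base point.\<close>

lemma continuous_on_pdiff: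
  assumes D: "open D" and c: "continuous_on D \<Phi>" and s: "sep_hol D \<Phi>"
  shows "continuous_on D (pdiff \<Phi> l)"
proof -
  have "continuous (at z0) (pdiff \<Phi> l)" if z0: "z0 \<in> D" for z0
  proof -
    obtain e where e: "0 < e" "cball z0 e \<subseteq> D" using D z0 open_contains_cball by blast
    define r where "r = e / 2"
    have r: "0 < r" using e by (simp add: r_def)
    have in_D: "z + axis l w \<in> cball z0 e" if "z \<in> ball z0 r" "norm w < r" for z w
    proof -
      have "dist z0 (z + axis l w) \<le> dist z0 z + dist z (z + axis l w)" by (rule dist_triangle)
      also have "dist z (z + axis l w) = norm w" by (simp add: dist_norm norm_axis)
      finally show ?thesis using that by (simp add: r_def)
    qed
    have "bounded (\<Phi> ` cball z0 e)"
      by (intro compact_imp_bounded compact_continuous_image continuous_on_subset[OF c] e) auto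
    then obtain B where B: "\<And>z. z \<in> cball z0 e \<Longrightarrow> norm (\<Phi> z) \<le> B"
      unfolding bounded_iff by blast
    define t where "t n = complex_of_real (r / 2 / real (Suc n))" for n
    have t: "t n \<noteq> 0" "norm (t n) \<le> r / 2" "norm (t n) = r / 2 * inverse (real (Suc n))" for n
      using r by (auto simp: t_def norm_divide divide_simps simp del: of_nat_Suc)
    define h where "h n z = (\<Phi> (z + axis l (t n)) - \<Phi> z) / t n" for n z
    have est: "dist (h n z) (pdiff \<Phi> l z) \<le> B / r * inverse (real (Suc n))" if z: "z \<in> ball z0 r" for n z
    proof -
      let ?f = "\<lambda>w. \<Phi> (z + axis l w)"
      have hol: "?f holomorphic_on ball 0 r"
        by (rule sep_hol_line[OF s]) (use in_D[OF z] e in auto)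
      have "norm (?f (t n) - (\<Sum>i<2. (deriv ^^ i) ?f 0 / fact i * t n ^ i)) \<le> 2 * B * (norm (t n) / r) ^ 2"
        by (rule Taylor_remainder_bound[OF hol r _ t(2)]) (use in_D[OF z] B in auto)
      moreover have "(\<Sum>i<2. (deriv ^^ i) ?f 0 / fact i * t n ^ i) = \<Phi> z + pdiff \<Phi> l z * t n"
        by (simp add: numeral_2_eq_2 pdiff_def)
      ultimately have *: "norm (\<Phi> (z + axis l (t n)) - \<Phi> z - pdiff \<Phi> l z * t n) \<le> 2 * B * (norm (t n) / r) ^ 2"
        by (simp add: algebra_simps)
      have "norm (h n z - pdiff \<Phi> l z) * norm (t n) = norm ((h n z - pdiff \<Phi> l z) * t n)"
        by (simp add: norm_mult)
      also have "(h n z - pdiff \<Phi> l z) * t n = \<Phi> (z + axis l (t n)) - \<Phi> z - pdiff \<Phi> l z * t n"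
        using t(1)[of n] by (simp add: h_def field_simps)
      also note *
      also have "2 * B * (norm (t n) / r) ^ 2 = (B / r * inverse (real (Suc n))) * norm (t n)"
      proof -
        have "2 * B * (r / 2 * q / r) ^ 2 = (B / r * q) * (r / 2 * q)" for q
          using r by (simp add: power2_eq_square field_simps)
        thus ?thesis unfolding t(3) .
      qed
      finally have "norm (h n z - pdiff \<Phi> l z) * norm (t n) \<le> B / r * inverse (real (Suc n)) * norm (t n)" .
      from mult_right_le_imp_le[OF this] show ?thesis using t(1)[of n] by (simp add: dist_norm)
    qed
    have "uniform_limit (ball z0 r) h (pdiff \<Phi> l) sequentially"
      unfolding uniform_limit_iff
    proof (intro allI impI)
      fix e' :: real assume "0 < e'"
      have "(\<lambda>n. B / r * inverse (real (Suc n))) \<longlonglongrightarrow> B / r * 0"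
        by (intro tendsto_intros LIMSEQ_inverse_real_of_nat)
      hence "\<forall>\<^sub>F n in sequentially. B / r * inverse (real (Suc n)) < e'"
        using \<open>0 < e'\<close> by (simp add: order_tendsto_iff)
      thus "\<forall>\<^sub>F n in sequentially. \<forall>z\<in>ball z0 r. dist (h n z) (pdiff \<Phi> l z) < e'"
        by eventually_elim (use est le_less_trans in blast)
    qed
    moreover have "continuous_on (ball z0 r) (h n)" for n
    proof -
      have "continuous_on (ball z0 r) \<Phi>"
        by (rule continuous_on_subset[OF c]) (use e r in \<open>auto simp: r_def\<close>)
      moreover have "continuous_on (ball z0 r) (\<lambda>z. \<Phi> (z + axis l (t n)))"
      proof (rule continuous_on_compose2[OF c])
        have "norm (t n) < r" using t(2)[of n] r by linarith
        thus "(\<lambda>z. z + axis l (t n)) ` ball z0 r \<subseteq> D" using in_D e by blast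
      qed (intro continuous_intros)
      ultimately show ?thesis unfolding h_def using t(1) by (intro continuous_intros) auto
    qed
    ultimately have "continuous_on (ball z0 r) (pdiff \<Phi> l)"
      by (intro uniform_limit_theorem[where F = sequentially]) auto
    thus ?thesis using r by (simp add: continuous_on_eq_continuous_at)
  qed
  thus ?thesis using continuous_at_imp_continuous_on by blast
qed

text \<open>The increment is telescoped one coordinate at a time. On each segment the mean value
  inequality is applied to the function minus its linear part, whose derivative is small because the
  partial derivatives vary little near z0.\<close>

theorem Osgood:
  assumes D: "open D" and c: "continuous_on D \<Phi>" and s: "sep_hol D \<Phi>"
  shows "hol_n D \<Phi>"
  unfolding hol_n_def
proof (intro conjI ballI allI continuous_on_pdiff assms)
  fix z0 assume z0: "z0 \<in> D"
  show "(\<Phi> has_derivative (\<lambda>v. \<Sum>l\<in>UNIV. v $ l * pdiff \<Phi> l z0)) (at z0)"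
    unfolding has_derivative_at_alt
  proof (intro conjI allI impI)
    show "bounded_linear (\<lambda>v. \<Sum>l\<in>UNIV. v $ l * pdiff \<Phi> l z0)"
      by (intro bounded_linear_sum bounded_linear_mult_const bounded_linear_vec_nth)
    fix e :: real assume e: "0 < e"
    define e' where "e' = e / real CARD('a)"
    have e': "0 < e'" using e by (simp add: e'_def)
    have "\<forall>\<^sub>F z in nhds z0. dist (pdiff \<Phi> l z) (pdiff \<Phi> l z0) < e'" for l
    proof -
      have "isCont (pdiff \<Phi> l) z0"
        using continuous_on_pdiff[OF assms] D z0 by (simp add: continuous_on_eq_continuous_at)
      thus ?thesis
        using e' unfolding isCont_def tendsto_at_iff_tendsto_nhds by (rule tendstoD)
    qed
    hence "\<forall>\<^sub>F z in nhds z0. \<forall>l\<in>UNIV. dist (pdiff \<Phi> l z) (pdiff \<Phi> l z0) < e'"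
      by (subst eventually_ball_finite_distrib) auto
    moreover have "\<forall>\<^sub>F z in nhds z0. z \<in> D" using D z0 by (simp add: eventually_nhds_in_open)
    ultimately have "\<forall>\<^sub>F z in nhds z0. z \<in> D \<and> (\<forall>l. dist (pdiff \<Phi> l z) (pdiff \<Phi> l z0) < e')"
      by eventually_elim auto
    then obtain d where d: "0 < d"
      "\<And>z. dist z z0 < d \<Longrightarrow> z \<in> D \<and> (\<forall>l. dist (pdiff \<Phi> l z) (pdiff \<Phi> l z0) < e')"
      unfolding eventually_nhds_metric by blast
    show "\<exists>d>0. \<forall>y. norm (y - z0) < d \<longrightarrow>
        norm (\<Phi> y - \<Phi> z0 - (\<Sum>l\<in>UNIV. (y - z0) $ l * pdiff \<Phi> l z0)) \<le> e * norm (y - z0)"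
    proof (intro exI[of _ d] conjI d allI impI)
      fix y assume y: "norm (y - z0) < d"
      define v where "v = y - z0"
      define vS where "vS S = (\<chi> l. if l \<in> S then v $ l else 0)" for S
      have step: "norm (\<Phi> (z0 + vS S) - \<Phi> z0 - (\<Sum>l\<in>S. v $ l * pdiff \<Phi> l z0)) \<le> e' * (\<Sum>l\<in>S. norm (v $ l))"
        if "finite S" for S
        using that
      proof (induction S)
        case empty
        have "vS {} = 0" by (simp add: vS_def vec_eq_iff)
        thus ?case by simp
      next
        case (insert l S)
        have ins: "vS (insert l S) = vS S + axis l (v $ l)"
          using insert.hyps by (auto simp: vS_def vec_eq_iff axis_def)
        have inn: "dist (z0 + vS S + axis l t) z0 < d" if "t \<in> closed_segment 0 (v $ l)" for t
        proof -
          from that obtain u where u: "0 \<le> u" "u \<le> 1" "t = u *\<^sub>R (v $ l)"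
            by (auto simp: in_segment)
          \<comment> \<open>Every intermediate point is coordinatewise dominated by v and so stays
            in the ball where the partial derivatives are controlled.\<close>
          have "norm (vS S + axis l t) \<le> norm v"
          proof (rule norm_le_componentwise_cart)
            fix i show "norm ((vS S + axis l t) $ i) \<le> norm (v $ i)"
              using insert.hyps u by (auto simp: vS_def axis_def mult_left_le_one_le)
          qed
          thus ?thesis using y by (simp add: dist_norm v_def add.assoc)
        qed
        let ?f = "\<lambda>t. \<Phi> (z0 + vS S + axis l t) - t * pdiff \<Phi> l z0"
        have "norm (?f (v $ l) - ?f 0) \<le> e' * norm (v $ l - 0)"
        proof (rule field_differentiable_bound[of "closed_segment 0 (v $ l)"])
          fix t assume t: "t \<in> closed_segment 0 (v $ l)"
          have "(?f has_field_derivative pdiff \<Phi> l (z0 + vS S + axis l t) - 1 * pdiff \<Phi> l z0) (at t)"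
            by (intro DERIV_diff sep_hol_line_deriv[OF s] DERIV_cmult_right DERIV_ident)
              (use d inn[OF t] in auto)
          thus "(?f has_field_derivative pdiff \<Phi> l (z0 + vS S + axis l t) - pdiff \<Phi> l z0)
              (at t within closed_segment 0 (v $ l))"
            by (simp add: has_field_derivative_at_within)
          show "norm (pdiff \<Phi> l (z0 + vS S + axis l t) - pdiff \<Phi> l z0) \<le> e'"
            using d(2)[OF inn[OF t]] by (auto simp: dist_norm less_imp_le)
        qed auto
        hence *: "norm (\<Phi> (z0 + vS (insert l S)) - \<Phi> (z0 + vS S) - v $ l * pdiff \<Phi> l z0)
            \<le> e' * norm (v $ l)"
          by (simp add: ins add_ac algebra_simps)
        have "\<Phi> (z0 + vS (insert l S)) - \<Phi> z0 - (\<Sum>l\<in>insert l S. v $ l * pdiff \<Phi> l z0)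
          = (\<Phi> (z0 + vS (insert l S)) - \<Phi> (z0 + vS S) - v $ l * pdiff \<Phi> l z0)
            + (\<Phi> (z0 + vS S) - \<Phi> z0 - (\<Sum>l\<in>S. v $ l * pdiff \<Phi> l z0))"
          using insert.hyps by simp
        also have "norm \<dots> \<le> e' * norm (v $ l) + e' * (\<Sum>l\<in>S. norm (v $ l))"
          by (rule order_trans[OF norm_triangle_ineq add_mono[OF * insert.IH]])
        finally show ?case using insert.hyps by (simp add: algebra_simps)
      qed
      have "vS UNIV = v" by (simp add: vS_def)
      hence "norm (\<Phi> y - \<Phi> z0 - (\<Sum>l\<in>UNIV. (y - z0) $ l * pdiff \<Phi> l z0)) \<le> e' * (\<Sum>l\<in>UNIV. norm (v $ l))"
        using step[of UNIV] by (simp add: v_def)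
      also have "\<dots> \<le> e' * (\<Sum>l\<in>(UNIV::'a set). norm v)"
        using e' by (intro mult_left_mono sum_mono Finite_Cartesian_Product.norm_nth_le) auto
      also have "\<dots> = e * norm v" by (simp add: e'_def)
      finally show "norm (\<Phi> y - \<Phi> z0 - (\<Sum>l\<in>UNIV. (y - z0) $ l * pdiff \<Phi> l z0)) \<le> e * norm (y - z0)"
        by (simp add: v_def)
    qed
  qed
qed

lemma hol_n_imp_sep_hol: "hol_n D \<Phi> \<Longrightarrow> sep_hol D \<Phi>"
  unfolding sep_hol_def
proof (intro ballI allI)
  fix z l assume "hol_n D \<Phi>" "z \<in> D"
  hence d: "(\<Phi> has_derivative (\<lambda>v. \<Sum>l\<in>UNIV. v $ l * pdiff \<Phi> l z)) (at (z + axis l 0))"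
    by (simp add: hol_n_def)
  have "((\<lambda>w. \<Phi> (z + axis l w)) has_derivative (\<lambda>w. \<Sum>k\<in>UNIV. (0 + axis l w) $ k * pdiff \<Phi> k z)) (at 0)"
    by (rule has_derivative_compose[where f = "\<lambda>w. z + axis l w" and x = 0 and g = \<Phi>, OF _ d])
      (intro has_derivative_add has_derivative_const bounded_linear_imp_has_derivative
       linear_conv_bounded_linear[THEN iffD1] linearI; simp add: axis_def vec_eq_iff)
  also have "(\<lambda>w. \<Sum>k\<in>UNIV. (0 + axis l w) $ k * pdiff \<Phi> k z) = (*) (pdiff \<Phi> l z)"
    by (auto simp: axis_def if_distrib if_distribR cong: if_cong)
  finally show "(\<lambda>w. \<Phi> (z + axis l w)) field_differentiable (at 0)"
    unfolding field_differentiable_def has_field_derivative_def by blast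
qed

lemma hol_n_line:
  assumes h: "hol_n D \<Phi>" and S: "open S" "\<And>w. w \<in> S \<Longrightarrow> b + w *s v \<in> D"
  shows "(\<lambda>w. \<Phi> (b + w *s v)) holomorphic_on S"
  unfolding holomorphic_on_open[OF S(1)]
proof (intro ballI)
  fix w assume w: "w \<in> S"
  let ?z = "b + w *s v"
  have d: "(\<Phi> has_derivative (\<lambda>v. \<Sum>l\<in>UNIV. v $ l * pdiff \<Phi> l ?z)) (at ?z)"
    using h S(2)[OF w] unfolding hol_n_def by blast
  have "((\<lambda>w. b + w *s v) has_derivative (\<lambda>t. 0 + t *s v)) (at w)"
    by (intro has_derivative_add has_derivative_const bounded_linear_imp_has_derivative
       linear_conv_bounded_linear[THEN iffD1] linearI; simp add: vec_eq_iff algebra_simps)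
  from has_derivative_compose[OF this d]
  have "((\<lambda>w. \<Phi> (b + w *s v)) has_derivative (\<lambda>t. \<Sum>l\<in>UNIV. (0 + t *s v) $ l * pdiff \<Phi> l ?z)) (at w)" .
  also have "(\<lambda>t. \<Sum>l\<in>UNIV. (0 + t *s v) $ l * pdiff \<Phi> l ?z) = (*) (\<Sum>l\<in>UNIV. v $ l * pdiff \<Phi> l ?z)"
    by (auto simp: sum_distrib_right sum_distrib_left mult_ac)
  finally show "\<exists>f'. ((\<lambda>w. \<Phi> (b + w *s v)) has_field_derivative f') (at w)"
    unfolding has_field_derivative_def by blast
qed

text \<open>Continuity and holomorphy along coordinate lines survive uniform limits, and Osgood's
  theorem restores the joint statement.\<close>

lemma hol_n_uniform_limit:
  assumes D: "open D" and h: "\<And>n. hol_n D (\<Phi> n)" and lim: "uniform_limit D \<Phi> \<Psi> sequentially"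
  shows "hol_n D \<Psi>"
proof (rule Osgood[OF D])
  show "continuous_on D \<Psi>"
    by (rule uniform_limit_theorem[OF _ lim]) (auto intro!: always_eventually hol_n_continuous h)
  show "sep_hol D \<Psi>"
    unfolding sep_hol_def
  proof (intro ballI allI)
    fix z l assume "z \<in> D"
    let ?S = "{w. z + axis l w \<in> D}"
    have "open ((\<lambda>w. z + axis l w) -` D)" by (intro open_vimage D continuous_intros)
    hence S: "open ?S" by (simp add: vimage_def)
    have "(\<lambda>w. \<Psi> (z + axis l w)) holomorphic_on ?S"
    proof (rule holomorphic_uniform_sequence[OF S])
      show "(\<lambda>w. \<Phi> n (z + axis l w)) holomorphic_on ?S" for n
        by (rule sep_hol_line[OF hol_n_imp_sep_hol[OF h]]) (use S in auto)
      fix w assume "w \<in> ?S"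
      then obtain d where d: "0 < d" "cball w d \<subseteq> ?S" using S open_contains_cball by blast
      have "uniform_limit (cball w d) (\<lambda>n w. \<Phi> n (z + axis l w)) (\<lambda>w. \<Psi> (z + axis l w)) sequentially"
        by (rule uniform_limit_compose'[OF lim]) (use d in auto)
      with d show "\<exists>d>0. cball w d \<subseteq> ?S \<and>
          uniform_limit (cball w d) (\<lambda>n w. \<Phi> n (z + axis l w)) (\<lambda>w. \<Psi> (z + axis l w)) sequentially" by blast
    qed
    moreover have "0 \<in> ?S" using \<open>z \<in> D\<close> by simp
    ultimately show "(\<lambda>w. \<Psi> (z + axis l w)) field_differentiable (at 0)"
      using S holomorphic_on_imp_differentiable_at by blast
  qed
qed

subsection \<open>Hartogs' theorem\<close>

lemma norm_scalar_mult: "norm (c *s v) = norm c * norm (v :: complex^'n)"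
  by (simp add: norm_vec_def vector_scalar_mult_def norm_mult L2_set_right_distrib)

text \<open>A point of the line is the limit of points vertically above it, where the bound is
  available.\<close>

lemma bound_off_horizontal_line:
  fixes f :: "complex \<Rightarrow> complex"
  assumes f: "continuous_on U f" and U: "open U" "\<zeta> \<in> U"
    and M: "\<And>\<zeta>. \<zeta> \<in> U \<Longrightarrow> Im \<zeta> \<noteq> c \<Longrightarrow> norm (f \<zeta>) \<le> M"
  shows "norm (f \<zeta>) \<le> M"
proof (cases "Im \<zeta> = c")
  case True
  have l: "((\<lambda>t. \<zeta> + \<i> * of_real t) \<longlongrightarrow> \<zeta> + \<i> * of_real 0) (at_right (0::real))"
    by (intro tendsto_intros)
  hence "\<forall>\<^sub>F t in at_right (0::real). \<zeta> + \<i> * of_real t \<in> U"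
    using U by (simp add: topological_tendstoD)
  moreover have "\<forall>\<^sub>F t in at_right (0::real). 0 < t" by (simp add: eventually_at_right_less)
  ultimately have ev: "\<forall>\<^sub>F t in at_right (0::real). norm (f (\<zeta> + \<i> * of_real t)) \<le> M"
    by eventually_elim (intro M; use True in simp)
  have "isCont f \<zeta>" using f U by (simp add: continuous_on_eq_continuous_at)
  hence "((\<lambda>t. f (\<zeta> + \<i> * of_real t)) \<longlongrightarrow> f \<zeta>) (at_right (0::real))"
    using isCont_tendsto_compose l by fastforce
  from tendsto_upperbound[OF tendsto_norm[OF this] ev] show ?thesis by simp
qed (use U M in blast)

text \<open>The bound B makes g Lipschitz in \<zeta> with a constant independent of v. On the
  exceptional line, g \<zeta> is therefore the uniform limit of functions whose parameters lie just
  above the line.\<close>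

lemma bounded_family_hol_n:
  assumes V: "open V" and r: "0 < r"
    and h1: "\<And>v. v \<in> V \<Longrightarrow> (\<lambda>\<zeta>. g \<zeta> v) holomorphic_on ball 0 r"
    and h2: "\<And>\<zeta>. \<zeta> \<in> ball 0 r \<Longrightarrow> Im \<zeta> \<noteq> c \<Longrightarrow> hol_n V (g \<zeta>)"
    and B: "\<And>\<zeta> v. \<zeta> \<in> ball 0 r \<Longrightarrow> v \<in> V \<Longrightarrow> norm (g \<zeta> v) \<le> B"
    and z: "\<zeta> \<in> ball 0 (r / 2)"
  shows "hol_n V (g \<zeta>)"
proof (cases "Im \<zeta> = c")
  case True
  \<comment> \<open>Half of the room left, so that all w n stay in the disc of radius r/2 where the
    Lipschitz estimate holds.\<close>
  define t where "t = (r / 2 - norm \<zeta>) / 2"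
  have t: "0 < t" "norm \<zeta> + t < r / 2" using z by (auto simp: t_def field_simps)
  define w where "w n = \<zeta> + \<i> * of_real (t * inverse (real (Suc n)))" for n
  have wd: "norm (w n - \<zeta>) = t * inverse (real (Suc n))" for n
    using t by (simp add: w_def norm_mult del: of_real_mult of_nat_Suc)
  have wt: "t * inverse (real (Suc n)) \<le> t" for n
    using t by (simp add: field_simps)
  have wr: "w n \<in> ball 0 (r/2)" for n
  proof -
    have "norm (w n) \<le> norm \<zeta> + t" using norm_triangle_ineq2[of "w n" \<zeta>] wd[of n] wt[of n] by linarith
    thus ?thesis using t by simp
  qed
  have "hol_n V (g (w n))" for n
    by (rule h2) (use wr[of n] r True t in \<open>auto simp: w_def simp del: of_nat_Suc\<close>)
  moreover have "uniform_limit V (\<lambda>n. g (w n)) (g \<zeta>) sequentially"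
    unfolding uniform_limit_iff
  proof (intro allI impI)
    fix e :: real assume "0 < e"
    have "(\<lambda>n. 2 * B / r * (t * inverse (real (Suc n)))) \<longlonglongrightarrow> 2 * B / r * (t * 0)"
      by (intro tendsto_intros LIMSEQ_inverse_real_of_nat)
    hence "\<forall>\<^sub>F n in sequentially. 2 * B / r * (t * inverse (real (Suc n))) < e"
      using \<open>0 < e\<close> by (simp add: order_tendsto_iff)
    thus "\<forall>\<^sub>F n in sequentially. \<forall>v\<in>V. dist (g (w n) v) (g \<zeta> v) < e"
    proof eventually_elim
      case (elim n)
      show ?case
      proof
        fix v assume v: "v \<in> V"
        have "norm (g (w n) v - g \<zeta> v) \<le> 2 * B / r * norm (w n - \<zeta>)"
          by (rule bounded_holomorphic_Lipschitz[OF h1[OF v] r]) (use B v wr z in auto)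
        thus "dist (g (w n) v) (g \<zeta> v) < e" using elim by (simp only: dist_norm wd)
      qed
    qed
  qed
  ultimately show ?thesis by (rule hol_n_uniform_limit[OF V])
qed (use h2 z r in auto)

text \<open>The k-th coefficient is the limit, as t tends to 0, of G \<zeta> t minus its Taylor
  polynomial of degree below k, divided by t^k. The remainder bound makes this uniform in \<zeta>,
  and the quotients are holomorphic in \<zeta> because the lower coefficients are, by
  induction.\<close>

lemma Taylor_coeffs_holomorphic:
  assumes "0 < \<rho>" "0 < r"
    and h: "\<And>x. x \<in> ball 0 \<rho> \<Longrightarrow> (\<lambda>\<zeta>. G \<zeta> x) holomorphic_on ball 0 r"
    and h': "\<And>\<zeta>. \<zeta> \<in> ball 0 r \<Longrightarrow> G \<zeta> holomorphic_on ball 0 \<rho>"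
    and B: "\<And>\<zeta> x. \<zeta> \<in> ball 0 r \<Longrightarrow> x \<in> ball 0 \<rho> \<Longrightarrow> norm (G \<zeta> x) \<le> B"
  shows "(\<lambda>\<zeta>. (deriv ^^ k) (G \<zeta>) 0 / fact k) holomorphic_on ball 0 r"
proof (induction k rule: less_induct)
  case (less k)
  define p where "p i \<zeta> = (deriv ^^ i) (G \<zeta>) 0 / fact i" for i \<zeta>
  define t where "t n = complex_of_real (\<rho> / 2 * inverse (real (Suc n)))" for n
  have nt: "norm (t n) = \<rho> / 2 * inverse (real (Suc n))" for n
    using assms by (simp add: t_def norm_mult del: of_real_mult of_nat_Suc)
  have t: "t n \<noteq> 0" "norm (t n) \<le> \<rho> / 2" "t n \<in> ball 0 \<rho>" for n
  proof -
    show "norm (t n) \<le> \<rho> / 2" unfolding nt using assms by (simp add: field_simps)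
    thus "t n \<in> ball 0 \<rho>" using assms by simp
    show "t n \<noteq> 0" using nt[of n] assms by (auto simp del: of_nat_Suc)
  qed
  define f where "f n \<zeta> = (G \<zeta> (t n) - (\<Sum>i<k. p i \<zeta> * t n ^ i)) / t n ^ k" for n \<zeta>
  have est: "dist (f n \<zeta>) (p k \<zeta>) \<le> B / \<rho> ^ k * inverse (real (Suc n))" if z: "\<zeta> \<in> ball 0 r" for n \<zeta>
  proof -
    have "norm (G \<zeta> (t n) - (\<Sum>i<Suc k. p i \<zeta> * t n ^ i)) \<le> 2 * B * (norm (t n) / \<rho>) ^ Suc k"
      unfolding p_def by (rule Taylor_remainder_bound[OF h'[OF z] _ B[OF z] t(2)]) (use assms in auto)
    also have "G \<zeta> (t n) - (\<Sum>i<Suc k. p i \<zeta> * t n ^ i) = (f n \<zeta> - p k \<zeta>) * t n ^ k"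
      using t(1)[of n] by (simp add: f_def field_simps)
    also have "2 * B * (norm (t n) / \<rho>) ^ Suc k = B / \<rho> ^ k * (2 * (norm (t n) / \<rho>)) * norm (t n) ^ k"
      using assms by (simp add: power_divide mult_ac)
    also have "2 * (norm (t n) / \<rho>) = inverse (real (Suc n))"
      unfolding nt using assms by (simp del: of_nat_Suc)
    finally have "norm (f n \<zeta> - p k \<zeta>) * norm (t n) ^ k \<le> (B / \<rho> ^ k * inverse (real (Suc n))) * norm (t n) ^ k"
      by (simp only: norm_mult norm_power)
    from mult_right_le_imp_le[OF this] show ?thesis using t(1)[of n] by (simp add: dist_norm)
  qed
  have ul: "uniform_limit (ball 0 r) f (p k) sequentially"
    unfolding uniform_limit_iff
  proof (intro allI impI)
    fix e :: real assume "0 < e"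
    have "(\<lambda>n. B / \<rho> ^ k * inverse (real (Suc n))) \<longlonglongrightarrow> B / \<rho> ^ k * 0"
      by (intro tendsto_intros LIMSEQ_inverse_real_of_nat)
    hence "\<forall>\<^sub>F n in sequentially. B / \<rho> ^ k * inverse (real (Suc n)) < e"
      using \<open>0 < e\<close> by (simp add: order_tendsto_iff)
    thus "\<forall>\<^sub>F n in sequentially. \<forall>\<zeta>\<in>ball 0 r. dist (f n \<zeta>) (p k \<zeta>) < e"
      by eventually_elim (use est le_less_trans in blast)
  qed
  have "p k holomorphic_on ball 0 r"
  proof (rule holomorphic_uniform_sequence[OF open_ball])
    show "f n holomorphic_on ball 0 r" for n
      unfolding f_def p_def
      by (intro holomorphic_intros h[OF t(3)] less.IH) (use t in auto)
    fix x :: complex assume "x \<in> ball 0 r"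
    then obtain d where "0 < d" "cball x d \<subseteq> ball 0 r"
      using open_contains_cball[of "ball (0::complex) r"] open_ball by blast
    thus "\<exists>d>0. cball x d \<subseteq> ball 0 r \<and> uniform_limit (cball x d) f (p k) sequentially"
      using uniform_limit_on_subset[OF ul] by blast
  qed
  thus ?case unfolding p_def .
qed

text \<open>The sets \<open>A M\<close> cover a closed ball, so one of them has interior by Baire's
  theorem. They are closed although continuity in v is known only for \<zeta> off the exceptional
  line, because a bound off the line extends to the line.\<close>

lemma Baire_uniform_bound:
  fixes g :: "complex \<Rightarrow> 'a::euclidean_space \<Rightarrow> complex"
  assumes r: "0 < r" "r < r'"
    and h1: "\<And>v. v \<in> cball 0 r \<Longrightarrow> (\<lambda>\<zeta>. g \<zeta> v) holomorphic_on ball 0 4"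
    and h2: "\<And>\<zeta>. \<zeta> \<in> ball 0 4 \<Longrightarrow> Im \<zeta> \<noteq> c \<Longrightarrow> continuous_on (ball 0 r') (g \<zeta>)"
  obtains b \<rho> M where "0 < \<rho>" "ball b \<rho> \<subseteq> ball 0 r"
    "\<And>\<zeta> v. \<zeta> \<in> ball 0 2 \<Longrightarrow> v \<in> ball b \<rho> \<Longrightarrow> norm (g \<zeta> v) \<le> M"
proof -
  define S where "S = cball (0::'a) r"
  define A where "A M = {v\<in>S. \<forall>\<zeta>\<in>ball 0 2. norm (g \<zeta> v) \<le> real M}" for M :: nat
  have A_eq: "A M = S \<inter> (\<Inter>\<zeta>\<in>{\<zeta>\<in>ball 0 2. Im \<zeta> \<noteq> c}. {v\<in>S. norm (g \<zeta> v) \<le> real M})" for M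
  proof -
    have "norm (g \<zeta> v) \<le> real M"
      if "v \<in> S" "\<forall>\<zeta>\<in>{\<zeta>\<in>ball 0 2. Im \<zeta> \<noteq> c}. norm (g \<zeta> v) \<le> real M" "\<zeta> \<in> ball 0 2" for v \<zeta>
    proof (rule bound_off_horizontal_line[of "ball 0 2" "\<lambda>\<zeta>. g \<zeta> v"])
      show "continuous_on (ball 0 2) (\<lambda>\<zeta>. g \<zeta> v)"
        by (intro holomorphic_on_imp_continuous_on holomorphic_on_subset[OF h1])
          (use that in \<open>auto simp: S_def\<close>)
    qed (use that in auto)
    thus ?thesis by (auto simp: A_def)
  qed
  have A: "closed (A M)" for M
    unfolding A_eq
  proof (intro closed_Int closed_INT ballI)
    fix \<zeta> :: complex assume "\<zeta> \<in> {\<zeta>\<in>ball 0 2. Im \<zeta> \<noteq> c}"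
    hence "continuous_on S (\<lambda>v. norm (g \<zeta> v))"
      by (intro continuous_intros continuous_on_subset[OF h2[of \<zeta>]]) (use r in \<open>auto simp: S_def\<close>)
    from continuous_closed_preimage[OF this, of "{..real M}"]
    show "closed {v\<in>S. norm (g \<zeta> v) \<le> real M}" by (simp add: S_def vimage_def Int_def)
  qed (simp add: S_def)
  have cov: "\<exists>M. v \<in> A M" if "v \<in> S" for v
  proof -
    have "continuous_on (cball 0 2) (\<lambda>\<zeta>. g \<zeta> v)"
      by (intro holomorphic_on_imp_continuous_on holomorphic_on_subset[OF h1])
        (use that in \<open>auto simp: S_def\<close>)
    hence "bounded ((\<lambda>\<zeta>. g \<zeta> v) ` cball 0 2)"
      by (intro compact_imp_bounded compact_continuous_image) auto
    then obtain B where "\<forall>\<zeta>\<in>cball 0 2. norm (g \<zeta> v) \<le> B" unfolding bounded_iff by blast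
    moreover obtain M :: nat where M: "B \<le> real M" using real_arch_simple by blast
    ultimately have "norm (g \<zeta> v) \<le> real M" if "\<zeta> \<in> ball 0 2" for \<zeta>
      using that order_trans[OF _ M] by simp
    hence "v \<in> A M" using that by (simp add: A_def)
    thus ?thesis by blast
  qed
  have "\<exists>M. \<not> S \<subseteq> closure (S - A M)"
  proof (rule ccontr)
    assume *: "\<not> (\<exists>M. \<not> S \<subseteq> closure (S - A M))"
    have cl: "S \<subseteq> closure (\<Inter>(range (\<lambda>M. S - A M)))"
    proof (rule Baire)
      fix T assume "T \<in> range (\<lambda>M. S - A M)"
      then obtain M where M: "T = S - A M" by blast
      have "openin (top_of_set S) (S - A M)"
        using A[of M] by (metis Diff_eq open_Compl openin_open_Int)
      thus "openin (top_of_set S) T \<and> S \<subseteq> closure T" using * M by blast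
    qed (auto simp: S_def)
    have e: "\<Inter>(range (\<lambda>M. S - A M)) = {}" using cov by blast
    have "0 \<in> S" using r by (simp add: S_def)
    from subsetD[OF cl this] show False unfolding e by simp
  qed
  then obtain M x where x: "x \<in> S" "x \<notin> closure (S - A M)" by blast
  then obtain e where e: "0 < e" "\<And>y. y \<in> S - A M \<Longrightarrow> \<not> dist y x < e"
    unfolding closure_approachable by blast
  \<comment> \<open>The point x may lie on the boundary sphere; a nearby interior point b leaves
    room for a full ball.\<close>
  have "x \<in> closure (ball 0 r)" using x r by (simp add: S_def)
  then obtain b where b: "b \<in> ball 0 r" "dist b x < e" using e unfolding closure_approachable by blast
  hence "b \<in> ball 0 r \<inter> ball x e" by (simp add: dist_commute)
  moreover have "open (ball 0 r \<inter> ball x e)" by auto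
  ultimately obtain \<rho> where \<rho>: "0 < \<rho>" "ball b \<rho> \<subseteq> ball 0 r \<inter> ball x e"
    using open_contains_ball by blast
  show ?thesis
  proof (rule that[OF \<rho>(1), of b "real M"])
    fix \<zeta> :: complex and v assume z: "\<zeta> \<in> ball 0 2" and v: "v \<in> ball b \<rho>"
    hence "v \<in> ball 0 r" "dist v x < e" using \<rho> by (auto simp: dist_commute)
    hence "v \<in> A M" using e(2)[of v] by (auto simp: S_def)
    thus "norm (g \<zeta> v) \<le> real M" using z by (simp add: A_def)
  qed (use \<rho> in auto)
qed

text \<open>After scaling by \<rho>^k / M, the k-th coefficient is at most 1 on the disc and at most
  a constant times (\<rho> / R)^k on \<open>A t\<close>. The two-constants estimate turns this into
  a bound of order ((R / \<rho>)^\<epsilon> / R)^k that is uniform in \<zeta> and u.\<close>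

lemma Taylor_coeff_decay:
  fixes p :: "nat \<Rightarrow> 'i \<Rightarrow> complex \<Rightarrow> complex" and A :: "nat \<Rightarrow> complex set"
  assumes cl: "\<And>t. closed (A t)" and mono: "incseq A"
    and cov: "\<And>\<zeta>. norm \<zeta> \<le> 1 \<Longrightarrow> Im \<zeta> \<noteq> c \<Longrightarrow> \<exists>t. \<zeta> \<in> A t"
    and M: "1 \<le> M" and \<rho>: "0 < \<rho>" "\<rho> < R"
    and hol: "\<And>k u. u \<in> I \<Longrightarrow> p k u holomorphic_on ball 0 1"
    and b1: "\<And>k u \<zeta>. u \<in> I \<Longrightarrow> \<zeta> \<in> ball 0 1 \<Longrightarrow> norm (p k u \<zeta>) \<le> M / \<rho> ^ k"
    and b2: "\<And>k u \<zeta> t. u \<in> I \<Longrightarrow> \<zeta> \<in> A t \<inter> ball 0 1 \<Longrightarrow> norm (p k u \<zeta>) \<le> real t / R ^ k"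
  obtains C k0 where "\<And>k u \<zeta>. k0 \<le> k \<Longrightarrow> u \<in> I \<Longrightarrow> norm \<zeta> < 1/4 \<Longrightarrow> norm (p k u \<zeta>) \<le> C * (3 / (2 * R)) ^ k"
proof -
  \<comment> \<open>Solves (R / \<rho>)^\<epsilon> = 3/2: the loss in the exponent shrinks the
    radius of convergence from R to 2 R / 3.\<close>
  define \<epsilon> where "\<epsilon> = ln (3/2) / ln (R / \<rho>)"
  have R\<rho>: "1 < R / \<rho>" using \<rho> by simp
  have e: "0 < \<epsilon>" unfolding \<epsilon>_def using R\<rho> by (intro divide_pos_pos ln_gt_zero) auto
  have pe: "(R / \<rho>) powr \<epsilon> = 3 / 2"
    using R\<rho> \<rho> by (simp add: \<epsilon>_def powr_def)
  obtain t where t: "\<And>(f :: complex \<Rightarrow> complex) \<eta> (\<zeta> :: complex). \<lbrakk>f holomorphic_on ball 0 1;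
    \<And>\<zeta>. \<zeta> \<in> ball 0 1 \<Longrightarrow> norm (f \<zeta>) \<le> 1;
    0 < \<eta>; \<eta> < 1; \<And>\<zeta>. \<zeta> \<in> A t \<inter> ball 0 1 \<Longrightarrow> norm (f \<zeta>) \<le> \<eta>; norm \<zeta> < 1/4\<rbrakk>
    \<Longrightarrow> norm (f \<zeta>) \<le> \<eta> powr (1 - \<epsilon>)"
    using two_constants[OF cl mono cov e] by blast
  \<comment> \<open>The added 1 keeps \<eta> positive when t = 0.\<close>
  define T where "T = real t + 1"
  have T: "0 < T" by (simp add: T_def)
  have "(\<lambda>k. T * (\<rho> / R) ^ k) \<longlonglongrightarrow> T * 0"
    by (intro tendsto_intros LIMSEQ_realpow_zero) (use \<rho> in auto)
  hence "\<forall>\<^sub>F k in sequentially. T * (\<rho> / R) ^ k < 1" by (simp add: order_tendsto_iff)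
  then obtain k0 where k0: "\<And>k. k0 \<le> k \<Longrightarrow> T * (\<rho> / R) ^ k < 1"
    unfolding eventually_sequentially by blast
  show ?thesis
  proof (rule that[of k0 "M * T powr (1 - \<epsilon>)"])
    fix k u and \<zeta> :: complex assume k: "k0 \<le> k" and u: "u \<in> I" and z: "norm \<zeta> < 1/4"
    define s where "s = \<rho> ^ k / M"
    have s: "0 < s" using \<rho> M by (simp add: s_def)
    define \<eta> where "\<eta> = T * (\<rho> / R) ^ k"
    have \<eta>: "0 < \<eta>" "\<eta> < 1" using T \<rho> k0[OF k] by (simp_all add: \<eta>_def)
    have "norm (of_real s * p k u \<zeta>) \<le> \<eta> powr (1 - \<epsilon>)"
    proof (rule t[OF _ _ \<eta> _ z])
      show "(\<lambda>\<zeta>. of_real s * p k u \<zeta>) holomorphic_on ball 0 1"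
        by (intro holomorphic_intros hol u)
      show "norm (of_real s * p k u \<zeta>) \<le> 1" if "\<zeta> \<in> ball 0 1" for \<zeta>
      proof -
        have "s * norm (p k u \<zeta>) \<le> s * (M / \<rho> ^ k)" using b1[OF u that] s by (intro mult_left_mono) auto
        also have "\<dots> = 1" using M \<rho> by (simp add: s_def)
        finally show ?thesis using s by (simp add: norm_mult)
      qed
      show "norm (of_real s * p k u \<zeta>) \<le> \<eta>" if "\<zeta> \<in> A t \<inter> ball 0 1" for \<zeta>
      proof -
        have "s * norm (p k u \<zeta>) \<le> s * (real t / R ^ k)" using b2[OF u that] s by (intro mult_left_mono) auto
        also have "\<dots> = (\<rho> / R) ^ k * (real t / M)" by (simp add: s_def power_divide)
        also have "\<dots> \<le> (\<rho> / R) ^ k * T"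
        proof (intro mult_left_mono)
          have "real t / M \<le> real t / 1" using M by (intro divide_left_mono) auto
          thus "real t / M \<le> T" by (simp add: T_def)
        qed (use \<rho> in simp)
        finally show ?thesis using s by (simp add: norm_mult \<eta>_def mult.commute)
      qed
    qed
    hence "s * norm (p k u \<zeta>) \<le> \<eta> powr (1 - \<epsilon>)" using s by (simp add: norm_mult)
    hence "norm (p k u \<zeta>) \<le> \<eta> powr (1 - \<epsilon>) / s" using s by (simp add: field_simps)
    also have "\<dots> = M * T powr (1 - \<epsilon>) * (((\<rho> / R) ^ k) powr (1 - \<epsilon>) / \<rho> ^ k)"
      using T \<rho> M by (simp add: \<eta>_def s_def powr_mult)
    also have "((\<rho> / R) ^ k) powr (1 - \<epsilon>) / \<rho> ^ k = (3 / (2 * R)) ^ k"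
    proof -
      have "(\<rho> / R) powr (- \<epsilon>) = (R / \<rho>) powr \<epsilon>"
        using \<rho> by (simp add: powr_minus powr_divide)
      hence q: "(\<rho> / R) powr (- \<epsilon>) = 3 / 2" using pe by simp
      have "((\<rho> / R) ^ k) powr (1 - \<epsilon>) = ((\<rho> / R) powr (1 - \<epsilon>)) ^ k"
        using \<rho> by (simp add: powr_powr powr_realpow[symmetric] mult.commute)
      also have "(\<rho> / R) powr (1 - \<epsilon>) = (\<rho> / R) powr 1 * (\<rho> / R) powr (- \<epsilon>)"
        unfolding powr_add[symmetric] by simp
      also have "\<dots> = \<rho> / R * (3 / 2)" unfolding q using \<rho> by simp
      finally show ?thesis using \<rho> by (simp add: power_divide power_mult_distrib)
    qed
    finally show "norm (p k u \<zeta>) \<le> M * T powr (1 - \<epsilon>) * (3 / (2 * R)) ^ k" .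
  qed
qed

text \<open>Baire's theorem gives a bound on a small ball around some b near 0. Off the exceptional
  line the Taylor series along complex lines through b converge on discs of the much larger radius
  R, though not uniformly in \<zeta>. The interpolated decay of the coefficients makes them
  uniformly bounded on a ball around b that contains all v with |v| < r/8. The radii 4, 2, 1, 1/4
  for \<zeta> are those of the domain, of Baire's bound, of holomorphy in v near b, and of the
  two-constants estimate.\<close>

lemma Hartogs_bounded_aux:
  fixes g :: "complex \<Rightarrow> complex^'n \<Rightarrow> complex"
  assumes r: "0 < r"
    and h1: "\<And>v. v \<in> ball 0 r \<Longrightarrow> (\<lambda>\<zeta>. g \<zeta> v) holomorphic_on ball 0 4"
    and h2: "\<And>\<zeta>. \<zeta> \<in> ball 0 4 \<Longrightarrow> Im \<zeta> \<noteq> c \<Longrightarrow> hol_n (ball 0 r) (g \<zeta>)"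
  obtains K where "\<And>\<zeta> v. norm \<zeta> < 1/4 \<Longrightarrow> norm v < r / 8 \<Longrightarrow> norm (g \<zeta> v) \<le> K"
proof -
  obtain b \<rho>0 M0 where b0: "0 < \<rho>0" "ball b \<rho>0 \<subseteq> ball 0 (r/8)"
    "\<And>\<zeta> v. \<zeta> \<in> ball 0 2 \<Longrightarrow> v \<in> ball b \<rho>0 \<Longrightarrow> norm (g \<zeta> v) \<le> M0"
  proof (rule Baire_uniform_bound[of "r/8" r g c])
    show "(\<lambda>\<zeta>. g \<zeta> v) holomorphic_on ball 0 4" if "v \<in> cball 0 (r/8)" for v
      using that r by (intro h1) auto
    show "continuous_on (ball 0 r) (g \<zeta>)" if "\<zeta> \<in> ball 0 4" "Im \<zeta> \<noteq> c" for \<zeta>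
      using h2[OF that] by (rule hol_n_continuous)
  qed (use r in auto)
  define \<rho> where "\<rho> = min \<rho>0 (r/8)"
  define M where "M = max M0 1"
  \<comment> \<open>As |b| < r/8, the ball of radius R around b lies in \<open>ball 0 r\<close>, and
    |v| < r/8 gives |v - b| \<le> R/2, inside the radius 2 R / 3 that the interpolation
    leaves.\<close>
  define R where "R = r / 2"
  have \<rho>: "0 < \<rho>" "\<rho> < R" using b0 r by (auto simp: \<rho>_def R_def)
  have M: "1 \<le> M" by (simp add: M_def)
  have R: "0 < R" using r by (simp add: R_def)
  have bn: "norm b < r / 8" using b0(1,2) by (meson centre_in_ball mem_ball_0 subsetD)
  have bR: "v \<in> ball 0 r" if "dist b v \<le> R" for v
    using that bn r norm_triangle_ineq2[of v b] by (simp add: dist_norm norm_minus_commute R_def)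
  have bM: "norm (g \<zeta> v) \<le> M" if "\<zeta> \<in> ball 0 2" "v \<in> ball b \<rho>" for \<zeta> v
    using b0(3)[of \<zeta> v] that by (simp add: \<rho>_def M_def)
  have sub: "ball b \<rho> \<subseteq> ball 0 r"
  proof
    fix v assume "v \<in> ball b \<rho>"
    thus "v \<in> ball 0 r" using bR[of v] \<rho> by simp
  qed
  have hol1: "hol_n (ball b \<rho>) (g \<zeta>)" if "\<zeta> \<in> ball 0 1" for \<zeta>
  proof (rule bounded_family_hol_n[where r = 2 and c = c and g = g])
    show "(\<lambda>\<zeta>. g \<zeta> v) holomorphic_on ball 0 2" if "v \<in> ball b \<rho>" for v
      by (rule holomorphic_on_subset[OF h1]) (use that sub in auto)
    show "hol_n (ball b \<rho>) (g \<zeta>)" if "\<zeta> \<in> ball 0 2" "Im \<zeta> \<noteq> c" for \<zeta>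
      by (rule hol_n_mono[OF h2]) (use that sub in auto)
  qed (use that bM in auto)
  \<comment> \<open>Directions of the complex lines through b. The closed unit ball contains u = 0,
    the direction that occurs for v = b.\<close>
  define I where "I = {u :: complex^'n. norm u \<le> 1}"
  define G where "G u \<zeta> w = g \<zeta> (b + w *s u)" for u \<zeta> w
  have wu: "norm (w *s u) \<le> norm w" if "u \<in> I" for w u
    using that by (simp add: I_def norm_scalar_mult mult_left_le)
  have inr: "b + w *s u \<in> ball b s" if "u \<in> I" "norm w < s" for u w s
    using wu[OF that(1), of w] that(2) by (simp add: dist_norm)
  have Ghol1: "G u \<zeta> holomorphic_on ball 0 \<rho>" if "u \<in> I" "\<zeta> \<in> ball 0 1" for u \<zeta>
    unfolding G_def by (rule hol_n_line[OF hol1]) (use that inr in auto)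
  have Ghol2: "G u \<zeta> holomorphic_on ball 0 R" if "u \<in> I" "\<zeta> \<in> ball 0 4" "Im \<zeta> \<noteq> c" for u \<zeta>
    unfolding G_def
  proof (rule hol_n_line[OF h2])
    show "b + w *s u \<in> ball 0 r" if "w \<in> ball 0 R" for w
      using inr[OF \<open>u \<in> I\<close>, of w R] that by (intro bR) auto
  qed (use that in auto)
  define p where "p k u \<zeta> = (deriv ^^ k) (G u \<zeta>) 0 / fact k" for k u \<zeta>
  \<comment> \<open>The second condition keeps \<open>A t\<close> off the exceptional line: on the
    line, holomorphy in v is known only on the small ball around b, and Cauchy's estimate with
    radius R would not be available.\<close>
  define A where "A t = {\<zeta> \<in> cball 0 1. \<forall>v\<in>ball b R. norm (g \<zeta> v) \<le> real t} \<inter>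
      {\<zeta>. inverse (real (Suc t)) \<le> \<bar>Im \<zeta> - c\<bar>}" for t :: nat
  have Aclosed: "closed (A t)" for t
  proof -
    have "A t = cball 0 1 \<inter> (\<Inter>v\<in>ball b R. {\<zeta> \<in> cball 0 1. norm (g \<zeta> v) \<le> real t}) \<inter>
        {\<zeta>. inverse (real (Suc t)) \<le> \<bar>Im \<zeta> - c\<bar>}"
      by (auto simp: A_def)
    moreover have "closed {\<zeta>. inverse (real (Suc t)) \<le> \<bar>Im \<zeta> - c\<bar>}"
      by (intro closed_Collect_le continuous_intros)
    moreover have "closed {\<zeta> \<in> cball 0 1. norm (g \<zeta> v) \<le> real t}" if "v \<in> ball b R" for v
    proof -
      have "(\<lambda>\<zeta>. g \<zeta> v) holomorphic_on cball 0 1"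
        by (rule holomorphic_on_subset[OF h1]) (use that bR[of v] in auto)
      hence "continuous_on (cball 0 1) (\<lambda>\<zeta>. norm (g \<zeta> v))"
        by (intro continuous_intros holomorphic_on_imp_continuous_on)
      from continuous_closed_preimage[OF this, of "{..real t}"]
      show ?thesis by (simp add: vimage_def Int_def)
    qed
    ultimately show ?thesis by (simp add: closed_Int closed_INT)
  qed
  have Amono: "incseq A"
    unfolding incseq_def
  proof (intro allI impI subsetI)
    fix s t :: nat and \<zeta> assume st: "s \<le> t" and z: "\<zeta> \<in> A s"
    have "inverse (real (Suc t)) \<le> inverse (real (Suc s))"
      using st by (intro le_imp_inverse_le) auto
    also have "\<dots> \<le> \<bar>Im \<zeta> - c\<bar>" using z unfolding A_def by blast
    finally have 1: "inverse (real (Suc t)) \<le> \<bar>Im \<zeta> - c\<bar>" .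
    have "norm (g \<zeta> v) \<le> real t" if "v \<in> ball b R" for v
    proof -
      have "norm (g \<zeta> v) \<le> real s" using z that unfolding A_def by blast
      also have "\<dots> \<le> real t" using st by simp
      finally show ?thesis .
    qed
    thus "\<zeta> \<in> A t" using z 1 unfolding A_def by blast
  qed
  have Acov: "\<exists>t. \<zeta> \<in> A t" if "norm \<zeta> \<le> 1" "Im \<zeta> \<noteq> c" for \<zeta>
  proof -
    have "continuous_on (cball b R) (g \<zeta>)"
      by (rule continuous_on_subset[OF hol_n_continuous[OF h2]]) (use that bR in auto)
    hence "bounded (g \<zeta> ` cball b R)"
      by (intro compact_imp_bounded compact_continuous_image) auto
    then obtain B where B: "\<forall>v\<in>cball b R. norm (g \<zeta> v) \<le> B" unfolding bounded_iff by blast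
    obtain t1 :: nat where t1: "B \<le> real t1" using real_arch_simple by blast
    obtain t2 where t2: "inverse (real (Suc t2)) < \<bar>Im \<zeta> - c\<bar>"
      using reals_Archimedean[of "\<bar>Im \<zeta> - c\<bar>"] \<open>Im \<zeta> \<noteq> c\<close> by auto
    define t where "t = max t1 t2"
    have t: "B \<le> real t" using t1 by (simp add: t_def)
    have "inverse (real (Suc t)) \<le> inverse (real (Suc t2))"
      by (intro le_imp_inverse_le) (auto simp: t_def)
    hence t3: "inverse (real (Suc t)) \<le> \<bar>Im \<zeta> - c\<bar>" using t2 by linarith
    have "norm (g \<zeta> v) \<le> real t" if "v \<in> ball b R" for v
      using B that by (intro order_trans[OF _ t]) auto
    hence "\<zeta> \<in> A t" using that t3 unfolding A_def by (simp del: of_nat_Suc)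
    thus ?thesis by blast
  qed
  have phol: "p k u holomorphic_on ball 0 1" if "u \<in> I" for k u
    unfolding p_def
  proof (rule Taylor_coeffs_holomorphic[OF \<rho>(1)])
    show "(\<lambda>\<zeta>. G u \<zeta> w) holomorphic_on ball 0 1" if "w \<in> ball 0 \<rho>" for w
      unfolding G_def
    proof (rule holomorphic_on_subset[OF h1])
      show "b + w *s u \<in> ball 0 r" using inr[OF \<open>u \<in> I\<close>, of w R] that \<rho> by (intro bR) auto
    qed auto
    show "norm (G u \<zeta> w) \<le> M" if "\<zeta> \<in> ball 0 1" "w \<in> ball 0 \<rho>" for \<zeta> w
      unfolding G_def by (rule bM) (use that inr[OF \<open>u \<in> I\<close>, of w \<rho>] in auto)
  qed (use Ghol1 that in auto)
  have pb1: "norm (p k u \<zeta>) \<le> M / \<rho> ^ k" if "u \<in> I" "\<zeta> \<in> ball 0 1" for k u \<zeta>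
    unfolding p_def
  proof (rule Cauchy_coeff_bound[OF Ghol1[OF that] \<rho>(1)])
    show "norm (G u \<zeta> w) \<le> M" if "w \<in> ball 0 \<rho>" for w
      unfolding G_def using bM[of \<zeta> "b + w *s u"] inr[OF \<open>u \<in> I\<close>, of w \<rho>] \<open>\<zeta> \<in> ball 0 1\<close> that by simp
  qed
  have pb2: "norm (p k u \<zeta>) \<le> real t / R ^ k" if "u \<in> I" "\<zeta> \<in> A t \<inter> ball 0 1" for k u \<zeta> t
    unfolding p_def
  proof (rule Cauchy_coeff_bound[OF Ghol2[OF \<open>u \<in> I\<close>] R])
    have "0 < inverse (real (Suc t))" by simp
    thus "Im \<zeta> \<noteq> c" using that unfolding A_def by (auto simp del: of_nat_Suc)
    show "norm (G u \<zeta> w) \<le> real t" if "w \<in> ball 0 R" for w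
      unfolding G_def using \<open>\<zeta> \<in> A t \<inter> ball 0 1\<close> inr[OF \<open>u \<in> I\<close>, of w R] that by (auto simp: A_def)
  qed (use that in auto)
  obtain C k0 where C: "\<And>k u \<zeta>. k0 \<le> k \<Longrightarrow> u \<in> I \<Longrightarrow> norm \<zeta> < 1/4 \<Longrightarrow> norm (p k u \<zeta>) \<le> C * (3 / (2 * R)) ^ k"
    by (rule Taylor_coeff_decay[where A = A and c = c and I = I and p = p,
          OF Aclosed Amono Acov M \<rho> phol pb1 pb2], assumption+, rule that, assumption+)
  define K where "K = (\<Sum>k<k0. M / \<rho> ^ k * (R / 2) ^ k) + C * 4"
  show ?thesis
  proof (rule that[of K])
    fix \<zeta> :: complex and v :: "complex^'n"
    assume z: "norm \<zeta> < 1/4" and v: "norm v < r / 8"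
    show "norm (g \<zeta> v) \<le> K"
    \<comment> \<open>Off the line the power series represents g up to radius R; the bound obtained
      there extends to the line by continuity in \<zeta>.\<close>
    proof (rule bound_off_horizontal_line[of "ball 0 (1/4)" "\<lambda>\<zeta>. g \<zeta> v"])
      show "continuous_on (ball 0 (1/4)) (\<lambda>\<zeta>. g \<zeta> v)"
        by (intro holomorphic_on_imp_continuous_on holomorphic_on_subset[OF h1]) (use v r in auto)
    next
      fix \<zeta> :: complex assume z: "\<zeta> \<in> ball 0 (1/4)" and good: "Im \<zeta> \<noteq> c"
      define w where "w = complex_of_real (norm (v - b))"
      define d where "d = v - b"
      define u where "u = inverse w *s d"
      have wd: "norm w = norm d" by (simp add: w_def d_def)
      have "norm u = inverse (norm w) * norm d" by (simp add: u_def norm_scalar_mult norm_inverse)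
      hence u: "u \<in> I" unfolding I_def wd by (cases "d = 0") auto
      have "w *s u = d"
      proof (cases "d = 0")
        case False
        hence "w \<noteq> 0" using wd by auto
        thus ?thesis by (simp add: u_def vec_eq_iff)
      qed (simp add: u_def vec_eq_iff)
      hence vu: "v = b + w *s u" by (simp add: d_def)
      have w: "norm w \<le> R / 2"
        using norm_triangle_ineq4[of v b] v bn by (simp add: w_def R_def)
      have "(\<lambda>k. p k u \<zeta> * (w - 0) ^ k) sums G u \<zeta> w"
        unfolding p_def by (rule holomorphic_power_series[OF Ghol2[OF u _ good]]) (use z w R in auto)
      hence s: "(\<lambda>k. p k u \<zeta> * w ^ k) sums g \<zeta> v" by (simp add: G_def vu[symmetric])
      hence s2: "(\<lambda>k. p (k + k0) u \<zeta> * w ^ (k + k0)) sums (g \<zeta> v - (\<Sum>k<k0. p k u \<zeta> * w ^ k))"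
        by (subst sums_iff_shift) simp
      have "0 \<le> C * (3 / (2 * R)) ^ k0"
        using C[OF order_refl u, of \<zeta>] z norm_ge_zero[of "p k0 u \<zeta>"] by (simp del: norm_ge_zero)
      hence C0: "0 \<le> C" using mult_right_le_imp_le[of 0 "(3 / (2 * R)) ^ k0" C] R by simp
      \<comment> \<open>The ratio 3/4 is 3 / (2 R) times the bound R / 2 for |w|.\<close>
      have t: "norm (p (k + k0) u \<zeta> * w ^ (k + k0)) \<le> C * (3/4) ^ k" for k
      proof -
        have "norm (p (k + k0) u \<zeta> * w ^ (k + k0)) \<le> C * (3 / (2 * R)) ^ (k + k0) * (R / 2) ^ (k + k0)"
          unfolding norm_mult norm_power
          by (intro mult_mono C u power_mono w) (use z R C0 in auto)
        also have "\<dots> = C * (3/4) ^ (k + k0)"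
          using R by (simp add: power_mult_distrib[symmetric] mult.assoc)
        also have "\<dots> \<le> C * (3/4) ^ k" using C0 by (intro mult_left_mono power_decreasing) auto
        finally show ?thesis .
      qed
      have gs: "(\<lambda>k. C * (3/4) ^ k) sums (C * 4)"
        using sums_mult[OF geometric_sums[of "3/4::real"], of C] by simp
      have "norm (\<Sum>k. p (k + k0) u \<zeta> * w ^ (k + k0)) \<le> (\<Sum>k. C * (3/4) ^ k)"
        by (rule norm_suminf_le[OF t sums_summable[OF gs]])
      hence tail: "norm (g \<zeta> v - (\<Sum>k<k0. p k u \<zeta> * w ^ k)) \<le> C * 4"
        using sums_unique[OF s2] sums_unique[OF gs] by simp
      have head: "norm (\<Sum>k<k0. p k u \<zeta> * w ^ k) \<le> (\<Sum>k<k0. M / \<rho> ^ k * (R / 2) ^ k)"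
      proof (rule order_trans[OF norm_sum sum_mono])
        fix k
        show "norm (p k u \<zeta> * w ^ k) \<le> M / \<rho> ^ k * (R / 2) ^ k"
          unfolding norm_mult norm_power
          by (intro mult_mono pb1 u power_mono w) (use z M \<rho> in auto)
      qed
      show "norm (g \<zeta> v) \<le> K"
        using norm_triangle_ineq[of "g \<zeta> v - (\<Sum>k<k0. p k u \<zeta> * w ^ k)" "\<Sum>k<k0. p k u \<zeta> * w ^ k"] head tail
        by (simp add: K_def)
    qed (use z in auto)
  qed
qed

text \<open>Scaling \<zeta> by r/4 takes the disc of radius 4 to the disc of radius r, and pulls the
  line Im = c back to Im = 4 c / r. The radius r/16 is (r/4)(1/4) in \<zeta> and is below r/8 in
  v.\<close>

lemma Hartogs_bounded:
  fixes g :: "complex \<Rightarrow> complex^'n \<Rightarrow> complex"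
  assumes r: "0 < r"
    and h1: "\<And>v. v \<in> ball 0 r \<Longrightarrow> (\<lambda>\<zeta>. g \<zeta> v) holomorphic_on ball 0 r"
    and h2: "\<And>\<zeta>. \<zeta> \<in> ball 0 r \<Longrightarrow> Im \<zeta> \<noteq> c \<Longrightarrow> hol_n (ball 0 r) (g \<zeta>)"
  obtains \<delta> K where "0 < \<delta>" "\<delta> < r" "\<And>\<zeta> v. norm \<zeta> < \<delta> \<Longrightarrow> norm v < \<delta> \<Longrightarrow> norm (g \<zeta> v) \<le> K"
proof -
  define s where "s = complex_of_real (r / 4)"
  have ns: "norm s = r / 4" using r unfolding s_def norm_of_real by simp
  have sb: "s * \<zeta> \<in> ball 0 r" if "\<zeta> \<in> ball 0 4" for \<zeta>
  proof -
    have "norm \<zeta> * (r / 4) < 4 * (r / 4)" using that r by (intro mult_strict_right_mono) auto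
    thus ?thesis by (simp add: norm_mult ns mult.commute)
  qed
  obtain K where K: "\<And>\<zeta> v. norm \<zeta> < 1/4 \<Longrightarrow> norm v < r / 8 \<Longrightarrow> norm (g (s * \<zeta>) v) \<le> K"
  proof (rule Hartogs_bounded_aux[OF r, of "\<lambda>\<zeta>. g (s * \<zeta>)" "4 * c / r"])
    show "(\<lambda>\<zeta>. g (s * \<zeta>) v) holomorphic_on ball 0 4" if "v \<in> ball 0 r" for v
      by (rule holomorphic_on_compose_gen[OF _ h1[OF that], unfolded o_def])
        (auto intro!: holomorphic_intros dest: sb[simplified])
    show "hol_n (ball 0 r) (g (s * \<zeta>))" if "\<zeta> \<in> ball 0 4" "Im \<zeta> \<noteq> 4 * c / r" for \<zeta>
      by (rule h2[OF sb[OF that(1)]]) (use that r in \<open>auto simp: s_def field_simps\<close>)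
  qed blast
  show ?thesis
  proof (rule that[of "r / 16" K])
    fix \<zeta> :: complex and v :: "complex^'n" assume z: "norm \<zeta> < r / 16" and v: "norm v < r / 16"
    have s0: "s \<noteq> 0" using ns r by auto
    have "norm (\<zeta> / s) < 1/4" using z r by (simp add: norm_divide ns field_simps)
    from K[OF this, of v] show "norm (g \<zeta> v) \<le> K" using v s0 r by simp
  qed (use r in auto)
qed

section \<open>Induction over the variables\<close>

definition rst :: "'n set \<Rightarrow> complex^'n \<Rightarrow> complex^'n" where
  "rst T v = (\<chi> l. if l \<in> T then v $ l else 0)"

lemma continuous_rst [continuous_intros]:
  "continuous_on S f \<Longrightarrow> continuous_on S (\<lambda>x. rst T (f x))"
  unfolding rst_def
proof (intro continuous_on_vec_lambda)
  fix i assume "continuous_on S f"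
  thus "continuous_on S (\<lambda>x. if i \<in> T then f x $ i else 0)"
    by (cases "i \<in> T") (auto intro!: continuous_intros)
qed

lemma rst_0 [simp]: "rst T 0 = 0"
  by (simp add: rst_def vec_eq_iff)

lemma norm_rst_le: "norm (rst T v) \<le> norm v"
  by (rule norm_le_componentwise_cart) (simp add: rst_def)

lemma rst_axis: "rst T (axis l w) = (if l \<in> T then axis l w else 0)"
  by (auto simp: rst_def axis_def vec_eq_iff)

lemma rst_add: "rst T (v + w) = rst T v + rst T w"
  by (auto simp: rst_def vec_eq_iff)

lemma rst_insert: "q \<notin> T \<Longrightarrow> rst (insert q T) v = axis q (v $ q) + rst T v"
  by (auto simp: rst_def vec_eq_iff axis_def)

text \<open>Joint holomorphy in the coordinates in T, with the others frozen at z. As a function of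
  v it ignores the coordinates outside T, so \<open>hol_n\<close> on the full space can express
  it.\<close>

definition hol_at :: "(complex^'n) set \<Rightarrow> (complex^'n \<Rightarrow> complex) \<Rightarrow> 'n set \<Rightarrow> complex^'n \<Rightarrow> bool" where
  "hol_at D \<Phi> T z \<longleftrightarrow> hol_n {v. z + rst T v \<in> D} (\<lambda>v. \<Phi> (z + rst T v))"

lemma open_rst_slice: "open D \<Longrightarrow> open {v. z + rst T v \<in> D}"
  using open_vimage[of D "\<lambda>v. z + rst T v"] by (simp add: vimage_def continuous_intros)

text \<open>Around each point, \<open>Hartogs_bounded\<close> supplies a bound; boundedness gives
  equicontinuity in the new variable, hence joint continuity, and Osgood's theorem
  concludes.\<close>

lemma Hartogs_step:
  fixes \<Phi> :: "complex^'n \<Rightarrow> complex"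
  assumes D: "open D" and q: "q \<notin> T"
    and a: "\<And>v. z0 + rst (insert q T) v \<in> D \<Longrightarrow>
      (\<lambda>w. \<Phi> (z0 + rst (insert q T) v + axis q w)) field_differentiable (at 0)"
    and b: "\<And>v. z0 + rst (insert q T) v \<in> D \<Longrightarrow> Im ((z0 + v) $ q) \<noteq> 0 \<Longrightarrow>
      hol_at D \<Phi> T (z0 + rst (insert q T) v)"
  shows "hol_at D \<Phi> (insert q T) z0"
proof -
  let ?R = "rst (insert q T)"
  let ?E = "{v. z0 + ?R v \<in> D}"
  let ?\<Psi> = "\<lambda>v. \<Phi> (z0 + ?R v)"
  have E: "open ?E" by (rule open_rst_slice[OF D])
  have key: "isCont ?\<Psi> v1 \<and> (\<forall>l. (\<lambda>w. ?\<Psi> (v1 + axis l w)) field_differentiable (at 0))" if v1: "v1 \<in> ?E" for v1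
  proof -
    define p where "p = z0 + ?R v1"
    have p: "p \<in> D" using v1 by (simp add: p_def)
    then obtain e where e: "0 < e" "ball p e \<subseteq> D" using D open_contains_ball by blast
    define r where "r = e / 2"
    have r: "0 < r" using e by (simp add: r_def)
    \<comment> \<open>Local coordinates at p: \<zeta> for the variable q and v for those in T. The
      coordinate q of the moved point is real exactly when Im \<zeta> = - Im (p $ q), the
      exceptional line.\<close>
    define g where "g \<zeta> v = \<Phi> (p + axis q \<zeta> + rst T v)" for \<zeta> v
    have inD: "p + axis q \<zeta> + rst T v \<in> D" if "norm \<zeta> < r" "norm v < r" for \<zeta> v
    proof -
      have "norm (axis q \<zeta> + rst T v) \<le> norm \<zeta> + norm v"
        using norm_triangle_ineq[of "axis q \<zeta>" "rst T v"] norm_rst_le[of T v] by (simp add: norm_axis)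
      also have "\<dots> < e" using that by (simp add: r_def)
      finally have "dist (p + (axis q \<zeta> + rst T v)) p < e" by (simp add: dist_norm)
      hence "p + axis q \<zeta> + rst T v \<in> ball p e" by (simp add: dist_commute add.assoc)
      thus ?thesis using e by blast
    qed
    have pR: "p + axis q \<zeta> + rst T v = z0 + ?R (v1 + axis q \<zeta> + rst T v)" for \<zeta> v
      using q by (auto simp: p_def rst_def axis_def vec_eq_iff)
    have h1: "(\<lambda>\<zeta>. g \<zeta> v) holomorphic_on ball 0 r" if v: "v \<in> ball 0 r" for v
      unfolding holomorphic_on_open[OF open_ball]
    proof
      fix \<zeta> :: complex assume z: "\<zeta> \<in> ball 0 r"
      have "(\<lambda>w. \<Phi> (p + axis q \<zeta> + rst T v + axis q w)) field_differentiable (at 0)"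
        unfolding pR by (rule a) (use inD[of \<zeta> v] z v pR[of \<zeta> v] in auto)
      then obtain f' where "((\<lambda>w. \<Phi> (p + axis q \<zeta> + rst T v + axis q w)) has_field_derivative f') (at 0)"
        unfolding field_differentiable_def by blast
      hence "((\<lambda>w. g (w + \<zeta>) v) has_field_derivative f') (at 0)"
        by (simp add: g_def axis_add add_ac)
      hence "((\<lambda>\<zeta>. g \<zeta> v) has_field_derivative f') (at \<zeta>)"
        by (subst (asm) DERIV_shift[symmetric]) simp
      thus "\<exists>f'. ((\<lambda>\<zeta>. g \<zeta> v) has_field_derivative f') (at \<zeta>)" by blast
    qed
    have h2: "hol_n (ball 0 r) (g \<zeta>)" if z: "\<zeta> \<in> ball 0 r" "Im \<zeta> \<noteq> - Im (p $ q)" for \<zeta>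
    proof -
      have P: "p + axis q \<zeta> = z0 + ?R (v1 + axis q \<zeta>)" using pR[of \<zeta> 0] by simp
      have "p + axis q \<zeta> \<in> D" using inD[of \<zeta> 0] z r by simp
      moreover have "Im ((z0 + (v1 + axis q \<zeta>)) $ q) \<noteq> 0"
        using z(2) by (simp add: p_def rst_def axis_def)
      ultimately have "hol_at D \<Phi> T (p + axis q \<zeta>)" unfolding P by (intro b)
      thus ?thesis unfolding hol_at_def g_def
        by (rule hol_n_mono) (use inD z in auto)
    qed
    obtain \<delta> K where \<delta>: "0 < \<delta>" "\<delta> < r" and K: "\<And>\<zeta> v. norm \<zeta> < \<delta> \<Longrightarrow> norm v < \<delta> \<Longrightarrow> norm (g \<zeta> v) \<le> K"
      using Hartogs_bounded[OF r h1 h2] by blast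
    have h1': "(\<lambda>\<zeta>. g \<zeta> v) holomorphic_on ball 0 \<delta>" if "v \<in> ball 0 \<delta>" for v
      by (rule holomorphic_on_subset[OF h1]) (use that \<delta> in auto)
    have hol0: "hol_n (ball 0 \<delta>) (g 0)"
    proof (rule bounded_family_hol_n[where g = g and c = "- Im (p $ q)", OF open_ball \<delta>(1) h1'])
      show "hol_n (ball 0 \<delta>) (g \<zeta>)" if "\<zeta> \<in> ball 0 \<delta>" "Im \<zeta> \<noteq> - Im (p $ q)" for \<zeta>
        by (rule hol_n_mono[OF h2]) (use that \<delta> in auto)
    qed (use K \<delta> in auto)
    have \<Psi>g: "?\<Psi> (v1 + v) = g (v $ q) v" for v
      using q by (simp add: g_def p_def rst_insert rst_add axis_add add_ac)
    have "isCont ?\<Psi> v1"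
    proof -
      have ev: "\<forall>\<^sub>F v in at 0. norm v < \<delta> / 2"
        using \<delta> by (auto simp: eventually_at intro!: exI[of _ "\<delta> / 2"])
      \<comment> \<open>The change in the variable q is controlled by a Lipschitz constant uniform
        in v; what is left, g 0, is already jointly continuous.\<close>
      have "((\<lambda>v. g (v $ q) v - g 0 v) \<longlongrightarrow> 0) (at 0)"
      proof (rule Lim_null_comparison)
        show "\<forall>\<^sub>F v in at 0. norm (g (v $ q) v - g 0 v) \<le> 2 * K / \<delta> * norm (v $ q - 0)"
          using ev
        proof eventually_elim
          case (elim v)
          have "norm (v $ q) < \<delta> / 2" using elim Finite_Cartesian_Product.norm_nth_le[of v q] by linarith
          thus ?case
            by (intro bounded_holomorphic_Lipschitz[OF h1' \<delta>(1)] K) (use elim \<delta> in auto)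
        qed
        have "((\<lambda>v::complex^'n. 2 * K / \<delta> * norm (v $ q - 0)) \<longlongrightarrow> 2 * K / \<delta> * norm ((0::complex^'n) $ q - 0)) (at 0)"
          by (intro tendsto_intros)
        thus "((\<lambda>v. 2 * K / \<delta> * norm (v $ q - 0)) \<longlongrightarrow> 0) (at (0::complex^'n))" by simp
      qed
      moreover have "(g 0 \<longlongrightarrow> g 0 0) (at 0)"
        using hol_n_continuous[OF hol0] \<delta> by (simp add: continuous_on_eq_continuous_at isCont_def)
      ultimately have "((\<lambda>v. (g (v $ q) v - g 0 v) + g 0 v) \<longlongrightarrow> 0 + g 0 0) (at 0)"
        by (intro tendsto_add)
      hence "((\<lambda>v. ?\<Psi> (v1 + v)) \<longlongrightarrow> ?\<Psi> (v1 + 0)) (at 0)"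
        unfolding \<Psi>g by simp
      thus ?thesis unfolding isCont_iff by simp
    qed
    moreover have "(\<lambda>w. ?\<Psi> (v1 + axis l w)) field_differentiable (at 0)" for l
    proof (cases "l = q")
      case True
      have "?\<Psi> (v1 + axis l w) = \<Phi> (z0 + ?R v1 + axis q w)" for w
        using True by (simp add: rst_add rst_axis add_ac)
      thus ?thesis using a v1 by simp
    next
      case False
      hence "?\<Psi> (v1 + axis l w) = g 0 (0 + axis l w)" for w
        unfolding \<Psi>g by (simp add: axis_def)
      moreover have "(\<lambda>w. g 0 (0 + axis l w)) field_differentiable (at 0)"
        using hol_n_imp_sep_hol[OF hol0] \<delta> unfolding sep_hol_def by (metis centre_in_ball)
      ultimately show ?thesis by simp
    qed
    ultimately show ?thesis by blast
  qed
  show ?thesis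
    unfolding hol_at_def
  proof (rule Osgood[OF E])
    show "continuous_on ?E ?\<Psi>" using key by (blast intro: continuous_at_imp_continuous_on)
    show "sep_hol ?E ?\<Psi>" using key unfolding sep_hol_def by blast
  qed
qed

theorem Hartogs:
  fixes D :: "(complex ^ 'n::{finite,linorder}) set"
  assumes D: "open D"
    and h: "\<And>q z. z \<in> D \<Longrightarrow> (\<And>l. l < q \<Longrightarrow> Im (z $ l) \<noteq> 0) \<Longrightarrow>
      (\<lambda>w. \<Phi> (z + axis q w)) field_differentiable (at 0)"
  shows "hol_n D \<Phi>"
proof -
  \<comment> \<open>T runs through the up-sets of the variables, enlarged by a new minimum b at each
    step. Coordinates outside T are kept non-real, which is what the hypothesis for b requires of
    the smaller variables, while those in T may be real.\<close>
  have claim: "(\<forall>a\<in>T. \<forall>l. a < l \<longrightarrow> l \<in> T) \<longrightarrow>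
      (\<forall>z\<in>D. (\<forall>l. l \<notin> T \<longrightarrow> Im (z $ l) \<noteq> 0) \<longrightarrow> hol_at D \<Phi> T z)" if "finite T" for T :: "'n set"
    using that
  proof (induction T rule: finite_linorder_min_induct)
    case empty
    have c: "rst {} v = 0" for v :: "complex^'n::{finite,linorder}" by (simp add: rst_def vec_eq_iff)
    show ?case
      unfolding hol_at_def c by (auto intro!: Osgood D simp: sep_hol_def)
  next
    case (insert b A)
    have bA: "b \<notin> A" using insert.hyps by blast
    show ?case
    proof (intro impI ballI)
      fix z0 assume up: "\<forall>a\<in>insert b A. \<forall>l>a. l \<in> insert b A" and z0: "z0 \<in> D"
        and im: "\<forall>l. l \<notin> insert b A \<longrightarrow> Im (z0 $ l) \<noteq> 0"
      have upA: "\<forall>a\<in>A. \<forall>l>a. l \<in> A" using up insert.hyps by (metis insertCI insertE less_asym)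
      have off: "(z0 + rst (insert b A) v) $ l = z0 $ l" if "l < b" for l v
        using that insert.hyps by (auto simp: rst_def)
      have ltb: "l < b" if "l \<notin> insert b A" for l
        using that up by (metis insertI1 linorder_less_linear)
      have ltb': "l \<notin> insert b A" if "l < b" for l
        using that insert.hyps by auto
      show "hol_at D \<Phi> (insert b A) z0"
      proof (rule Hartogs_step[OF D bA])
        fix v assume v: "z0 + rst (insert b A) v \<in> D"
        show "(\<lambda>w. \<Phi> (z0 + rst (insert b A) v + axis b w)) field_differentiable at 0"
          by (rule h[OF v]) (use off im ltb' in auto)
        assume q: "Im ((z0 + v) $ b) \<noteq> 0"
        have e: "Im ((z0 + rst (insert b A) v) $ l) \<noteq> 0" if l: "l \<notin> A" for l
        proof (cases "l = b")
          case True
          thus ?thesis using q by (simp add: rst_def)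
        next
          case False
          hence "l \<notin> insert b A" using l by simp
          thus ?thesis using off[OF ltb] im by simp
        qed
        from insert.IH[THEN mp, OF upA, THEN bspec, OF v, THEN mp]
        show "hol_at D \<Phi> A (z0 + rst (insert b A) v)" using e by iprover
      qed
    qed
  qed
  have R: "rst UNIV v = v" for v :: "complex^'n::{finite,linorder}" by (simp add: rst_def vec_eq_iff)
  have at: "hol_n {v. z + v \<in> D} (\<lambda>v. \<Phi> (z + v))" if "z \<in> D" for z
    using claim[of UNIV] that unfolding hol_at_def R by simp
  show ?thesis
  proof (rule Osgood[OF D])
    have "isCont \<Phi> z" if "z \<in> D" for z
    proof -
      have "open {v. z + v \<in> D}" using open_rst_slice[OF D, of z UNIV] by (simp add: R)
      hence "isCont (\<lambda>v. \<Phi> (z + v)) 0"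
        using hol_n_continuous[OF at[OF that]] that by (simp add: continuous_on_eq_continuous_at)
      hence "((\<lambda>v. \<Phi> (z + v)) \<longlongrightarrow> \<Phi> z) (at 0)" by (simp add: isCont_def)
      thus ?thesis by (simp only: isCont_iff)
    qed
    thus "continuous_on D \<Phi>" by (blast intro: continuous_at_imp_continuous_on)
    show "sep_hol D \<Phi>"
      unfolding sep_hol_def
    proof (intro ballI allI)
      fix z l assume z: "z \<in> D"
      have s: "\<forall>v\<in>{v. z + v \<in> D}. \<forall>l. (\<lambda>w. \<Phi> (z + (v + axis l w))) field_differentiable at 0"
        using hol_n_imp_sep_hol[OF at[OF z]] unfolding sep_hol_def .
      have "(\<lambda>w. \<Phi> (z + (0 + axis l w))) field_differentiable at 0"
        using bspec[OF s, of 0] z by simp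
      thus "(\<lambda>w. \<Phi> (z + axis l w)) field_differentiable at 0" by (simp only: add_0_left)
    qed
  qed
qed

subsection \<open>The imaginary sphere\<close>

lemma cl_coeff_gen: "cl_coeff (cl_gen k) A = (if A = {k} then 1 else 0)"
  by (simp add: cl_coeff_def cl_gen_def Clifford_inverse axis_def)

lemma cl_coeff_sum: "cl_coeff (\<Sum>i\<in>S. a i) A = (\<Sum>i\<in>S. cl_coeff (a i) A)"
  by (induction S rule: infinite_finite_induct) auto

text \<open>Adding the double sum for J J to its transpose leaves only anticommutators of
  generators.\<close>

lemma imag_sphere_square:
  assumes "J \<in> imag_sphere" shows "J * J = -1"
proof -
  obtain v :: "'a \<Rightarrow> real" where J: "J = (\<Sum>i\<in>UNIV. v i *\<^sub>R cl_gen i)" and v: "(\<Sum>i\<in>UNIV. (v i)\<^sup>2) = 1"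
    using assms by (auto simp: imag_sphere_def)
  have J2: "J * J = (\<Sum>i\<in>UNIV. \<Sum>j\<in>UNIV. (v i * v j) *\<^sub>R (cl_gen i * cl_gen j))"
    by (simp add: J sum_product mult.commute)
  also have "\<dots> = (\<Sum>i\<in>UNIV. \<Sum>j\<in>UNIV. (v i * v j) *\<^sub>R (cl_gen j * cl_gen i))"
    by (subst sum.swap) (intro sum.cong refl, simp add: mult.commute)
  finally have "J * J + J * J = (\<Sum>i\<in>UNIV. \<Sum>j\<in>UNIV. (v i * v j) *\<^sub>R (cl_gen i * cl_gen j + cl_gen j * cl_gen i))"
    by (simp add: scaleR_add_right sum.distrib flip: J2)
  also have "\<dots> = (\<Sum>i\<in>UNIV. (v i)\<^sup>2 *\<^sub>R (- 2))"
    by (simp add: cl_gen_anticommute if_distrib power2_eq_square cong: if_cong)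
  also have "\<dots> = - 2" unfolding scaleR_sum_left[symmetric] v by simp
  finally have "2 *\<^sub>R (J * J) = 2 *\<^sub>R (- 1)" by (simp add: scaleR_2)
  thus ?thesis by (simp only: scaleR_cancel_left) simp
qed

lemma imag_sphere_uminus:
  assumes "J \<in> imag_sphere" shows "- J \<in> imag_sphere"
proof -
  obtain v :: "'a \<Rightarrow> real" where J: "J = (\<Sum>i\<in>UNIV. v i *\<^sub>R cl_gen i)" and v: "(\<Sum>i\<in>UNIV. (v i)\<^sup>2) = 1"
    using assms by (auto simp: imag_sphere_def)
  have "- J = (\<Sum>i\<in>UNIV. (- v i) *\<^sub>R cl_gen i)" "(\<Sum>i\<in>UNIV. (- v i)\<^sup>2) = 1"
    using v by (simp_all add: J sum_negf)
  thus ?thesis unfolding imag_sphere_def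
    by (intro CollectI exI[of _ "\<lambda>i. - v i"]) simp
qed

lemma cl_gen_imag_sphere: "cl_gen i \<in> imag_sphere"
  unfolding imag_sphere_def
  by (auto simp: if_distrib if_distribR cong: if_cong intro!: exI[of _ "\<lambda>j. if j = i then 1 else 0"])

lemma cl_coeff_imag_sphere: "J \<in> imag_sphere \<Longrightarrow> cl_coeff J {} = 0"
  by (auto simp: imag_sphere_def cl_coeff_sum cl_coeff_gen)

lemma slice_pt1_alt: "slice_pt1 J w = of_real (Re w) + Im w *\<^sub>R J"
  by (simp add: slice_pt1_def scaleR_conv_of_real[symmetric] of_real_def)

text \<open>The coefficient of 1 gives equal real parts. Squaring what remains, with J J = -1, shows
  that the imaginary parts agree up to sign.\<close>

lemma slice_pt1_eq_cases:
  assumes J: "J \<in> imag_sphere" "J' \<in> imag_sphere" and eq: "slice_pt1 J w = slice_pt1 J' w'"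
  shows "(w' = w \<and> (Im w = 0 \<or> J' = J)) \<or> (w' = cnj w \<and> Im w \<noteq> 0 \<and> J' = - J)"
proof -
  have c: "cl_coeff (slice_pt1 J w) {} = Re w" if "J \<in> imag_sphere" for J :: "'a clifford" and w
    using cl_coeff_imag_sphere[OF that] by (simp add: slice_pt1_alt of_real_def)
  have re: "Re w' = Re w" using c[OF J(1), of w] c[OF J(2), of w'] eq by simp
  have im: "Im w *\<^sub>R J = Im w' *\<^sub>R J'" using eq re by (simp add: slice_pt1_alt)
  hence "(Im w *\<^sub>R J) * (Im w *\<^sub>R J) = (Im w' *\<^sub>R J') * (Im w' *\<^sub>R J')" by simp
  hence "(Im w * Im w) *\<^sub>R (- 1 :: 'a clifford) = (Im w' * Im w') *\<^sub>R (- 1)"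
    by (simp add: imag_sphere_square[OF J(1)] imag_sphere_square[OF J(2)])
  hence "Im w * Im w = Im w' * Im w'" by (simp only: scaleR_cancel_right) simp
  hence "Im w' = Im w \<or> Im w' = - Im w" by (auto simp: square_eq_iff)
  thus ?thesis
  proof
    assume *: "Im w' = Im w"
    thus ?thesis using im re by (auto simp: complex_eq_iff)
  next
    assume *: "Im w' = - Im w"
    hence "Im w = 0 \<or> J' = - J" using im by (auto simp flip: scaleR_minus_right)
    thus ?thesis using * re by (auto simp: complex_eq_iff)
  qed
qed

subsection \<open>Ordered products and sign flips\<close>

lemma ordered_prod_empty [simp]: "ordered_prod J {} = 1"
  by (simp add: ordered_prod_def)

lemma ordered_prod_cong: "finite K \<Longrightarrow> (\<And>l. l \<in> K \<Longrightarrow> J l = J' l) \<Longrightarrow> ordered_prod J K = ordered_prod J' K"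
  by (auto simp: ordered_prod_def intro!: arg_cong[where f = prod_list])

lemma ordered_prod_scaleR:
  fixes J :: "'n::linorder \<Rightarrow> 'a::real_algebra_1"
  assumes "finite K"
  shows "ordered_prod (\<lambda>l. \<sigma> l *\<^sub>R J l) K = (\<Prod>l\<in>K. \<sigma> l) *\<^sub>R ordered_prod J K"
proof -
  have "prod_list (map (\<lambda>l. \<sigma> l *\<^sub>R J l) xs) = prod_list (map \<sigma> xs) *\<^sub>R prod_list (map J xs)" for xs
    by (induction xs) (auto simp: mult.commute)
  thus ?thesis using assms
    by (simp add: ordered_prod_def prod.distinct_set_conv_list[symmetric])
qed

lemma ordered_prod_Un:
  assumes "finite A" "finite B" "\<And>a b. a \<in> A \<Longrightarrow> b \<in> B \<Longrightarrow> a < b"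
  shows "ordered_prod J (A \<union> B) = ordered_prod J A * ordered_prod J B"
proof -
  have "sorted_list_of_set (A \<union> B) = sorted_list_of_set A @ sorted_list_of_set B"
  proof (rule sorted_distinct_set_unique)
    show "sorted (sorted_list_of_set A @ sorted_list_of_set B)"
      using assms by (auto simp: sorted_append less_imp_le)
    show "distinct (sorted_list_of_set A @ sorted_list_of_set B)"
      using assms by fastforce
  qed (use assms in auto)
  thus ?thesis by (simp add: ordered_prod_def)
qed

lemma ordered_prod_insert:
  assumes "finite A" "\<And>a. a \<in> A \<Longrightarrow> b < a"
  shows "ordered_prod J (insert b A) = J b * ordered_prod J A"
  using ordered_prod_Un[of "{b}" A J] assms by (simp add: ordered_prod_def)

lemma ordered_prod_left_inverse:
  assumes "finite K" "\<And>l. l \<in> K \<Longrightarrow> J l \<in> imag_sphere"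
  obtains c where "c * ordered_prod J K = 1"
proof -
  have "\<exists>c. c * prod_list (map J xs) = 1" if "set xs \<subseteq> K" for xs
    using that
  proof (induction xs)
    case (Cons x xs)
    then obtain c where c: "c * prod_list (map J xs) = 1" by auto
    have "(c * (- J x)) * (J x * prod_list (map J xs)) = - (c * (J x * J x) * prod_list (map J xs))"
      by (simp add: mult.assoc)
    also have "\<dots> = 1" using Cons.prems assms(2)[of x] c by (simp add: imag_sphere_square)
    finally show ?case by (intro exI[of _ "c * (- J x)"]) simp
  qed auto
  from this[of "sorted_list_of_set K"] assms(1) that show ?thesis by (auto simp: ordered_prod_def)
qed

text \<open>The character (-1)^|S \<inter> K| of the group of sign changes.\<close>

definition sg :: "'n set \<Rightarrow> 'n set \<Rightarrow> real" where
  "sg S K = (\<Prod>l\<in>K. if l \<in> S then -1 else 1)"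

definition flip :: "'n set \<Rightarrow> ('n \<Rightarrow> 'a::uminus) \<Rightarrow> 'n \<Rightarrow> 'a" where
  "flip S J l = (if l \<in> S then - J l else J l)"

definition cnj_set :: "'n::finite set \<Rightarrow> complex ^ 'n \<Rightarrow> complex ^ 'n" where
  "cnj_set S z = (\<chi> l. if l \<in> S then cnj (z $ l) else z $ l)"

lemma flip_imag_sphere: "(\<And>l. J l \<in> imag_sphere) \<Longrightarrow> flip S J l \<in> imag_sphere"
  by (auto simp: flip_def imag_sphere_uminus)

lemma sg_square: "sg S K * sg S K = 1"
  unfolding sg_def prod.distrib[symmetric] by (intro prod.neutral) auto

lemma ordered_prod_flip:
  fixes J :: "'n::{finite,linorder} \<Rightarrow> 'a::real_algebra_1"
  shows "ordered_prod (flip S J) K = sg S K *\<^sub>R ordered_prod J K"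
proof -
  have "flip S J = (\<lambda>l. (if l \<in> S then -1 else 1) *\<^sub>R J l)" by (auto simp: flip_def)
  thus ?thesis by (simp add: ordered_prod_scaleR sg_def)
qed

lemma sum_Pow_prod: "finite A \<Longrightarrow> (\<Sum>S\<in>Pow A. \<Prod>l\<in>S. c l) = (\<Prod>l\<in>A. 1 + c l :: real)"
proof (induction A rule: finite_induct)
  case (insert x A)
  have "(\<Sum>S\<in>Pow (insert x A). \<Prod>l\<in>S. c l) = (\<Sum>S\<in>Pow A. \<Prod>l\<in>S. c l) + (\<Sum>S\<in>insert x ` Pow A. \<Prod>l\<in>S. c l)"
    unfolding Pow_insert using insert.hyps by (intro sum.union_disjoint) auto
  also have "(\<Sum>S\<in>insert x ` Pow A. \<Prod>l\<in>S. c l) = (\<Sum>S\<in>Pow A. \<Prod>l\<in>insert x S. c l)"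
    using insert.hyps by (subst sum.reindex) (auto simp: inj_on_def o_def insert_eq_iff)
  also have "\<dots> = (\<Sum>S\<in>Pow A. c x * (\<Prod>l\<in>S. c l))"
    using insert.hyps by (intro sum.cong refl prod.insert) (auto intro: finite_subset)
  finally show ?case using insert by (simp add: sum_distrib_left[symmetric] algebra_simps)
qed simp

text \<open>The sum over S factors into the product of the numbers 1 + c l, and the factor at any l
  where K and L differ is 0.\<close>

lemma sg_orthogonal:
  fixes K L :: "'n::finite set"
  shows "(\<Sum>S\<in>UNIV. sg S K * sg S L) = (if K = L then 2 ^ CARD('n) else 0)"
proof -
  define c where "c l = (if (l \<in> K) = (l \<in> L) then 1 else - 1 :: real)" for l
  have "sg S K * sg S L = (\<Prod>l\<in>S. c l)" for S
  proof -
    have "sg S A = (\<Prod>l\<in>S. if l \<in> A then -1 else 1)" for A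
    proof -
      have "sg S A = (\<Prod>l\<in>A \<inter> S. -1)" unfolding sg_def by (intro prod.mono_neutral_cong_right) auto
      also have "\<dots> = (\<Prod>l\<in>S. if l \<in> A then -1 else 1)" by (intro prod.mono_neutral_cong_left) auto
      finally show ?thesis .
    qed
    thus ?thesis by (auto simp: c_def prod.distrib[symmetric] intro!: prod.cong)
  qed
  hence "(\<Sum>S\<in>UNIV. sg S K * sg S L) = (\<Prod>l\<in>UNIV. 1 + c l)"
    using sum_Pow_prod[of UNIV c] by simp
  also have "\<dots> = (if K = L then 2 ^ CARD('n) else 0)"
  proof (cases "K = L")
    case True thus ?thesis by (simp add: c_def)
  next
    case False
    then obtain l where "(l \<in> K) \<noteq> (l \<in> L)" by blast
    thus ?thesis using False by (auto simp: c_def intro!: exI[of _ l])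
  qed
  finally show ?thesis .
qed

subsection \<open>Evaluation of stem functions\<close>

text \<open>The value attached to one presentation (J, z) of a point;
  \<open>slice_ind_slice_pt\<close> identifies it with the induced function.\<close>

definition stem_val ::
  "('n::{finite,linorder} \<Rightarrow> 'm::{finite,linorder} clifford) \<Rightarrow> ('m, 'n) stem \<Rightarrow> complex ^ 'n::{finite,linorder} \<Rightarrow> 'm clifford" where
  "stem_val J F z = (\<Sum>K\<in>UNIV. ordered_prod J K * F K z)"

lemma stem_recover:
  fixes F :: "('m::{finite,linorder}, 'n::{finite,linorder}) stem"
  shows "(\<Sum>S\<in>UNIV. sg S K *\<^sub>R stem_val (flip S J) F z) = 2 ^ CARD('n) *\<^sub>R (ordered_prod J K * F K z)"
proof -
  have "(\<Sum>S\<in>UNIV. sg S K *\<^sub>R stem_val (flip S J) F z) =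
      (\<Sum>S\<in>UNIV. \<Sum>L\<in>UNIV. (sg S K * sg S L) *\<^sub>R (ordered_prod J L * F L z))"
    by (simp add: stem_val_def ordered_prod_flip scaleR_sum_right)
  also have "\<dots> = (\<Sum>L\<in>UNIV. \<Sum>S\<in>UNIV. (sg S K * sg S L) *\<^sub>R (ordered_prod J L * F L z))"
    by (rule sum.swap)
  also have "\<dots> = (\<Sum>L\<in>UNIV. (if K = L then 2 ^ CARD('n) else 0) *\<^sub>R (ordered_prod J L * F L z))"
    unfolding scaleR_sum_left[symmetric] sg_orthogonal ..
  also have "\<dots> = 2 ^ CARD('n) *\<^sub>R (ordered_prod J K * F K z)"
    by (simp add: if_distrib if_distribR cong: if_cong)
  finally show ?thesis .
qed

text \<open>The coefficient c depends on J and K but not on F or z. Linear properties of slice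
  functions, such as continuity or the Cauchy-Riemann equations, therefore pass to the stem
  components.\<close>

lemma stem_component:
  fixes J :: "'n::{finite,linorder} \<Rightarrow> 'm::{finite,linorder} clifford"
  assumes "\<And>l. J l \<in> imag_sphere"
  obtains c where "\<And>F z. F K z = c * (\<Sum>S\<in>UNIV. sg S K *\<^sub>R stem_val (flip S J) F z)"
proof -
  obtain c where c: "c * ordered_prod J K = 1"
    using ordered_prod_left_inverse[of K J] assms by auto
  show ?thesis
  proof (rule that[of "inverse (2 ^ CARD('n)) *\<^sub>R c"])
    show "F K z = (inverse (2 ^ CARD('n)) *\<^sub>R c) * (\<Sum>S\<in>UNIV. sg S K *\<^sub>R stem_val (flip S J) F z)" for F z
      unfolding stem_recover using c by (simp add: mult.assoc[symmetric])
  qed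
qed

lemma cnj_set_empty [simp]: "cnj_set {} z = z"
  by (simp add: cnj_set_def)

lemma cnj_set_insert: "h \<notin> S \<Longrightarrow> cnj_set (insert h S) z = cnj_at h (cnj_set S z)"
  by (auto simp: cnj_set_def cnj_at_def vec_eq_iff)

lemma cnj_set_stem:
  assumes sym: "symmetric D" and F: "is_stem D F" and z: "z \<in> D"
  shows "cnj_set S z \<in> D \<and> F K (cnj_set S z) = sg S K *\<^sub>R F K z"
  using finite[of S]
proof (induction S rule: finite_induct)
  case empty
  thus ?case using z by (simp add: sg_def)
next
  case (insert h S)
  have "sg (insert h S) K = (if h \<in> K then - sg S K else sg S K)"
  proof -
    have "sg (insert h S) K = (\<Prod>l\<in>K. (if l \<in> S then -1 else 1) * (if l = h then -1 else 1))"
      unfolding sg_def using insert.hyps by (intro prod.cong) auto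
    also have "\<dots> = sg S K * (\<Prod>l\<in>K. if l = h then -1 else 1)" by (simp add: prod.distrib sg_def)
    finally show ?thesis by (simp add: prod.delta)
  qed
  thus ?case using insert sym F by (simp add: cnj_set_insert symmetric_def is_stem_def)
qed

lemma is_stem_zero:
  assumes "is_stem D F" "z \<in> D" "h \<in> K" "Im (z $ h) = 0"
  shows "F K z = 0"
proof -
  have "cnj_at h z = z" using assms(4) by (auto simp: cnj_at_def vec_eq_iff complex_eq_iff)
  hence "F K z = - F K z" using assms unfolding is_stem_def by metis
  hence "2 *\<^sub>R F K z = 0" by (simp add: scaleR_2 eq_neg_iff_add_eq_0)
  thus ?thesis by simp
qed

text \<open>Two presentations differ by conjugation on a set S with the matching sign changes in J,
  and by arbitrary units at real coordinates. The two signs cancel, and a component whose index set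
  contains a real coordinate vanishes.\<close>

lemma stem_val_unique:
  assumes sym: "symmetric D" and F: "is_stem D F" and z: "z \<in> D"
    and J: "\<And>l. J l \<in> imag_sphere" "\<And>l. J' l \<in> imag_sphere" and eq: "slice_pt J z = slice_pt J' z'"
  shows "stem_val J' F z' = stem_val J F z"
proof -
  define S where "S = {l. z' $ l = cnj (z $ l) \<and> Im (z $ l) \<noteq> 0}"
  have *: "(z' $ l = z $ l \<and> (Im (z $ l) = 0 \<or> J' l = J l)) \<or> (z' $ l = cnj (z $ l) \<and> Im (z $ l) \<noteq> 0 \<and> J' l = - J l)" for l
    using eq by (intro slice_pt1_eq_cases J) (simp add: slice_pt_def vec_eq_iff)
  have z': "z' = cnj_set S z" using * by (auto simp: cnj_set_def vec_eq_iff S_def)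
  have "ordered_prod J' K * F K z' = ordered_prod J K * F K z" for K
  proof (cases "\<exists>l\<in>K. Im (z $ l) = 0")
    case True
    thus ?thesis using is_stem_zero[OF F z] cnj_set_stem[OF sym F z] z' by force
  next
    case False
    have "ordered_prod J' K = ordered_prod (flip S J) K"
    proof (rule ordered_prod_cong)
      fix l assume "l \<in> K"
      thus "J' l = flip S J l" using False *[of l] by (auto simp: flip_def S_def complex_eq_iff)
    qed simp
    thus ?thesis using cnj_set_stem[OF sym F z] by (simp add: z' ordered_prod_flip sg_square)
  qed
  thus ?thesis by (simp add: stem_val_def)
qed

lemma slice_ind_slice_pt:
  assumes "symmetric D" "is_stem D F" "z \<in> D" "\<And>l. J l \<in> imag_sphere"
  shows "slice_ind D F (slice_pt J z) = stem_val J F z"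
  unfolding slice_ind_def stem_val_def[symmetric]
proof (rule the_equality)
  show "\<exists>J' z'. z' \<in> D \<and> (\<forall>l. J' l \<in> imag_sphere) \<and> slice_pt J z = slice_pt J' z' \<and> stem_val J F z = stem_val J' F z'"
    using assms by blast
  fix v assume "\<exists>J' z'. z' \<in> D \<and> (\<forall>l. J' l \<in> imag_sphere) \<and> slice_pt J z = slice_pt J' z' \<and> v = stem_val J' F z'"
  then obtain J' z' where *: "\<And>l. J' l \<in> imag_sphere" "slice_pt J z = slice_pt J' z'" "v = stem_val J' F z'" by blast
  show "v = stem_val J F z" using stem_val_unique[OF assms(1-4) *(1,2)] *(3) by simp
qed

lemma Omega_cases:
  assumes "x \<in> Omega D"
  obtains J z where "x = slice_pt J z" "z \<in> D" "\<And>l. J l \<in> imag_sphere"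
  using assms unfolding Omega_def by blast

lemma slice_pt_in_Omega: "z \<in> D \<Longrightarrow> (\<And>l. J l \<in> imag_sphere) \<Longrightarrow> slice_pt J z \<in> Omega D"
  unfolding Omega_def by blast

lemma slice_ind_cong:
  assumes "\<And>K z. z \<in> D \<Longrightarrow> F K z = G K z"
  shows "slice_ind D F = slice_ind D G"
proof -
  have "(\<Sum>K\<in>UNIV. ordered_prod J K * F K z) = (\<Sum>K\<in>UNIV. ordered_prod J K * G K z)" if "z \<in> D" for J z
    using assms that by simp
  hence "(\<lambda>v. \<exists>J z. z \<in> D \<and> (\<forall>l. J l \<in> imag_sphere) \<and> x = slice_pt J z \<and> v = (\<Sum>K\<in>UNIV. ordered_prod J K * F K z)) =
      (\<lambda>v. \<exists>J z. z \<in> D \<and> (\<forall>l. J l \<in> imag_sphere) \<and> x = slice_pt J z \<and> v = (\<Sum>K\<in>UNIV. ordered_prod J K * G K z))" for x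
    by (intro ext ex_cong1 conj_cong refl) simp
  thus ?thesis unfolding slice_ind_def by simp
qed

lemma induced_by_val:
  assumes "induced_by D f F" "symmetric D" "z \<in> D" "\<And>l. J l \<in> imag_sphere"
  shows "f (slice_pt J z) = stem_val J F z"
proof -
  have "f (slice_pt J z) = slice_ind D F (slice_pt J z)"
    using assms(1) slice_pt_in_Omega[of z D J, OF assms(3,4)] unfolding induced_by_def by blast
  also have "\<dots> = stem_val J F z"
    using assms(1) by (intro slice_ind_slice_pt assms) (simp add: induced_by_def)
  finally show ?thesis .
qed

lemma induced_byI:
  fixes f :: "('m::{finite,linorder}, 'n::{finite,linorder}) slice_fun"
  assumes "symmetric D" "is_stem D F"
    "\<And>J z. z \<in> D \<Longrightarrow> (\<And>l. J l \<in> imag_sphere) \<Longrightarrow> f (slice_pt J z) = stem_val J F z"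
  shows "induced_by D f F"
  unfolding induced_by_def
proof (intro conjI ballI assms(2))
  fix x :: "'m clifford ^ 'n::{finite,linorder}"
  assume "x \<in> Omega D"
  then obtain J z where "x = slice_pt J z" "z \<in> D" "\<And>l. J l \<in> imag_sphere" using Omega_cases by blast
  thus "f x = slice_ind D F x" using assms by (simp add: slice_ind_slice_pt)
qed

lemma induced_by_unique:
  fixes f :: "('m::{finite,linorder}, 'n::{finite,linorder}) slice_fun"
  assumes "induced_by D f F" "induced_by D f G" "symmetric D" "z \<in> D"
  shows "F K z = G K z"
proof -
  define J :: "'n \<Rightarrow> 'm clifford" where "J = (\<lambda>_. cl_gen undefined)"
  have J: "J l \<in> imag_sphere" for l by (simp add: J_def cl_gen_imag_sphere)
  obtain c where c: "\<And>F z. F K z = c * (\<Sum>S\<in>UNIV. sg S K *\<^sub>R stem_val (flip S J) F z)"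
    using stem_component[of J K] J by blast
  have "stem_val (flip S J) F z = stem_val (flip S J) G z" for S
    using induced_by_val[OF assms(1,3,4)] induced_by_val[OF assms(2,3,4)] flip_imag_sphere[of J S] J by metis
  thus ?thesis using c[of F z] c[of G z] by simp
qed

lemma induced_by_stem_of: "f \<in> slice_fns D \<Longrightarrow> induced_by D f (stem_of D f)"
  unfolding slice_fns_def stem_of_def mem_Collect_eq
proof (erule exE)
  fix F assume F: "induced_by D f F"
  show "induced_by D f (SOME F. induced_by D f F)" by (rule someI[of "induced_by D f", OF F])
qed

lemma stem_of_eq:
  assumes "induced_by D f F" "symmetric D" "z \<in> D"
  shows "stem_of D f K z = F K z"
proof -
  have "f \<in> slice_fns D" using assms(1) by (auto simp: slice_fns_def)
  thus ?thesis using induced_by_unique[OF induced_by_stem_of assms(1-3)] by blast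
qed

lemma induced_by_subset:
  assumes "induced_by D f F" "symmetric D" "symmetric E" "E \<subseteq> D"
  shows "induced_by E f F"
proof (rule induced_byI[OF assms(3)])
  show "is_stem E F" using assms unfolding induced_by_def is_stem_def by blast
  show "f (slice_pt J z) = stem_val J F z" if "z \<in> E" "\<And>l. J l \<in> imag_sphere" for J z
    by (rule induced_by_val[OF assms(1,2)]) (use that assms(4) in auto)
qed

lemma induced_by_slice_ind: "is_stem D F \<Longrightarrow> induced_by D (slice_ind D F) F"
  by (simp add: induced_by_def)

subsection \<open>Products with coordinates\<close>

lemma stem_prod_alt:
  "stem_prod F G L z = (\<Sum>H\<in>UNIV. (- 1) ^ card (H \<inter> sym_diff H L) * F H z * G (sym_diff H L) z)"
proof -
  have *: "sym_diff H (sym_diff H L) = L" for H L :: "'n set" by auto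
  show ?thesis
    unfolding stem_prod_def
    by (rule sum.reindex_bij_witness[of _ "\<lambda>H. (H, sym_diff H L)" fst]) (auto simp: *)
qed

text \<open>The stem product with the coordinate \<open>x_k\<close>, as shown by
  \<open>stem_prod_coord\<close>. The minus sign arises because the basis element of {k} has square
  -1.\<close>

definition xmul :: "'n::finite \<Rightarrow> ('m::{finite,linorder}, 'n) stem \<Rightarrow> ('m, 'n) stem" where
  "xmul k F L z = Re (z $ k) *\<^sub>R F L z +
     (if k \<in> L then Im (z $ k) *\<^sub>R F (L - {k}) z else - Im (z $ k) *\<^sub>R F (insert k L) z)"

lemma stem_prod_coord:
  fixes F :: "('m::{finite,linorder}, 'n::{finite,linorder}) stem"
  shows "stem_prod (\<lambda>K z. if K = {} then of_real (Re (z $ j)) else if K = {j} then of_real (Im (z $ j)) else 0) F L z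
    = xmul j F L z"
proof -
  let ?C = "\<lambda>K (z :: complex ^ 'n::{finite,linorder}). if K = {} then of_real (Re (z $ j))
    else if K = {j} then of_real (Im (z $ j)) else (0 :: 'm clifford)"
  have "stem_prod ?C F L z =
      (\<Sum>H\<in>{{}, {j}}. (- 1) ^ card (H \<inter> sym_diff H L) * ?C H z * F (sym_diff H L) z)"
    unfolding stem_prod_alt by (rule sum.mono_neutral_right) auto
  also have "\<dots> = xmul j F L z"
    by (auto simp: xmul_def of_real_def insert_Diff_if Un_commute)
  finally show ?thesis .
qed

lemma cnj_at_nth: "cnj_at h z $ l = (if l = h then cnj (z $ l) else z $ l)"
  by (simp add: cnj_at_def)

lemma is_stem_xmul: "is_stem D F \<Longrightarrow> is_stem D (xmul k F)"
  unfolding is_stem_def xmul_def by (auto simp: cnj_at_nth)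

lemma stem_prod_cong:
  "(\<And>K. F K z = F' K z) \<Longrightarrow> (\<And>K. G K z = G' K z) \<Longrightarrow> stem_prod F G L z = stem_prod F' G' L z"
  by (simp add: stem_prod_def)

lemma slice_prod_eq:
  assumes "symmetric D" "induced_by D f F" "induced_by D g G"
  shows "slice_prod D f g = slice_ind D (stem_prod F G)"
  unfolding slice_prod_def using assms stem_of_eq by (intro slice_ind_cong stem_prod_cong) auto

lemma induced_by_coord_mult:
  fixes f :: "('m::{finite,linorder}, 'n::{finite,linorder}) slice_fun"
  assumes "symmetric D" "induced_by D f F"
  shows "induced_by D (slice_prod D (coord D k) f) (xmul k F)"
proof -
  let ?C = "(\<lambda>K z. if K = {} then of_real (Re (z $ k)) else if K = {k} then of_real (Im (z $ k)) else 0)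
    :: ('m, 'n) stem"
  have "is_stem D ?C" by (auto simp: is_stem_def cnj_at_nth)
  hence "induced_by D (coord D k) ?C" unfolding coord_def by (rule induced_by_slice_ind)
  hence "slice_prod D (coord D k) f = slice_ind D (stem_prod ?C F)"
    by (intro slice_prod_eq assms)
  also have "stem_prod ?C F = xmul k F" by (intro ext stem_prod_coord)
  finally show ?thesis using assms
    by (simp add: induced_by_slice_ind is_stem_xmul induced_by_def)
qed

lemma induced_by_foldr:
  assumes "symmetric D" "induced_by D f F"
  shows "induced_by D (foldr (\<lambda>k g. slice_prod D (coord D k) g) ks f) (foldr xmul ks F)"
  by (induction ks) (simp_all add: assms induced_by_coord_mult)

text \<open>The indices are distinct and belong to A, so only the branch \<open>k \<in> L\<close> of
  \<open>xmul\<close> is met: each factor either keeps its index with weight Re or removes it with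
  weight Im. M collects the removed indices.\<close>

lemma foldr_xmul:
  assumes "distinct ks" "set ks \<subseteq> A"
  shows "foldr xmul ks F A z = (\<Sum>M\<in>Pow (set ks).
    ((\<Prod>l\<in>set ks - M. Re (z $ l)) * (\<Prod>l\<in>M. Im (z $ l))) *\<^sub>R F (A - M) z)"
  using assms
proof (induction ks arbitrary: A)
  case (Cons k ks)
  define c where "c K M = (\<Prod>l\<in>K - M. Re (z $ l)) * (\<Prod>l\<in>M. Im (z $ l))" for K M
  have k: "k \<notin> set ks" "k \<in> A" using Cons.prems by auto
  have fin: "finite M" if "M \<in> Pow (set ks)" for M using that finite_subset by auto
  have c1: "c (insert k (set ks)) M = Re (z $ k) * c (set ks) M" if "M \<in> Pow (set ks)" for M
  proof -
    have "insert k (set ks) - M = insert k (set ks - M)" using k that by auto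
    thus ?thesis using k by (simp add: c_def)
  qed
  have c2: "c (insert k (set ks)) (insert k M) = Im (z $ k) * c (set ks) M" if "M \<in> Pow (set ks)" for M
  proof -
    have "insert k (set ks) - insert k M = set ks - M" "k \<notin> M" using k that by auto
    thus ?thesis using fin[OF that] by (simp add: c_def)
  qed
  have "(\<Sum>M\<in>Pow (insert k (set ks)). c (insert k (set ks)) M *\<^sub>R F (A - M) z) =
      (\<Sum>M\<in>Pow (set ks). c (insert k (set ks)) M *\<^sub>R F (A - M) z) +
      (\<Sum>M\<in>insert k ` Pow (set ks). c (insert k (set ks)) M *\<^sub>R F (A - M) z)"
    unfolding Pow_insert using k by (intro sum.union_disjoint) auto
  also have "(\<Sum>M\<in>insert k ` Pow (set ks). c (insert k (set ks)) M *\<^sub>R F (A - M) z) =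
      (\<Sum>M\<in>Pow (set ks). c (insert k (set ks)) (insert k M) *\<^sub>R F (A - insert k M) z)"
    using k by (subst sum.reindex) (auto simp: inj_on_def o_def insert_eq_iff)
  also have "(\<Sum>M\<in>Pow (set ks). c (insert k (set ks)) M *\<^sub>R F (A - M) z) =
      Re (z $ k) *\<^sub>R foldr xmul ks F A z"
    using Cons by (simp add: c1 scaleR_sum_right flip: c_def)
  also have "(\<Sum>M\<in>Pow (set ks). c (insert k (set ks)) (insert k M) *\<^sub>R F (A - insert k M) z) =
      Im (z $ k) *\<^sub>R foldr xmul ks F (A - {k}) z"
  proof -
    have "foldr xmul ks F (A - {k}) z = (\<Sum>M\<in>Pow (set ks). c (set ks) M *\<^sub>R F (A - {k} - M) z)"
      unfolding c_def using Cons.prems k by (intro Cons.IH) auto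
    moreover have "c (insert k (set ks)) (insert k M) *\<^sub>R F (A - insert k M) z =
        Im (z $ k) *\<^sub>R (c (set ks) M *\<^sub>R F (A - {k} - M) z)" if M: "M \<in> Pow (set ks)" for M
    proof -
      have "A - insert k M = A - {k} - M" by auto
      thus ?thesis by (simp only: c2[OF M] scaleR_scaleR)
    qed
    ultimately show ?thesis by (simp only: scaleR_sum_right cong: sum.cong)
  qed
  finally show ?case using k by (simp add: xmul_def[of k "foldr xmul ks F"] c_def)
qed simp

subsection \<open>The spherical components\<close>

lemma nonreal_subset: "nonreal D H \<subseteq> D"
  by (auto simp: nonreal_def)

lemma symmetric_nonreal: "symmetric D \<Longrightarrow> symmetric (nonreal D H)"
  by (auto simp: symmetric_def nonreal_def cnj_at_nth)

lemma open_nonreal: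
  assumes "open D" shows "open (nonreal D H)"
proof -
  have "nonreal D H = D \<inter> (\<Inter>h\<in>H. {z. Im (z $ h) \<noteq> 0})" by (auto simp: nonreal_def)
  thus ?thesis using assms
    by (auto intro!: open_Int open_INT open_Collect_neq continuous_intros)
qed

lemma prod_Im_cnj_at:
  fixes H :: "'n::finite set"
  shows "(\<Prod>l\<in>H. Im (cnj_at h z $ l)) = (if h \<in> H then -1 else 1) * (\<Prod>l\<in>H. Im (z $ l))"
proof -
  have "(\<Prod>l\<in>H. Im (cnj_at h z $ l)) = (\<Prod>l\<in>H. (if l = h then -1 else 1) * Im (z $ l))"
    by (intro prod.cong) (auto simp: cnj_at_nth)
  thus ?thesis by (simp add: prod.distrib prod.delta)
qed

lemma is_stem_spherical: "is_stem D F \<Longrightarrow> is_stem (nonreal D H) (spherical_stem H F)"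
  unfolding is_stem_def spherical_stem_def prod_Im_cnj_at
  using nonreal_subset[of D H] by auto

definition S_stem ::
  "'n::{finite,linorder} set \<Rightarrow> 'n set \<Rightarrow> ('m::{finite,linorder}, 'n) stem \<Rightarrow> ('m, 'n) stem" where
  "S_stem H K F = spherical_stem H (foldr xmul (sorted_list_of_set K) F)"

lemma is_stem_foldr_xmul: "is_stem D F \<Longrightarrow> is_stem D (foldr xmul ks F)"
  by (induction ks) (simp_all add: is_stem_xmul)

lemma S_comp_induced_by:
  assumes "symmetric D" "induced_by D f F"
  shows "induced_by (nonreal D H) (S_comp D H K f) (S_stem H K F)"
proof -
  have "S_comp D H K f = slice_ind (nonreal D H) (S_stem H K F)"
    unfolding S_comp_def spherical_deriv_def S_stem_def
    by (rule slice_ind_cong)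
      (use stem_of_eq[OF induced_by_foldr[OF assms] assms(1)] nonreal_subset[of D H] in
        \<open>auto simp: spherical_stem_def\<close>)
  moreover have "is_stem (nonreal D H) (S_stem H K F)"
    unfolding S_stem_def using assms(2) by (intro is_stem_spherical is_stem_foldr_xmul) (simp add: induced_by_def)
  ultimately show ?thesis by (simp add: induced_by_slice_ind)
qed

lemma S_stem_support: "\<not> L \<subseteq> - H \<Longrightarrow> S_stem H K F L z = 0"
  by (simp add: S_stem_def spherical_stem_def)

lemma S_stem_alt:
  assumes "L \<subseteq> - H"
  shows "S_stem H K F L z = inverse (\<Prod>h\<in>H. Im (z $ h)) *\<^sub>R foldr xmul (sorted_list_of_set K) F (L \<union> H) z"
  using assms by (simp add: S_stem_def spherical_stem_def)

lemma S_stem_explicit: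
  assumes "K \<subseteq> H" "L \<subseteq> - H"
  shows "S_stem H K F L z = inverse (\<Prod>h\<in>H. Im (z $ h)) *\<^sub>R (\<Sum>M\<in>Pow K.
    ((\<Prod>l\<in>K - M. Re (z $ l)) * (\<Prod>l\<in>M. Im (z $ l))) *\<^sub>R F (L \<union> (H - M)) z)"
proof -
  have "foldr xmul (sorted_list_of_set K) F (L \<union> H) z =
      (\<Sum>M\<in>Pow K. ((\<Prod>l\<in>K - M. Re (z $ l)) * (\<Prod>l\<in>M. Im (z $ l))) *\<^sub>R F (L \<union> H - M) z)"
    using foldr_xmul[of "sorted_list_of_set K" "L \<union> H" F z] assms(1) by auto
  also have "\<dots> = (\<Sum>M\<in>Pow K. ((\<Prod>l\<in>K - M. Re (z $ l)) * (\<Prod>l\<in>M. Im (z $ l))) *\<^sub>R F (L \<union> (H - M)) z)"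
  proof (intro sum.cong refl)
    fix M assume "M \<in> Pow K"
    hence "L \<union> H - M = L \<union> (H - M)" using assms by auto
    thus "((\<Prod>l\<in>K - M. Re (z $ l)) * (\<Prod>l\<in>M. Im (z $ l))) *\<^sub>R F (L \<union> H - M) z =
      ((\<Prod>l\<in>K - M. Re (z $ l)) * (\<Prod>l\<in>M. Im (z $ l))) *\<^sub>R F (L \<union> (H - M)) z" by simp
  qed
  finally show ?thesis unfolding S_stem_alt[OF assms(2)] by simp
qed

text \<open>Each index l contributes in three ways: - a l if it is outside K, a l if it is in K but
  not in M, and b l if it is in M. The first two cancel, so only M = S survives. The induction on S
  carries out this cancellation one index at a time.\<close>

lemma alternating_double_sum:
  fixes a b :: "'i \<Rightarrow> real" and \<phi> :: "'i set \<Rightarrow> 'v::real_vector"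
  assumes "finite S"
  shows "(\<Sum>K\<in>Pow S. (\<Prod>l\<in>S - K. - a l) *\<^sub>R (\<Sum>M\<in>Pow K. ((\<Prod>l\<in>K - M. a l) * (\<Prod>l\<in>M. b l)) *\<^sub>R \<phi> M))
    = (\<Prod>l\<in>S. b l) *\<^sub>R \<phi> S"
  using assms
proof (induction S arbitrary: \<phi> rule: finite_induct)
  case (insert s S)
  define I where "I K \<phi> = (\<Sum>M\<in>Pow K. ((\<Prod>l\<in>K - M. a l) * (\<Prod>l\<in>M. b l)) *\<^sub>R \<phi> M)"
    for K and \<phi> :: "'i set \<Rightarrow> 'v"
  define T where "T S \<phi> = (\<Sum>K\<in>Pow S. (\<Prod>l\<in>S - K. - a l) *\<^sub>R I K \<phi>)" for S \<phi>
  have fin: "finite M" if "M \<in> Pow S" for M using that insert.hyps finite_subset by auto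
  have split: "(\<Sum>K\<in>Pow (insert s S'). h K) = (\<Sum>K\<in>Pow S'. h K) + (\<Sum>K\<in>Pow S'. h (insert s K))"
    if "S' \<subseteq> S" for S' and h :: "'i set \<Rightarrow> 'v"
  proof -
    have "finite S'" "s \<notin> S'" using that insert.hyps finite_subset by auto
    hence "(\<Sum>K\<in>Pow (insert s S'). h K) = (\<Sum>K\<in>Pow S'. h K) + (\<Sum>K\<in>insert s ` Pow S'. h K)"
      unfolding Pow_insert by (intro sum.union_disjoint) auto
    also have "(\<Sum>K\<in>insert s ` Pow S'. h K) = (\<Sum>K\<in>Pow S'. h (insert s K))"
      using \<open>s \<notin> S'\<close> by (subst sum.reindex) (auto simp: inj_on_def o_def insert_eq_iff)
    finally show ?thesis .
  qed
  have I: "I (insert s K) \<phi> = a s *\<^sub>R I K \<phi> + b s *\<^sub>R I K (\<lambda>M. \<phi> (insert s M))" if K: "K \<in> Pow S" for K \<phi>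
  proof -
    have 1: "(\<Prod>l\<in>insert s K - M. a l) = a s * (\<Prod>l\<in>K - M. a l)" if "M \<in> Pow K" for M
    proof -
      have "insert s K - M = insert s (K - M)" using insert.hyps that K by auto
      thus ?thesis using insert.hyps fin[OF K] K by (simp add: subset_iff) (metis PowD finite_Diff prod.insert DiffD1 subsetD K)
    qed
    have 2: "insert s K - insert s M = K - M" "s \<notin> M" "finite M" if "M \<in> Pow K" for M
      using insert.hyps that K fin[of M] by auto
    show ?thesis
      unfolding I_def using K by (subst split) (auto simp: 1 2 scaleR_sum_right mult_ac intro!: arg_cong2[where f = "(+)"] sum.cong)
  qed
  have "T (insert s S) \<phi> = (\<Sum>K\<in>Pow S. (\<Prod>l\<in>insert s S - K. - a l) *\<^sub>R I K \<phi>)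
      + (\<Sum>K\<in>Pow S. (\<Prod>l\<in>insert s S - insert s K. - a l) *\<^sub>R I (insert s K) \<phi>)"
    unfolding T_def by (rule split) simp
  also have "(\<Sum>K\<in>Pow S. (\<Prod>l\<in>insert s S - K. - a l) *\<^sub>R I K \<phi>) = - a s *\<^sub>R T S \<phi>"
    unfolding T_def scaleR_sum_right
  proof (intro sum.cong refl)
    fix K assume "K \<in> Pow S"
    hence "insert s S - K = insert s (S - K)" using insert.hyps by auto
    thus "(\<Prod>l\<in>insert s S - K. - a l) *\<^sub>R I K \<phi> = - a s *\<^sub>R (\<Prod>l\<in>S - K. - a l) *\<^sub>R I K \<phi>"
      using insert.hyps by simp
  qed
  also have "(\<Sum>K\<in>Pow S. (\<Prod>l\<in>insert s S - insert s K. - a l) *\<^sub>R I (insert s K) \<phi>) =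
      (\<Sum>K\<in>Pow S. a s *\<^sub>R ((\<Prod>l\<in>S - K. - a l) *\<^sub>R I K \<phi>)
        + b s *\<^sub>R ((\<Prod>l\<in>S - K. - a l) *\<^sub>R I K (\<lambda>M. \<phi> (insert s M))))"
  proof (intro sum.cong refl)
    fix K assume K: "K \<in> Pow S"
    hence "insert s S - insert s K = S - K" using insert.hyps by auto
    thus "(\<Prod>l\<in>insert s S - insert s K. - a l) *\<^sub>R I (insert s K) \<phi> =
      a s *\<^sub>R ((\<Prod>l\<in>S - K. - a l) *\<^sub>R I K \<phi>)
        + b s *\<^sub>R ((\<Prod>l\<in>S - K. - a l) *\<^sub>R I K (\<lambda>M. \<phi> (insert s M)))"
      by (simp add: I[OF K] scaleR_add_right mult.commute)
  qed
  also have "\<dots> = a s *\<^sub>R T S \<phi> + b s *\<^sub>R T S (\<lambda>M. \<phi> (insert s M))"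
    by (simp add: sum.distrib T_def scaleR_sum_right)
  finally have "T (insert s S) \<phi> = b s *\<^sub>R T S (\<lambda>M. \<phi> (insert s M))" by simp
  also have "T S (\<lambda>M. \<phi> (insert s M)) = (\<Prod>l\<in>S. b l) *\<^sub>R \<phi> (insert s S)"
    unfolding T_def I_def by (rule insert.IH)
  finally show ?case unfolding T_def I_def using insert.hyps by simp
qed simp

text \<open>The real factor is the component A of the product of conjugates over H - K. Its sign and
  (-1)^card (H - K) together turn each Re into - Re and each - Im into Im, so
  \<open>alternating_double_sum\<close> applies on H - A. The products of Im over A and over H - A
  then cancel the denominator.\<close>

lemma S_stem_decomposition:
  assumes z: "z \<in> nonreal D H" and "A \<subseteq> H" "L \<subseteq> - H"
  shows "(\<Sum>K\<in>Pow (H - A). (- 1) ^ card (H - K) *\<^sub>R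
      ((\<Prod>l\<in>H - K - A. Re (z $ l)) * (\<Prod>l\<in>A. - Im (z $ l))) *\<^sub>R S_stem H K F L z) = F (A \<union> L) z"
proof -
  let ?b = "\<Prod>h\<in>H. Im (z $ h)"
  define I where "I K = (\<Sum>M\<in>Pow K. ((\<Prod>l\<in>K - M. Re (z $ l)) * (\<Prod>l\<in>M. Im (z $ l))) *\<^sub>R F (L \<union> (H - M)) z)" for K
  have b: "?b \<noteq> 0" using z by (simp add: nonreal_def)
  have "(\<Sum>K\<in>Pow (H - A). (- 1) ^ card (H - K) *\<^sub>R
      ((\<Prod>l\<in>H - K - A. Re (z $ l)) * (\<Prod>l\<in>A. - Im (z $ l))) *\<^sub>R S_stem H K F L z) =
    (\<Sum>K\<in>Pow (H - A). ((\<Prod>l\<in>A. Im (z $ l)) * inverse ?b) *\<^sub>R ((\<Prod>l\<in>H - A - K. - Re (z $ l)) *\<^sub>R I K))"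
  proof (intro sum.cong refl)
    fix K assume K: "K \<in> Pow (H - A)"
    have "S_stem H K F L z = inverse ?b *\<^sub>R I K"
      unfolding I_def using K assms by (intro S_stem_explicit) auto
    moreover have "(\<Prod>l\<in>A. - Im (z $ l)) = (-1) ^ card A * (\<Prod>l\<in>A. Im (z $ l))"
      by (simp add: prod_uminus)
    moreover have "(\<Prod>l\<in>H - A - K. - Re (z $ l)) = (-1) ^ card (H - A - K) * (\<Prod>l\<in>H - A - K. Re (z $ l))"
      by (simp add: prod_uminus)
    moreover have "H - K - A = H - A - K" by auto
    moreover have "card (H - K) = card (H - A - K) + card A"
    proof -
      have "H - K = (H - A - K) \<union> A" using K assms by auto
      moreover have "(H - A - K) \<inter> A = {}" by auto
      ultimately show ?thesis by (metis card_Un_disjoint finite)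
    qed
    moreover have "(-1::real) ^ card A * (-1) ^ card A = 1" by (simp flip: power_add)
    ultimately show "(- 1) ^ card (H - K) *\<^sub>R
      ((\<Prod>l\<in>H - K - A. Re (z $ l)) * (\<Prod>l\<in>A. - Im (z $ l))) *\<^sub>R S_stem H K F L z
      = ((\<Prod>l\<in>A. Im (z $ l)) * inverse ?b) *\<^sub>R ((\<Prod>l\<in>H - A - K. - Re (z $ l)) *\<^sub>R I K)"
      by (simp add: power_add mult_ac)
  qed
  also have "\<dots> = ((\<Prod>l\<in>A. Im (z $ l)) * inverse ?b) *\<^sub>R (\<Sum>K\<in>Pow (H - A). (\<Prod>l\<in>H - A - K. - Re (z $ l)) *\<^sub>R I K)"
    by (simp add: scaleR_sum_right)
  also have "(\<Sum>K\<in>Pow (H - A). (\<Prod>l\<in>H - A - K. - Re (z $ l)) *\<^sub>R I K) =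
      (\<Prod>l\<in>H - A. Im (z $ l)) *\<^sub>R F (L \<union> (H - (H - A))) z"
    unfolding I_def by (rule alternating_double_sum) simp
  also have "H - (H - A) = A" using assms by auto
  also have "((\<Prod>l\<in>A. Im (z $ l)) * inverse ?b) *\<^sub>R (\<Prod>l\<in>H - A. Im (z $ l)) *\<^sub>R F (L \<union> A) z = F (A \<union> L) z"
  proof -
    have "?b = (\<Prod>l\<in>A. Im (z $ l)) * (\<Prod>l\<in>H - A. Im (z $ l))"
      using assms by (metis finite prod.subset_diff mult.commute)
    hence "(\<Prod>l\<in>A. Im (z $ l)) * inverse ?b * (\<Prod>l\<in>H - A. Im (z $ l)) = 1"
      using b by (simp add: field_simps)
    thus ?thesis by (simp add: Un_commute)
  qed
  finally show ?thesis .
qed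

section \<open>Conjugate coordinates and the decomposition formula\<close>

lemma ordered_prod_expand:
  fixes J :: "'n::linorder \<Rightarrow> 'a::real_algebra_1"
  assumes "finite T"
  shows "ordered_prod (\<lambda>t. of_real (a t) + b t *\<^sub>R J t) T =
    (\<Sum>A\<in>Pow T. ((\<Prod>l\<in>T - A. a l) * (\<Prod>l\<in>A. b l)) *\<^sub>R ordered_prod J A)"
  using assms
proof (induction T rule: finite_linorder_min_induct)
  case (insert t T)
  define c where "c T A = (\<Prod>l\<in>T - A. a l) * (\<Prod>l\<in>A. b l)" for T A
  have t: "t \<notin> T" using insert.hyps by blast
  have fin: "finite A" if "A \<in> Pow T" for A using that insert.hyps(1) finite_subset by auto
  have c1: "c (insert t T) A = a t * c T A" if "A \<in> Pow T" for A
  proof -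
    have "insert t T - A = insert t (T - A)" using t that by auto
    thus ?thesis using t insert.hyps(1) by (simp add: c_def)
  qed
  have c2: "c (insert t T) (insert t A) *\<^sub>R ordered_prod J (insert t A) = b t *\<^sub>R (J t * (c T A *\<^sub>R ordered_prod J A))"
    if "A \<in> Pow T" for A
  proof -
    have 1: "insert t T - insert t A = T - A" "t \<notin> A" using t that by auto
    have "c (insert t T) (insert t A) = b t * c T A"
      unfolding c_def 1(1) using 1(2) fin[OF that] by simp
    moreover have "ordered_prod J (insert t A) = J t * ordered_prod J A"
      by (rule ordered_prod_insert[OF fin[OF that]]) (use that insert.hyps in auto)
    ultimately show ?thesis by simp
  qed
  have "(\<Sum>A\<in>Pow (insert t T). c (insert t T) A *\<^sub>R ordered_prod J A) =
      (\<Sum>A\<in>Pow T. c (insert t T) A *\<^sub>R ordered_prod J A) + (\<Sum>A\<in>insert t ` Pow T. c (insert t T) A *\<^sub>R ordered_prod J A)"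
    unfolding Pow_insert using t insert.hyps(1) by (intro sum.union_disjoint) auto
  also have "(\<Sum>A\<in>insert t ` Pow T. c (insert t T) A *\<^sub>R ordered_prod J A) =
      (\<Sum>A\<in>Pow T. c (insert t T) (insert t A) *\<^sub>R ordered_prod J (insert t A))"
    using t by (subst sum.reindex) (auto simp: inj_on_def o_def insert_eq_iff)
  also have "\<dots> = b t *\<^sub>R (J t * (\<Sum>A\<in>Pow T. c T A *\<^sub>R ordered_prod J A))"
    unfolding sum_distrib_left scaleR_sum_right by (intro sum.cong refl c2)
  also have "(\<Sum>A\<in>Pow T. c (insert t T) A *\<^sub>R ordered_prod J A) = a t *\<^sub>R (\<Sum>A\<in>Pow T. c T A *\<^sub>R ordered_prod J A)"
    unfolding scaleR_sum_right by (intro sum.cong refl) (simp add: c1)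
  also have "(\<Sum>A\<in>Pow T. c T A *\<^sub>R ordered_prod J A) = ordered_prod (\<lambda>t. of_real (a t) + b t *\<^sub>R J t) T"
    unfolding c_def using insert.IH by simp
  finally have "(\<Sum>A\<in>Pow (insert t T). c (insert t T) A *\<^sub>R ordered_prod J A) =
      (of_real (a t) + b t *\<^sub>R J t) * ordered_prod (\<lambda>t. of_real (a t) + b t *\<^sub>R J t) T"
    by (simp add: distrib_right of_real_def)
  also have "\<dots> = ordered_prod (\<lambda>t. of_real (a t) + b t *\<^sub>R J t) (insert t T)"
    using insert.hyps by (intro ordered_prod_insert[symmetric]) auto
  finally show ?case unfolding c_def by simp
qed simp

definition xbar_stem :: "'n::finite set \<Rightarrow> ('m::{finite,linorder}, 'n) stem" where
  "xbar_stem T A z = (if A \<subseteq> T then of_real ((\<Prod>l\<in>T - A. Re (z $ l)) * (\<Prod>l\<in>A. - Im (z $ l))) else 0)"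

lemma is_stem_xbar: "is_stem D (xbar_stem T)"
proof -
  have "(\<Prod>l\<in>A. - Im (cnj_at h z $ l)) = (if h \<in> A then -1 else 1) * (\<Prod>l\<in>A. - Im (z $ l))" for h z and A :: "'a set"
    using prod_Im_cnj_at[of h z A] by (simp add: prod_uminus)
  moreover have "(\<Prod>l\<in>A. Re (cnj_at h z $ l)) = (\<Prod>l\<in>A. Re (z $ l))" for h z and A :: "'a set"
    by (intro prod.cong) (auto simp: cnj_at_nth)
  ultimately show ?thesis by (auto simp: is_stem_def xbar_stem_def)
qed

lemma coord_cnj_slice_pt:
  fixes J :: "'n::{finite,linorder} \<Rightarrow> 'm::{finite,linorder} clifford"
  assumes "symmetric D" "z \<in> D" "\<And>l. J l \<in> imag_sphere"
  shows "coord_cnj D j (slice_pt J z) = of_real (Re (z $ j)) + (- Im (z $ j)) *\<^sub>R J j"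
proof -
  let ?C = "(\<lambda>K z. if K = {} then of_real (Re (z $ j)) else if K = {j} then - of_real (Im (z $ j)) else 0)
    :: ('m, 'n) stem"
  have "is_stem D ?C" by (auto simp: is_stem_def cnj_at_nth)
  hence "coord_cnj D j (slice_pt J z) = stem_val J ?C z"
    unfolding coord_cnj_def using assms by (intro slice_ind_slice_pt)
  also have "\<dots> = (\<Sum>K\<in>{{}, {j}}. ordered_prod J K * ?C K z)"
    unfolding stem_val_def by (rule sum.mono_neutral_right) auto
  also have "\<dots> = of_real (Re (z $ j)) + (- Im (z $ j)) *\<^sub>R J j"
    by (simp add: ordered_prod_def of_real_def)
  finally show ?thesis .
qed

lemma coord_cnj_prod_induced_by:
  assumes "symmetric D"
  shows "induced_by D (coord_cnj_prod D T) (xbar_stem T :: ('m::{finite,linorder}, 'n::{finite,linorder}) stem)"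
proof (rule induced_byI[OF assms is_stem_xbar])
  fix J :: "'n \<Rightarrow> 'm clifford" and z assume z: "z \<in> D" "\<And>l. J l \<in> imag_sphere"
  have "coord_cnj_prod D T (slice_pt J z) = ordered_prod (\<lambda>t. of_real (Re (z $ t)) + (- Im (z $ t)) *\<^sub>R J t) T"
    unfolding coord_cnj_prod_def by (simp only: coord_cnj_slice_pt[OF assms z])
  also have "\<dots> = (\<Sum>A\<in>Pow T. ((\<Prod>l\<in>T - A. Re (z $ l)) * (\<Prod>l\<in>A. - Im (z $ l))) *\<^sub>R ordered_prod J A)"
    by (rule ordered_prod_expand) simp
  also have "\<dots> = stem_val J (xbar_stem T) z"
    unfolding stem_val_def
    by (rule sum.mono_neutral_cong_left) (auto simp: xbar_stem_def of_real_def)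
  finally show "coord_cnj_prod D T (slice_pt J z) = stem_val J (xbar_stem T) z" .
qed

text \<open>One factor lives on subsets of T, hence of H, the other on subsets of the complement of
  H. So B has to split as B \<inter> H and B - H, and disjointness makes the sign trivial.\<close>

lemma stem_prod_xbar:
  fixes G :: "('m::{finite,linorder}, 'n::{finite,linorder}) stem"
  assumes supp: "\<And>L. \<not> L \<subseteq> - H \<Longrightarrow> G L z = 0" and T: "T \<subseteq> H"
  shows "stem_prod (xbar_stem T) G B z = (if B \<inter> H \<subseteq> T
    then ((\<Prod>l\<in>T - B \<inter> H. Re (z $ l)) * (\<Prod>l\<in>B \<inter> H. - Im (z $ l))) *\<^sub>R G (B - H) z else 0)"
proof -
  have "stem_prod (xbar_stem T) G B z =
      (\<Sum>A\<in>{B \<inter> H}. (- 1) ^ card (A \<inter> sym_diff A B) * xbar_stem T A z * G (sym_diff A B) z)"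
    unfolding stem_prod_alt
  proof (rule sum.mono_neutral_right)
    show "\<forall>A\<in>UNIV - {B \<inter> H}. (- 1) ^ card (A \<inter> sym_diff A B) * xbar_stem T A z * G (sym_diff A B) z = 0"
    proof
      fix A assume A: "A \<in> UNIV - {B \<inter> H}"
      have "\<not> A \<subseteq> T \<or> \<not> sym_diff A B \<subseteq> - H" using A T by auto
      thus "(- 1) ^ card (A \<inter> sym_diff A B) * xbar_stem T A z * G (sym_diff A B) z = 0"
        using supp by (auto simp: xbar_stem_def)
    qed
  qed auto
  moreover have "sym_diff (B \<inter> H) B = B - H" "B \<inter> H \<inter> (B - H) = {}" by auto
  ultimately show ?thesis by (simp add: xbar_stem_def of_real_def)
qed

lemma is_stem_stem_prod:
  assumes "is_stem D F" "is_stem D G"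
  shows "is_stem D (stem_prod F G)"
  unfolding is_stem_def
proof (intro ballI allI)
  fix z h L assume z: "z \<in> D"
  have "(- 1) ^ card (H \<inter> sym_diff H L) * F H (cnj_at h z) * G (sym_diff H L) (cnj_at h z) =
    (if h \<in> L then -1 else 1) * ((- 1) ^ card (H \<inter> sym_diff H L) * F H z * G (sym_diff H L) z)" for H
    using assms z unfolding is_stem_def by (cases "h \<in> H"; cases "h \<in> L") auto
  thus "stem_prod F G L (cnj_at h z) = (if h \<in> L then - stem_prod F G L z else stem_prod F G L z)"
    unfolding stem_prod_alt by (simp add: sum_negf)
qed

lemma minus_one_power_mult: "(- 1) ^ k * (v :: 'a::real_algebra_1) = (- 1 :: real) ^ k *\<^sub>R v"
  by (induction k) auto

lemma decomposition_term:
  fixes f :: "('m::{finite,linorder}, 'n::{finite,linorder}) slice_fun"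
  assumes sym: "symmetric D" and F: "induced_by D f F"
    and z: "z \<in> nonreal D H" and J: "\<And>l. J l \<in> imag_sphere"
  shows "slice_prod (nonreal D H) (coord_cnj_prod (nonreal D H) T) (S_comp D H K f) (slice_pt J z)
    = stem_val J (stem_prod (xbar_stem T) (S_stem H K F)) z"
proof -
  have N: "symmetric (nonreal D H)" using sym by (rule symmetric_nonreal)
  have S: "induced_by (nonreal D H) (S_comp D H K f) (S_stem H K F)"
    by (rule S_comp_induced_by[OF sym F])
  show ?thesis
    unfolding slice_prod_eq[OF N coord_cnj_prod_induced_by[OF N] S]
    using S by (intro slice_ind_slice_pt N z J is_stem_stem_prod is_stem_xbar) (simp add: induced_by_def)
qed

lemma decomposition:
  fixes f :: "('m::{finite,linorder}, 'n::{finite,linorder}) slice_fun"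
  assumes sym: "symmetric D" and F: "induced_by D f F" and x: "x \<in> Omega (nonreal D H)"
  shows "f x = (\<Sum>K\<in>Pow H. (- 1) ^ card (H - K) *
    slice_prod (nonreal D H) (coord_cnj_prod (nonreal D H) (H - K)) (S_comp D H K f) x)"
proof -
  obtain J z where x: "x = slice_pt J z" and z: "z \<in> nonreal D H" and J: "\<And>l. J l \<in> imag_sphere"
    using x Omega_cases by blast
  define c where "c K B = (\<Prod>l\<in>H - K - B \<inter> H. Re (z $ l)) * (\<Prod>l\<in>B \<inter> H. - Im (z $ l))" for K B
  define T where "T K B = (if B \<inter> H \<subseteq> H - K then c K B *\<^sub>R S_stem H K F (B - H) z else 0)" for K B
  have "(\<Sum>K\<in>Pow H. (- 1) ^ card (H - K) *
      slice_prod (nonreal D H) (coord_cnj_prod (nonreal D H) (H - K)) (S_comp D H K f) x) =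
    (\<Sum>K\<in>Pow H. \<Sum>B\<in>UNIV. ordered_prod J B * ((- 1) ^ card (H - K) *\<^sub>R T K B))"
  proof (intro sum.cong refl)
    fix K assume K: "K \<in> Pow H"
    have "stem_prod (xbar_stem (H - K)) (S_stem H K F) B z = T K B" for B
      unfolding T_def c_def by (rule stem_prod_xbar) (auto intro: S_stem_support)
    thus "(- 1) ^ card (H - K) *
      slice_prod (nonreal D H) (coord_cnj_prod (nonreal D H) (H - K)) (S_comp D H K f) x =
      (\<Sum>B\<in>UNIV. ordered_prod J B * ((- 1) ^ card (H - K) *\<^sub>R T K B))"
      unfolding x decomposition_term[OF sym F z J] minus_one_power_mult stem_val_def scaleR_sum_right by simp
  qed
  also have "\<dots> = (\<Sum>B\<in>UNIV. ordered_prod J B * (\<Sum>K\<in>Pow H. (- 1) ^ card (H - K) *\<^sub>R T K B))"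
    by (subst sum.swap) (simp add: sum_distrib_left)
  also have "\<dots> = (\<Sum>B\<in>UNIV. ordered_prod J B * F B z)"
  proof (intro sum.cong refl arg_cong2[where f = "(*)"])
    fix B
    \<comment> \<open>Only sets K disjoint from B contribute; what remains is
      \<open>S_stem_decomposition\<close> with A = B \<inter> H and L = B - H.\<close>
    have "(\<Sum>K\<in>Pow H. (- 1) ^ card (H - K) *\<^sub>R T K B) =
      (\<Sum>K\<in>Pow (H - B \<inter> H). (- 1) ^ card (H - K) *\<^sub>R c K B *\<^sub>R S_stem H K F (B - H) z)"
      by (rule sum.mono_neutral_cong_right) (auto simp: T_def)
    also have "\<dots> = F (B \<inter> H \<union> (B - H)) z"
      unfolding c_def by (rule S_stem_decomposition[OF z]) auto
    also have "B \<inter> H \<union> (B - H) = B" by auto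
    finally show "(\<Sum>K\<in>Pow H. (- 1) ^ card (H - K) *\<^sub>R T K B) = F B z" .
  qed
  also have "\<dots> = f x"
    unfolding x using induced_by_val[OF F sym _ J] z nonreal_subset[of D H] by (auto simp: stem_val_def)
  finally show ?thesis ..
qed

text \<open>If all of H precedes its complement, the ordered product over A \<union> L is the
  product over A times the product over L, and the slice product becomes pointwise. Initial segments
  have this property.\<close>

lemma stem_val_xbar_mult:
  fixes G :: "('m::{finite,linorder}, 'n::{finite,linorder}) stem"
  assumes supp: "\<And>L. \<not> L \<subseteq> - H \<Longrightarrow> G L z = 0" and T: "T \<subseteq> H"
    and less: "\<And>a b. a \<in> H \<Longrightarrow> b \<notin> H \<Longrightarrow> a < b"
  shows "stem_val J (stem_prod (xbar_stem T) G) z = stem_val J (xbar_stem T) z * stem_val J G z"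
proof -
  define c where "c A = (\<Prod>l\<in>T - A. Re (z $ l)) * (\<Prod>l\<in>A. - Im (z $ l))" for A
  have "stem_val J (stem_prod (xbar_stem T) G) z =
      (\<Sum>B\<in>{B. B \<inter> H \<subseteq> T}. ordered_prod J B * (c (B \<inter> H) *\<^sub>R G (B - H) z))"
    unfolding stem_val_def
    by (rule sum.mono_neutral_cong_right) (auto simp: stem_prod_xbar[where G = G and H = H and T = T and z = z, OF supp T] c_def)
  also have "\<dots> = (\<Sum>(A, L)\<in>Pow T \<times> Pow (- H). ordered_prod J (A \<union> L) * (c A *\<^sub>R G L z))"
  proof (rule sum.reindex_bij_witness[of _ "\<lambda>(A, L). A \<union> L" "\<lambda>B. (B \<inter> H, B - H)"])
    fix p assume p: "p \<in> Pow T \<times> Pow (- H)"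
    obtain A L where p': "p = (A, L)" "A \<subseteq> T" "L \<subseteq> - H" using p by auto
    show "((case p of (A, L) \<Rightarrow> A \<union> L) \<inter> H, (case p of (A, L) \<Rightarrow> A \<union> L) - H) = p"
      using p' T by auto
    show "(case p of (A, L) \<Rightarrow> A \<union> L) \<in> {B. B \<inter> H \<subseteq> T}" using p' by auto
  next
    fix B :: "'n set"
    have "B \<inter> H \<union> (B - H) = B" by auto
    thus "(case (B \<inter> H, B - H) of (A, L) \<Rightarrow> A \<union> L) = B"
      "(case (B \<inter> H, B - H) of (A, L) \<Rightarrow> ordered_prod J (A \<union> L) * (c A *\<^sub>R G L z)) =
       ordered_prod J B * (c (B \<inter> H) *\<^sub>R G (B - H) z)" by simp_all
  qed auto
  also have "\<dots> = (\<Sum>(A, L)\<in>Pow T \<times> Pow (- H). (c A *\<^sub>R ordered_prod J A) * (ordered_prod J L * G L z))"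
  proof (intro sum.cong refl)
    fix p assume "p \<in> Pow T \<times> Pow (- H)"
    then obtain A L where p: "p = (A, L)" "A \<subseteq> T" "L \<subseteq> - H" by auto
    have "ordered_prod J (A \<union> L) = ordered_prod J A * ordered_prod J L"
    proof (rule ordered_prod_Un)
      show "a < b" if "a \<in> A" "b \<in> L" for a b by (rule less) (use that p T in auto)
    qed auto
    thus "(case p of (A, L) \<Rightarrow> ordered_prod J (A \<union> L) * (c A *\<^sub>R G L z)) =
      (case p of (A, L) \<Rightarrow> (c A *\<^sub>R ordered_prod J A) * (ordered_prod J L * G L z))"
      by (simp add: p mult.assoc)
  qed
  also have "\<dots> = (\<Sum>A\<in>Pow T. c A *\<^sub>R ordered_prod J A) * (\<Sum>L\<in>Pow (- H). ordered_prod J L * G L z)"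
    by (simp add: sum_product sum.cartesian_product)
  also have "(\<Sum>A\<in>Pow T. c A *\<^sub>R ordered_prod J A) = stem_val J (xbar_stem T) z"
    unfolding stem_val_def
    by (rule sum.mono_neutral_cong_left) (auto simp: xbar_stem_def c_def of_real_def)
  also have "(\<Sum>L\<in>Pow (- H). ordered_prod J L * G L z) = stem_val J G z"
    unfolding stem_val_def by (rule sum.mono_neutral_cong_left) (auto simp: supp)
  finally show ?thesis .
qed

lemma decomposition_pointwise:
  fixes f :: "('m::{finite,linorder}, 'n::{finite,linorder}) slice_fun"
  assumes sym: "symmetric D" and F: "induced_by D f F" and x: "x \<in> Omega (nonreal D H)"
    and H: "H = first_indices q"
  shows "f x = (\<Sum>K\<in>Pow H. (- 1) ^ card (H - K) * (coord_cnj_prod (nonreal D H) (H - K) x * S_comp D H K f x))"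
  unfolding decomposition[OF sym F x]
proof (intro sum.cong refl arg_cong2[where f = "(*)"])
  fix K assume K: "K \<in> Pow H"
  obtain J z where x: "x = slice_pt J z" and z: "z \<in> nonreal D H" and J: "\<And>l. J l \<in> imag_sphere"
    using x Omega_cases by blast
  have less: "a < b" if "a \<in> H" "b \<notin> H" for a b
  proof (rule ccontr)
    assume "\<not> a < b"
    hence "card {..b} \<le> card {..a}" by (intro card_mono) auto
    thus False using that by (simp add: H first_indices_def)
  qed
  have N: "symmetric (nonreal D H)" using sym by (rule symmetric_nonreal)
  show "slice_prod (nonreal D H) (coord_cnj_prod (nonreal D H) (H - K)) (S_comp D H K f) x =
    coord_cnj_prod (nonreal D H) (H - K) x * S_comp D H K f x"
    unfolding x decomposition_term[OF sym F z J]
      induced_by_val[OF coord_cnj_prod_induced_by[OF N] N z J] induced_by_val[OF S_comp_induced_by[OF sym F] N z J]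
  proof (rule stem_val_xbar_mult[where H = H])
    show "S_stem H K F L z = 0" if "\<not> L \<subseteq> - H" for L using that by (rule S_stem_support)
  qed (use less in auto)
qed

subsection \<open>Sections\<close>

lemma subst_at_nth: "subst_at h y x $ l = (if l = h then x else y $ l)"
  by (simp add: subst_at_def)

lemma subst_at_same [simp]: "subst_at h z (z $ h) = z"
  by (simp add: vec_eq_iff subst_at_nth)

lemma subst_at_slice_pt: "subst_at h (slice_pt J z) (slice_pt1 I w) = slice_pt (J(h := I)) (subst_at h z w)"
  by (simp add: vec_eq_iff subst_at_nth slice_pt_def)

lemma cnj_at_subst_at: "cnj_at h (subst_at h z w) = subst_at h z (cnj w)"
  by (simp add: vec_eq_iff subst_at_nth cnj_at_nth)

definition sec :: "(complex ^ 'n::finite) set \<Rightarrow> 'n \<Rightarrow> complex ^ 'n \<Rightarrow> complex set" where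
  "sec D h z = {w. subst_at h z w \<in> D}"

lemma continuous_subst_at [continuous_intros]:
  "continuous_on S f \<Longrightarrow> continuous_on S (\<lambda>x. subst_at h z (f x))"
  unfolding subst_at_def
proof (intro continuous_on_vec_lambda)
  fix i assume "continuous_on S f"
  thus "continuous_on S (\<lambda>x. if i = h then f x else z $ i)" by (cases "i = h") auto
qed

lemma open_sec: "open D \<Longrightarrow> open (sec D h z)"
  unfolding sec_def using open_vimage[of D "\<lambda>w. subst_at h z w"]
  by (simp add: vimage_def continuous_intros)

lemma cnj_sec: "symmetric D \<Longrightarrow> w \<in> sec D h z \<Longrightarrow> cnj w \<in> sec D h z"
  unfolding sec_def symmetric_def by (metis cnj_at_subst_at mem_Collect_eq)

text \<open>Two presentations agree up to conjugation in each single coordinate, and D is invariant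
  under these conjugations; so the section does not depend on the presentation of the base
  point.\<close>

lemma section_dom_eq:
  fixes J :: "'n::{finite,linorder} \<Rightarrow> 'm::{finite,linorder} clifford"
  assumes sym: "symmetric D" and z: "z \<in> D" and J: "\<And>l. J l \<in> imag_sphere"
  shows "section_dom D h (slice_pt J z) = Omega1 (sec D h z)"
proof (intro equalityI subsetI)
  fix x :: "'m clifford" assume "x \<in> Omega1 (sec D h z)"
  then obtain I w where x: "x = slice_pt1 I w" "I \<in> imag_sphere" "subst_at h z w \<in> D"
    by (auto simp: Omega1_def sec_def)
  thus "x \<in> section_dom D h (slice_pt J z)"
    unfolding section_dom_def x(1) mem_Collect_eq subst_at_slice_pt
    using J by (intro slice_pt_in_Omega) auto
next
  fix x :: "'m clifford" assume "x \<in> section_dom D h (slice_pt J z)"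
  then obtain J' z' where *: "subst_at h (slice_pt J z) x = slice_pt J' z'" "z' \<in> D" "\<And>l. J' l \<in> imag_sphere"
    unfolding section_dom_def by (auto elim!: Omega_cases)
  have x: "x = slice_pt1 (J' h) (z' $ h)"
    using arg_cong[OF *(1), of "\<lambda>y. y $ h"] by (simp add: subst_at_nth slice_pt_def)
  define S where "S = {l. l \<noteq> h \<and> z' $ l \<noteq> z $ l}"
  have "z $ l = z' $ l \<or> z $ l = cnj (z' $ l)" if "l \<noteq> h" for l
  proof -
    have "slice_pt1 (J l) (z $ l) = slice_pt1 (J' l) (z' $ l)"
      using arg_cong[OF *(1), of "\<lambda>y. y $ l"] that by (simp add: subst_at_nth slice_pt_def)
    from slice_pt1_eq_cases[OF J *(3) this] show ?thesis by auto
  qed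
  hence e: "l = h \<or> z $ l = z' $ l \<or> z $ l = cnj (z' $ l)" for l by blast
  have "subst_at h z (z' $ h) $ l = cnj_set S z' $ l" for l
    using e[of l] by (cases "l = h"; cases "z' $ l = z $ l") (auto simp: subst_at_nth cnj_set_def S_def)
  hence "subst_at h z (z' $ h) = cnj_set S z'" by (simp add: vec_eq_iff)
  moreover have "cnj_set S z' \<in> D"
  proof -
    have "is_stem D (\<lambda>K z. 0 :: 'm clifford)" by (simp add: is_stem_def)
    from cnj_set_stem[OF sym this *(2)] show ?thesis by blast
  qed
  ultimately have "z' $ h \<in> sec D h z" by (simp add: sec_def)
  thus "x \<in> Omega1 (sec D h z)"
    unfolding Omega1_def x using *(3)[of h] by blast
qed

lemma Omega1_inj:
  fixes E E' :: "complex set"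
  assumes "Omega1 E = (Omega1 E' :: 'm::{finite,linorder} clifford set)"
    "\<And>w. w \<in> E \<Longrightarrow> cnj w \<in> E" "\<And>w. w \<in> E' \<Longrightarrow> cnj w \<in> E'"
  shows "E = E'"
proof -
  have "w \<in> B" if AB: "Omega1 A = (Omega1 B :: 'm clifford set)" "\<And>w. w \<in> B \<Longrightarrow> cnj w \<in> B" "w \<in> A" for A B w
  proof -
    define J :: "'m clifford" where "J = cl_gen undefined"
    have J: "J \<in> imag_sphere" by (simp add: J_def cl_gen_imag_sphere)
    have "slice_pt1 J w \<in> Omega1 A" using AB(3) J unfolding Omega1_def by blast
    hence "slice_pt1 J w \<in> Omega1 B" by (simp only: AB(1))
    then obtain J' w' where "slice_pt1 J w = slice_pt1 J' w'" "w' \<in> B" "J' \<in> imag_sphere"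
      by (auto simp: Omega1_def)
    thus ?thesis using slice_pt1_eq_cases[OF J] AB(2)[of w'] by fastforce
  qed
  from this[of E E'] this[of E' E] show ?thesis using assms by blast
qed

text \<open>With \<open>sec1\<close>, the even and odd parts in the variable h of a stem supported
  on subsets of \<open>{h..}\<close>. Then h is the smallest index that occurs, so its unit is the
  leftmost factor and can be split off as in the definition of a one-variable slice
  function.\<close>

definition sec0 ::
  "('n::{finite,linorder} \<Rightarrow> 'm::{finite,linorder} clifford) \<Rightarrow> ('m, 'n) stem \<Rightarrow> 'n \<Rightarrow>
    complex ^ 'n::{finite,linorder} \<Rightarrow> complex \<Rightarrow> 'm clifford" where
  "sec0 J F h z w = (\<Sum>L\<in>Pow {h<..}. ordered_prod J L * F L (subst_at h z w))"

definition sec1 ::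
  "('n::{finite,linorder} \<Rightarrow> 'm::{finite,linorder} clifford) \<Rightarrow> ('m, 'n) stem \<Rightarrow> 'n \<Rightarrow>
    complex ^ 'n::{finite,linorder} \<Rightarrow> complex \<Rightarrow> 'm clifford" where
  "sec1 J F h z w = (\<Sum>L\<in>Pow {h<..}. ordered_prod J L * F (insert h L) (subst_at h z w))"

lemma stem_val_min:
  fixes J :: "'n::{finite,linorder} \<Rightarrow> 'm::{finite,linorder} clifford"
  assumes supp: "\<And>L. \<not> L \<subseteq> {h..} \<Longrightarrow> F L z = 0"
  shows "stem_val J F z = (\<Sum>L\<in>Pow {h<..}. ordered_prod J L * F L z)
    + J h * (\<Sum>L\<in>Pow {h<..}. ordered_prod J L * F (insert h L) z)"
proof -
  have "{h..} = insert h {h<..}" by auto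
  hence "stem_val J F z = (\<Sum>L\<in>Pow (insert h {h<..}). ordered_prod J L * F L z)"
    unfolding stem_val_def using supp by (intro sum.mono_neutral_right) auto
  also have "\<dots> = (\<Sum>L\<in>Pow {h<..}. ordered_prod J L * F L z)
      + (\<Sum>L\<in>insert h ` Pow {h<..}. ordered_prod J L * F L z)"
    unfolding Pow_insert by (intro sum.union_disjoint) auto
  also have "(\<Sum>L\<in>insert h ` Pow {h<..}. ordered_prod J L * F L z) =
      (\<Sum>L\<in>Pow {h<..}. ordered_prod J (insert h L) * F (insert h L) z)"
  proof (subst sum.reindex)
    have "h \<notin> L" if "L \<in> Pow {h<..}" for L using that by auto
    thus "inj_on (insert h) (Pow {h<..})" by (auto simp: inj_on_def insert_eq_iff)
  qed (simp add: o_def)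
  also have "\<dots> = (\<Sum>L\<in>Pow {h<..}. J h * (ordered_prod J L * F (insert h L) z))"
  proof (intro sum.cong refl)
    fix L assume "L \<in> Pow {h<..}"
    hence "ordered_prod J (insert h L) = J h * ordered_prod J L"
      by (intro ordered_prod_insert) auto
    thus "ordered_prod J (insert h L) * F (insert h L) z = J h * (ordered_prod J L * F (insert h L) z)"
      by (simp add: mult.assoc)
  qed
  finally show ?thesis by (simp add: sum_distrib_left)
qed

lemma slice_pair1_section:
  fixes J :: "'n::{finite,linorder} \<Rightarrow> 'm::{finite,linorder} clifford"
  assumes D: "open D" "symmetric D" and F: "induced_by D f F" and z: "z \<in> D" and J: "\<And>l. J l \<in> imag_sphere"
    and supp: "\<And>L z. \<not> L \<subseteq> {h..} \<Longrightarrow> F L z = 0"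
  shows "slice_pair1 (sec D h z) (\<lambda>x. f (subst_at h (slice_pt J z) x)) (sec0 J F h z) (sec1 J F h z)"
  unfolding slice_pair1_def
proof (intro conjI ballI)
  have st: "is_stem D F" using F by (simp add: induced_by_def)
  fix w assume w: "w \<in> sec D h z"
  hence wD: "subst_at h z w \<in> D" by (simp add: sec_def)
  show "cnj w \<in> sec D h z" using w by (rule cnj_sec[OF D(2)])
  have "F L (subst_at h z (cnj w)) = (if h \<in> L then - F L (subst_at h z w) else F L (subst_at h z w))" for L
    using st wD unfolding is_stem_def cnj_at_subst_at[symmetric] by blast
  moreover have "h \<notin> L" if "L \<in> Pow {h<..}" for L using that by auto
  ultimately show "sec0 J F h z (cnj w) = sec0 J F h z w" "sec1 J F h z (cnj w) = - sec1 J F h z w"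
    by (simp_all add: sec0_def sec1_def sum_negf)
  fix I :: "'m clifford" assume I: "I \<in> imag_sphere"
  define J' where "J' = J(h := I)"
  have J'h: "J' h = I" and JI: "J' l \<in> imag_sphere" for l using I J by (simp_all add: J'_def)
  have op: "ordered_prod J' L = ordered_prod J L" if "L \<in> Pow {h<..}" for L
    by (rule ordered_prod_cong) (use that in \<open>auto simp: J'_def\<close>)
  have "f (subst_at h (slice_pt J z) (slice_pt1 I w)) = stem_val J' F (subst_at h z w)"
    unfolding subst_at_slice_pt J'_def[symmetric]
    by (rule induced_by_val[where J = J', OF F D(2) wD JI])
  also have "\<dots> = (\<Sum>L\<in>Pow {h<..}. ordered_prod J' L * F L (subst_at h z w))
    + J' h * (\<Sum>L\<in>Pow {h<..}. ordered_prod J' L * F (insert h L) (subst_at h z w))"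
    by (rule stem_val_min[OF supp])
  also have "\<dots> = sec0 J F h z w + I * sec1 J F h z w"
    by (simp only: sec0_def sec1_def op J'h cong: sum.cong)
  finally show "f (subst_at h (slice_pt J z) (slice_pt1 I w)) = sec0 J F h z w + I * sec1 J F h z w" .
qed (use D open_sec in auto)

text \<open>All components whose index set contains h vanish. The unit of the variable h then drops
  out, and the remaining components are even in Im w.\<close>

lemma circular_section:
  fixes J :: "'n::{finite,linorder} \<Rightarrow> 'm::{finite,linorder} clifford"
  assumes D: "open D" "symmetric D" and F: "induced_by D f F" and z: "z \<in> D" and J: "\<And>l. J l \<in> imag_sphere"
    and supp: "\<And>L z. h \<in> L \<Longrightarrow> F L z = 0"
  shows "slice_pair1 (sec D h z) (\<lambda>x. f (subst_at h (slice_pt J z) x)) (\<lambda>w. stem_val J F (subst_at h z w)) (\<lambda>_. 0)"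
  unfolding slice_pair1_def
proof (intro conjI ballI)
  have st: "is_stem D F" using F by (simp add: induced_by_def)
  fix w assume w: "w \<in> sec D h z"
  hence wD: "subst_at h z w \<in> D" by (simp add: sec_def)
  show "cnj w \<in> sec D h z" using w by (rule cnj_sec[OF D(2)])
  have "F L (subst_at h z (cnj w)) = F L (subst_at h z w)" for L
    using st wD supp unfolding is_stem_def cnj_at_subst_at[symmetric] by (cases "h \<in> L") auto
  thus "stem_val J F (subst_at h z (cnj w)) = stem_val J F (subst_at h z w)"
    by (simp add: stem_val_def)
  show "(0 :: 'm clifford) = - 0" by simp
  fix I :: "'m clifford" assume I: "I \<in> imag_sphere"
  define J' where "J' = J(h := I)"
  have JI: "J' l \<in> imag_sphere" for l using I J by (simp add: J'_def)
  have "ordered_prod J' L * F L (subst_at h z w) = ordered_prod J L * F L (subst_at h z w)" for L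
  proof (cases "h \<in> L")
    case False
    hence "ordered_prod J' L = ordered_prod J L" by (intro ordered_prod_cong) (auto simp: J'_def)
    thus ?thesis by simp
  qed (simp add: supp)
  hence "stem_val J' F (subst_at h z w) = stem_val J F (subst_at h z w)" by (simp add: stem_val_def)
  moreover have "f (subst_at h (slice_pt J z) (slice_pt1 I w)) = stem_val J' F (subst_at h z w)"
    unfolding subst_at_slice_pt J'_def[symmetric]
    by (rule induced_by_val[where J = J', OF F D(2) wD JI])
  ultimately show "f (subst_at h (slice_pt J z) (slice_pt1 I w)) = stem_val J F (subst_at h z w) + I * 0"
    by simp
qed (use D open_sec in auto)

lemma S_comp_slice_fns: "symmetric D \<Longrightarrow> induced_by D f F \<Longrightarrow> S_comp D H K f \<in> slice_fns (nonreal D H)"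
  unfolding slice_fns_def using S_comp_induced_by by blast

lemma S_comp_circular:
  fixes f :: "('m::{finite,linorder}, 'n::{finite,linorder}) slice_fun"
  assumes D: "open D" "symmetric D" and F: "induced_by D f F"
  shows "S_comp D H K f \<in> circular_fns H (nonreal D H)"
proof -
  have "S_comp D H K f \<in> circular_fns_at h (nonreal D H)" if h: "h \<in> H" for h
    unfolding circular_fns_at_def
  proof (intro CollectI conjI ballI S_comp_slice_fns[OF D(2) F])
    fix y :: "'m clifford ^ 'n::{finite,linorder}" assume "y \<in> Omega (nonreal D H)"
    then obtain J z where y: "y = slice_pt J z" "z \<in> nonreal D H" "\<And>l. J l \<in> imag_sphere"
      using Omega_cases by blast
    have "slice_pair1 (sec (nonreal D H) h z) (\<lambda>x. S_comp D H K f (subst_at h y x))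
        (\<lambda>w. stem_val J (S_stem H K F) (subst_at h z w)) (\<lambda>_. 0)"
      unfolding y(1)
    proof (rule circular_section[OF open_nonreal[OF D(1)] symmetric_nonreal[OF D(2)] S_comp_induced_by[OF D(2) F] y(2,3)])
      show "S_stem H K F L z = 0" if "h \<in> L" for L z
        by (rule S_stem_support) (use that h in auto)
    qed
    moreover have "section_dom (nonreal D H) h y = Omega1 (sec (nonreal D H) h z)"
      unfolding y(1) by (rule section_dom_eq[OF symmetric_nonreal[OF D(2)] y(2,3)])
    ultimately show "is_circular1 (section_dom (nonreal D H) h y) (\<lambda>x. S_comp D H K f (subst_at h y x))"
      unfolding is_circular1_def by blast
  qed
  thus ?thesis unfolding circular_fns_def using S_comp_slice_fns[OF D(2) F] by blast
qed

text \<open>The stem of the component is supported on subsets of the complement of H, none of whose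
  elements is below its minimum, as the splitting at that variable demands.\<close>

lemma S_comp_pair_at_min:
  fixes J :: "'n::{finite,linorder} \<Rightarrow> 'm::{finite,linorder} clifford"
  assumes D: "open D" "symmetric D" and F: "induced_by D f F" and H: "H \<noteq> UNIV"
    and y: "z \<in> nonreal D H" "\<And>l. J l \<in> imag_sphere"
  shows "slice_pair1 (sec (nonreal D H) (Min (- H)) z) (\<lambda>x. S_comp D H K f (subst_at (Min (- H)) (slice_pt J z) x))
      (sec0 J (S_stem H K F) (Min (- H)) z) (sec1 J (S_stem H K F) (Min (- H)) z)"
proof (rule slice_pair1_section[OF open_nonreal[OF D(1)] symmetric_nonreal[OF D(2)] S_comp_induced_by[OF D(2) F] y])
  have "- H \<subseteq> {Min (- H)..}" by auto
  thus "S_stem H K F L z = 0" if "\<not> L \<subseteq> {Min (- H)..}" for L z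
    by (intro S_stem_support) (use that in blast)
qed

lemma S_comp_slice_at_min:
  fixes f :: "('m::{finite,linorder}, 'n::{finite,linorder}) slice_fun"
  assumes D: "open D" "symmetric D" and F: "induced_by D f F" and H: "H \<noteq> UNIV"
  shows "S_comp D H K f \<in> slice_fns_at (Min (- H)) (nonreal D H)"
  unfolding slice_fns_at_def
proof (intro CollectI conjI ballI S_comp_slice_fns[OF D(2) F])
  fix y :: "'m clifford ^ 'n::{finite,linorder}" assume "y \<in> Omega (nonreal D H)"
  then obtain J z where y: "y = slice_pt J z" "z \<in> nonreal D H" "\<And>l. J l \<in> imag_sphere"
    using Omega_cases by blast
  show "is_slice1 (section_dom (nonreal D H) (Min (- H)) y) (\<lambda>x. S_comp D H K f (subst_at (Min (- H)) y x))"
    unfolding is_slice1_def y(1)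
    by (intro exI conjI, rule section_dom_eq[where J = J, OF symmetric_nonreal[OF D(2)] y(2,3)],
        rule S_comp_pair_at_min[where J = J, OF D F H y(2,3)])
qed

subsection \<open>Slice preserving functions\<close>

lemma continuous_zero_on_nonreal:
  fixes g :: "complex ^ 'n::finite \<Rightarrow> 'b::real_normed_vector"
  assumes D: "open D" and g: "continuous_on D g" and 0: "\<And>z. z \<in> nonreal D UNIV \<Longrightarrow> g z = 0" and z: "z \<in> D"
  shows "g z = 0"
proof -
  \<comment> \<open>All coordinates move upwards together. For small t > 0 a real coordinate
    acquires imaginary part t and a non-real one stays non-real, so the points without real
    coordinates are dense in D.\<close>
  define c where "c t = z + (\<chi> l. \<i> * of_real t)" for t :: real
  have "((\<lambda>t. z + (\<chi> l. \<i> * of_real t)) \<longlongrightarrow> z + (\<chi> l. \<i> * of_real 0)) (at_right (0::real))"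
    by (intro tendsto_intros)
  moreover have "(\<chi> l. \<i> * of_real 0) = (0 :: complex ^ 'n)" by (simp add: vec_eq_iff)
  ultimately have c: "(c \<longlongrightarrow> z) (at_right 0)" by (simp add: c_def[abs_def])
  have "isCont g z" using g D z by (simp add: continuous_on_eq_continuous_at)
  hence lim: "((\<lambda>t. g (c t)) \<longlongrightarrow> g z) (at_right 0)" using c by (rule isCont_tendsto_compose)
  have "\<forall>\<^sub>F t in at_right (0::real). Im (c t $ l) \<noteq> 0" for l
  proof (cases "Im (z $ l) = 0")
    case True
    thus ?thesis by (auto simp: c_def eventually_at_right_less intro: eventually_mono[OF eventually_at_right_less])
  next
    case False
    have "((\<lambda>t. Im (c t $ l)) \<longlongrightarrow> Im (z $ l)) (at_right 0)" by (intro tendsto_intros c)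
    thus ?thesis using False by (rule tendsto_imp_eventually_ne)
  qed
  hence "\<forall>\<^sub>F t in at_right (0::real). \<forall>l\<in>UNIV. Im (c t $ l) \<noteq> 0"
    by (subst eventually_ball_finite_distrib) auto
  moreover have "\<forall>\<^sub>F t in at_right 0. c t \<in> D" using c D z by (simp add: topological_tendstoD)
  ultimately have "\<forall>\<^sub>F t in at_right 0. g (c t) = 0"
    by eventually_elim (auto intro: 0 simp: nonreal_def)
  hence "((\<lambda>t. g (c t)) \<longlongrightarrow> 0) (at_right 0)" by (rule tendsto_eventually)
  with lim show ?thesis by (rule tendsto_unique[rotated]) simp
qed

lemma Reals_scaleR: "a \<in> \<real> \<Longrightarrow> r *\<^sub>R a \<in> (\<real> :: 'a::real_algebra_1 set)"
proof -
  assume "a \<in> \<real>"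
  then obtain x where "a = of_real x" by (rule Reals_cases)
  hence "r *\<^sub>R a = of_real (r * x)" by (simp add: of_real_def)
  thus ?thesis by simp
qed

text \<open>For H = UNIV only the component of the empty set survives, so no imaginary unit enters
  the value.\<close>

lemma S_comp_UNIV_val:
  fixes J :: "'n::{finite,linorder} \<Rightarrow> 'm::{finite,linorder} clifford"
  assumes "symmetric D" "induced_by D f F" "z \<in> nonreal D UNIV" "\<And>l. J l \<in> imag_sphere"
  shows "S_comp D UNIV K f (slice_pt J z) = S_stem UNIV K F {} z"
proof -
  have "S_comp D UNIV K f (slice_pt J z) = stem_val J (S_stem UNIV K F) z"
    by (rule induced_by_val[OF S_comp_induced_by[OF assms(1,2)] symmetric_nonreal[OF assms(1)] assms(3,4)])
  also have "\<dots> = (\<Sum>L\<in>{{}}. ordered_prod J L * S_stem UNIV K F L z)"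
  proof -
    have "S_stem UNIV K F L z = 0" if "L \<noteq> {}" for L by (rule S_stem_support) (use that in auto)
    thus ?thesis unfolding stem_val_def by (intro sum.mono_neutral_right) auto
  qed
  finally show ?thesis by simp
qed

text \<open>The spherical components are combinations of the F K with real coefficients, by
  \<open>S_stem_explicit\<close>, and conversely by \<open>S_stem_decomposition\<close>.\<close>

lemma S_comp_UNIV_real_iff:
  fixes f :: "('m::{finite,linorder}, 'n::{finite,linorder}) slice_fun"
  assumes sym: "symmetric D" and F: "induced_by D f F"
  shows "(\<forall>K. \<forall>x\<in>Omega (nonreal D UNIV). S_comp D UNIV K f x \<in> \<real>) \<longleftrightarrow>
    (\<forall>K. \<forall>z\<in>nonreal D UNIV. F K z \<in> \<real>)"
proof
  assume R: "\<forall>K. \<forall>z\<in>nonreal D UNIV. F K z \<in> \<real>"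
  show "\<forall>K. \<forall>x\<in>Omega (nonreal D UNIV). S_comp D UNIV K f x \<in> \<real>"
  proof (intro allI ballI)
    fix K and x :: "'m clifford ^ 'n::{finite,linorder}" assume "x \<in> Omega (nonreal D UNIV)"
    then obtain J z where x: "x = slice_pt J z" "z \<in> nonreal D UNIV" "\<And>l. J l \<in> imag_sphere"
      using Omega_cases by blast
    have "S_stem UNIV K F {} z \<in> \<real>"
      using R x(2) by (subst S_stem_explicit) (auto intro!: Reals_scaleR sum_in_Reals)
    thus "S_comp D UNIV K f x \<in> \<real>"
      unfolding x(1) S_comp_UNIV_val[OF sym F x(2,3)] .
  qed
next
  assume R: "\<forall>K. \<forall>x\<in>Omega (nonreal D UNIV). S_comp D UNIV K f x \<in> \<real>"
  define J :: "'n \<Rightarrow> 'm clifford" where "J = (\<lambda>_. cl_gen undefined)"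
  have J: "J l \<in> imag_sphere" for l by (simp add: J_def cl_gen_imag_sphere)
  show "\<forall>K. \<forall>z\<in>nonreal D UNIV. F K z \<in> \<real>"
  proof (intro allI ballI)
    fix A z assume z: "z \<in> nonreal D UNIV"
    have S: "S_stem UNIV K F {} z \<in> \<real>" for K
    proof -
      have "S_comp D UNIV K f (slice_pt J z) \<in> \<real>"
        using R slice_pt_in_Omega[where J = J, OF z J] by blast
      thus ?thesis unfolding S_comp_UNIV_val[where J = J, OF sym F z J] .
    qed
    have "(\<Sum>K\<in>Pow (UNIV - A). (- 1) ^ card (UNIV - K) *\<^sub>R
      ((\<Prod>l\<in>UNIV - K - A. Re (z $ l)) * (\<Prod>l\<in>A. - Im (z $ l))) *\<^sub>R S_stem UNIV K F {} z) \<in> \<real>"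
    proof (rule sum_in_Reals)
      fix K
      show "(- 1) ^ card (UNIV - K) *\<^sub>R ((\<Prod>l\<in>UNIV - K - A. Re (z $ l)) * (\<Prod>l\<in>A. - Im (z $ l))) *\<^sub>R
          S_stem UNIV K F {} z \<in> \<real>"
        by (rule Reals_scaleR, rule Reals_scaleR, rule S)
    qed
    also have "(\<Sum>K\<in>Pow (UNIV - A). (- 1) ^ card (UNIV - K) *\<^sub>R
      ((\<Prod>l\<in>UNIV - K - A. Re (z $ l)) * (\<Prod>l\<in>A. - Im (z $ l))) *\<^sub>R S_stem UNIV K F {} z) = F (A \<union> {}) z"
      by (rule S_stem_decomposition[OF z]) auto
    finally show "F A z \<in> \<real>" by simp
  qed
qed

lemma slice_preserving_iff:
  assumes "symmetric D" "induced_by D f F"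
  shows "f \<in> slice_preserving_fns D \<longleftrightarrow> (\<forall>K. \<forall>z\<in>D. F K z \<in> \<real>)"
proof
  assume "f \<in> slice_preserving_fns D"
  then obtain G where "induced_by D f G" "\<forall>K. \<forall>z\<in>D. G K z \<in> \<real>"
    unfolding slice_preserving_fns_def by blast
  thus "\<forall>K. \<forall>z\<in>D. F K z \<in> \<real>" using induced_by_unique[OF assms(2) _ assms(1)] by simp
next
  assume "\<forall>K. \<forall>z\<in>D. F K z \<in> \<real>"
  thus "f \<in> slice_preserving_fns D" unfolding slice_preserving_fns_def using assms(2) by blast
qed

section \<open>Continuity of the stem and real points\<close>

lemma linear_cl_coeff: "bounded_linear (\<lambda>a. cl_coeff a A)"
  unfolding linear_conv_bounded_linear[symmetric] by (rule linearI) simp_all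

lemma Reals_iff_cl_coeff: "a \<in> \<real> \<longleftrightarrow> a = of_real (cl_coeff a {})"
  by (auto simp: Reals_def of_real_def)

lemma stem_component_fun:
  fixes f :: "('m::{finite,linorder}, 'n::{finite,linorder}) slice_fun"
  assumes "symmetric D" "induced_by D f F" "\<And>l. J l \<in> imag_sphere"
  obtains c where "\<And>z. z \<in> D \<Longrightarrow> F K z = c * (\<Sum>S\<in>UNIV. sg S K *\<^sub>R f (slice_pt (flip S J) z))"
proof -
  obtain c where c: "\<And>F z. F K z = c * (\<Sum>S\<in>UNIV. sg S K *\<^sub>R stem_val (flip S J) F z)"
    using stem_component[of J K] assms(3) by blast
  have "F K z = c * (\<Sum>S\<in>UNIV. sg S K *\<^sub>R f (slice_pt (flip S J) z))" if z: "z \<in> D" for z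
    unfolding c[of F z] by (simp only: induced_by_val[where J = "flip S J" for S, OF assms(2,1) z flip_imag_sphere[where J = J, OF assms(3)]])
  thus ?thesis using that by blast
qed

lemma stem_continuous:
  fixes f :: "('m::{finite,linorder}, 'n::{finite,linorder}) slice_fun"
  assumes sym: "symmetric D" and F: "induced_by D f F" and f: "continuous_on (Omega D) f"
  shows "continuous_on D (F K)"
proof -
  define J :: "'n \<Rightarrow> 'm clifford" where "J = (\<lambda>_. cl_gen undefined)"
  have J: "J l \<in> imag_sphere" for l by (simp add: J_def cl_gen_imag_sphere)
  obtain c where c: "\<And>z. z \<in> D \<Longrightarrow> F K z = c * (\<Sum>S\<in>UNIV. sg S K *\<^sub>R f (slice_pt (flip S J) z))"
    using stem_component_fun[where J = J and K = K, OF sym F J] by blast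
  have lm: "bounded_linear (\<lambda>v. c * v :: 'm clifford)"
    unfolding linear_conv_bounded_linear[symmetric] by (rule linearI) (simp_all add: algebra_simps)
  have "continuous_on D (\<lambda>z. f (slice_pt (flip S J) z))" for S
  proof (rule continuous_on_compose2[OF f])
    show "continuous_on D (slice_pt (flip S J))"
      unfolding slice_pt_def slice_pt1_alt of_real_def
      by (intro continuous_on_vec_lambda continuous_intros)
    show "slice_pt (flip S J) ` D \<subseteq> Omega D"
      using slice_pt_in_Omega flip_imag_sphere[where J = J, OF J] by blast
  qed
  hence "continuous_on D (\<lambda>z. c * (\<Sum>S\<in>UNIV. sg S K *\<^sub>R f (slice_pt (flip S J) z)))"
    by (intro bounded_linear.continuous_on[OF lm] continuous_intros)
  thus ?thesis by (simp only: c cong: continuous_on_cong)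
qed

text \<open>F K minus its scalar part is continuous on D and vanishes on the dense set without real
  coordinates.\<close>

lemma slice_preserving_of_continuous:
  fixes f :: "('m::{finite,linorder}, 'n::{finite,linorder}) slice_fun"
  assumes D: "open D" "symmetric D" and F: "induced_by D f F" and f: "continuous_on (Omega D) f"
    and R: "\<forall>K. \<forall>x\<in>Omega (nonreal D UNIV). S_comp D UNIV K f x \<in> \<real>"
  shows "f \<in> slice_preserving_fns D"
  unfolding slice_preserving_iff[OF D(2) F]
proof (intro allI ballI)
  fix K z assume z: "z \<in> D"
  have "F K z - of_real (cl_coeff (F K z) {}) = 0"
  proof (rule continuous_zero_on_nonreal[OF D(1) _ _ z])
    show "continuous_on D (\<lambda>z. F K z - of_real (cl_coeff (F K z) {}))"
      by (intro continuous_intros bounded_linear.continuous_on[OF linear_cl_coeff] stem_continuous[OF D(2) F f])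
    show "F K z - of_real (cl_coeff (F K z) {}) = 0" if "z \<in> nonreal D UNIV" for z
      using R that unfolding S_comp_UNIV_real_iff[OF D(2) F] by (simp add: Reals_iff_cl_coeff)
  qed
  thus "F K z \<in> \<real>" unfolding Reals_iff_cl_coeff by simp
qed

subsection \<open>Calculus of continuously differentiable functions\<close>

lemma C1_on_cong_open:
  assumes "open S" "C1_on S f" "\<And>x. x \<in> S \<Longrightarrow> f x = g x"
  shows "C1_on S g"
proof -
  obtain f' where f': "\<forall>x\<in>S. (f has_derivative blinfun_apply (f' x)) (at x)" "continuous_on S f'"
    using assms(2) unfolding C1_on_def by blast
  have "(g has_derivative blinfun_apply (f' x)) (at x)" if "x \<in> S" for x
    using f'(1) that assms has_derivative_transform_within_open by blast
  thus ?thesis unfolding C1_on_def using f'(2) by blast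
qed

lemma C1_on_linear_left:
  assumes T: "bounded_linear T" and f: "C1_on S f"
  shows "C1_on S (\<lambda>x. T (f x))"
proof -
  obtain f' where f': "\<forall>x\<in>S. (f has_derivative blinfun_apply (f' x)) (at x)" "continuous_on S f'"
    using f unfolding C1_on_def by blast
  show ?thesis
    unfolding C1_on_def
  proof (intro exI[of _ "\<lambda>x. Blinfun T o\<^sub>L f' x"] conjI ballI)
    show "((\<lambda>x. T (f x)) has_derivative blinfun_apply (Blinfun T o\<^sub>L f' x)) (at x)" if "x \<in> S" for x
      using bounded_linear.has_derivative[OF T f'(1)[rule_format, OF that]]
      by (simp add: blinfun_compose.rep_eq bounded_linear_Blinfun_apply[OF T] o_def)
  qed (intro continuous_intros f')
qed

lemma C1_on_affine_right:
  assumes A: "bounded_linear A" and f: "C1_on D f" and E: "\<And>x. x \<in> E \<Longrightarrow> a + A x \<in> D"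
  shows "C1_on E (\<lambda>x. f (a + A x))"
proof -
  obtain f' where f': "\<forall>x\<in>D. (f has_derivative blinfun_apply (f' x)) (at x)" "continuous_on D f'"
    using f unfolding C1_on_def by blast
  show ?thesis
    unfolding C1_on_def
  proof (intro exI[of _ "\<lambda>x. f' (a + A x) o\<^sub>L Blinfun A"] conjI ballI)
    fix x assume x: "x \<in> E"
    have "((\<lambda>x. a + A x) has_derivative (\<lambda>d. 0 + A d)) (at x)"
      by (intro has_derivative_add has_derivative_const bounded_linear_imp_has_derivative A)
    from has_derivative_compose[OF this, of f "blinfun_apply (f' (a + A x))"] f'(1) E[OF x]
    show "((\<lambda>x. f (a + A x)) has_derivative blinfun_apply (f' (a + A x) o\<^sub>L Blinfun A)) (at x)"
      by (simp add: blinfun_compose.rep_eq bounded_linear_Blinfun_apply[OF A] o_def)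
  next
    have "continuous_on E (\<lambda>x. f' (a + A x))"
      by (rule continuous_on_compose2[OF f'(2)])
        (use E in \<open>auto intro!: continuous_intros bounded_linear.continuous_on[OF A]\<close>)
    thus "continuous_on E (\<lambda>x. f' (a + A x) o\<^sub>L Blinfun A)" by (intro continuous_intros)
  qed
qed

lemma C1_on_add:
  assumes "C1_on S f" "C1_on S g" shows "C1_on S (\<lambda>x. f x + g x)"
proof -
  obtain f' where f': "\<forall>x\<in>S. (f has_derivative blinfun_apply (f' x)) (at x)" "continuous_on S f'"
    using assms(1) unfolding C1_on_def by blast
  obtain g' where g': "\<forall>x\<in>S. (g has_derivative blinfun_apply (g' x)) (at x)" "continuous_on S g'"
    using assms(2) unfolding C1_on_def by blast
  show ?thesis
    unfolding C1_on_def
  proof (intro exI[of _ "\<lambda>x. f' x + g' x"] conjI ballI)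
    show "((\<lambda>x. f x + g x) has_derivative blinfun_apply (f' x + g' x)) (at x)" if "x \<in> S" for x
      using has_derivative_add f'(1) g'(1) that by (simp add: plus_blinfun.rep_eq)
  qed (intro continuous_intros f' g')
qed

lemma C1_on_0: "C1_on S (\<lambda>x. 0)"
  unfolding C1_on_def by (intro exI[of _ "\<lambda>_. 0"]) (auto simp: zero_blinfun.rep_eq)

lemma C1_on_sum:
  assumes "\<And>i. i \<in> I \<Longrightarrow> C1_on S (f i)"
  shows "C1_on S (\<lambda>x. \<Sum>i\<in>I. f i x)"
  using assms
proof (induction I rule: infinite_finite_induct)
  case (insert i I)
  thus ?case using C1_on_add[of S "f i" "\<lambda>x. \<Sum>i\<in>I. f i x"] by simp
qed (simp_all add: C1_on_0)

lemma C1_on_derivative: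
  assumes "C1_on S f"
  obtains f' where "\<And>x. x \<in> S \<Longrightarrow> (f has_derivative blinfun_apply (f' x)) (at x)" "continuous_on S f'"
    "\<And>x. x \<in> S \<Longrightarrow> frechet_derivative f (at x) = blinfun_apply (f' x)"
proof -
  obtain f' where f': "\<forall>x\<in>S. (f has_derivative blinfun_apply (f' x)) (at x)" "continuous_on S f'"
    using assms unfolding C1_on_def by blast
  thus ?thesis using that[of f'] frechet_derivative_at by force
qed

text \<open>The regularity condition exactly as it occurs in \<open>is_slice_regular1\<close>, with
  A and B in the places of G0 and G1.\<close>

definition CR_pair :: "complex set \<Rightarrow> (complex \<Rightarrow> 'b::real_normed_vector) \<Rightarrow> (complex \<Rightarrow> 'b) \<Rightarrow> bool" where
  "CR_pair E A B \<longleftrightarrow> C1_on E A \<and> C1_on E B \<and>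
     (\<forall>w\<in>E. frechet_derivative A (at w) 1 = frechet_derivative B (at w) \<i> \<and>
            frechet_derivative A (at w) \<i> = - frechet_derivative B (at w) 1)"

lemma CR_pair_linear:
  assumes T: "bounded_linear T" and AB: "CR_pair E A B"
  shows "CR_pair E (\<lambda>w. T (A w)) (\<lambda>w. T (B w))"
proof -
  have fd: "frechet_derivative (\<lambda>w. T (f w)) (at w) = (\<lambda>v. T (frechet_derivative f (at w) v))"
    if "C1_on E f" "w \<in> E" for f w
  proof -
    obtain f' where f': "\<And>x. x \<in> E \<Longrightarrow> (f has_derivative blinfun_apply (f' x)) (at x)"
      "\<And>x. x \<in> E \<Longrightarrow> frechet_derivative f (at x) = blinfun_apply (f' x)"
      using C1_on_derivative[OF \<open>C1_on E f\<close>] by metis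
    show ?thesis
      using frechet_derivative_at[OF bounded_linear.has_derivative[OF T f'(1)[OF that(2)]]] f'(2)[OF that(2)]
      by simp
  qed
  show ?thesis
    using AB unfolding CR_pair_def
    by (auto simp: fd C1_on_linear_left[OF T] bounded_linear.linear[OF T, THEN linear_neg])
qed

lemma CR_pair_add:
  assumes "CR_pair E A B" "CR_pair E A' B'"
  shows "CR_pair E (\<lambda>w. A w + A' w) (\<lambda>w. B w + B' w)"
proof -
  have fd: "frechet_derivative (\<lambda>w. f w + g w) (at w) v = frechet_derivative f (at w) v + frechet_derivative g (at w) v"
    if "C1_on E f" "C1_on E g" "w \<in> E" for f g :: "complex \<Rightarrow> 'a" and w v
  proof -
    have "f differentiable (at w)" "g differentiable (at w)"
      using that unfolding C1_on_def differentiable_def by blast+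
    hence "(f has_derivative frechet_derivative f (at w)) (at w)" "(g has_derivative frechet_derivative g (at w)) (at w)"
      by (simp_all add: frechet_derivative_works)
    from fun_cong[OF frechet_derivative_at[OF has_derivative_add[OF this]], of v] show ?thesis by simp
  qed
  show ?thesis using assms unfolding CR_pair_def by (auto simp: fd C1_on_add)
qed

lemma CR_pair_0: "CR_pair E (\<lambda>w. 0) (\<lambda>w. 0)"
  by (simp add: CR_pair_def C1_on_0)

lemma CR_pair_sum:
  assumes "\<And>i. i \<in> I \<Longrightarrow> CR_pair E (A i) (B i)"
  shows "CR_pair E (\<lambda>w. \<Sum>i\<in>I. A i w) (\<lambda>w. \<Sum>i\<in>I. B i w)"
  using assms
proof (induction I rule: infinite_finite_induct)
  case (insert i I)
  thus ?case using CR_pair_add[of E "A i" "B i" "\<lambda>w. \<Sum>i\<in>I. A i w" "\<lambda>w. \<Sum>i\<in>I. B i w"] by simp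
qed (simp_all add: CR_pair_0)

lemma CR_pair_cong:
  assumes E: "open E" and AB: "CR_pair E A B" and eq: "\<And>w. w \<in> E \<Longrightarrow> A w = A' w" "\<And>w. w \<in> E \<Longrightarrow> B w = B' w"
  shows "CR_pair E A' B'"
proof -
  have fd: "frechet_derivative g (at w) = frechet_derivative f (at w)"
    if "C1_on E f" "w \<in> E" "\<And>w. w \<in> E \<Longrightarrow> f w = g w" for f g :: "complex \<Rightarrow> 'a" and w
  proof -
    obtain f' where f': "\<And>x. x \<in> E \<Longrightarrow> (f has_derivative blinfun_apply (f' x)) (at x)"
      "\<And>x. x \<in> E \<Longrightarrow> frechet_derivative f (at x) = blinfun_apply (f' x)"
      using C1_on_derivative[OF \<open>C1_on E f\<close>] by metis
    have "(g has_derivative blinfun_apply (f' w)) (at w)"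
      using has_derivative_transform_within_open[OF f'(1)[OF that(2)] E that(2)] that(3) by blast
    from frechet_derivative_at[OF this] show ?thesis using f'(2)[OF that(2)] by simp
  qed
  have "C1_on E A" "C1_on E B" using AB by (simp_all add: CR_pair_def)
  note C = this
  have f: "frechet_derivative A' (at w) = frechet_derivative A (at w)"
    "frechet_derivative B' (at w) = frechet_derivative B (at w)" if "w \<in> E" for w
    using fd[OF C(1) that eq(1)] fd[OF C(2) that eq(2)] by auto
  have "C1_on E A'" "C1_on E B'"
    using C1_on_cong_open[OF E C(1) eq(1)] C1_on_cong_open[OF E C(2) eq(2)] by auto
  thus ?thesis using AB by (simp add: CR_pair_def f)
qed

lemma CR_pair_subset: "CR_pair E A B \<Longrightarrow> E' \<subseteq> E \<Longrightarrow> CR_pair E' A B"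
  unfolding CR_pair_def C1_on_def by (meson continuous_on_subset subsetD)

text \<open>The differential of the formal sum A + i B is multiplication by a + i b. Only
  differentiability at each point is recorded, since holomorphy gives everything else.\<close>

definition CR_on :: "complex set \<Rightarrow> (complex \<Rightarrow> 'b::real_normed_vector) \<Rightarrow> (complex \<Rightarrow> 'b) \<Rightarrow> bool" where
  "CR_on E A B \<longleftrightarrow> (\<forall>w\<in>E. \<exists>a b. (A has_derivative (\<lambda>d. Re d *\<^sub>R a - Im d *\<^sub>R b)) (at w) \<and>
     (B has_derivative (\<lambda>d. Re d *\<^sub>R b + Im d *\<^sub>R a)) (at w))"

lemma CR_pair_imp_CR_on:
  assumes "CR_pair E A B" shows "CR_on E A B"
  unfolding CR_on_def
proof
  fix w assume w: "w \<in> E"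
  have C: "C1_on E A" "C1_on E B" using assms by (simp_all add: CR_pair_def)
  obtain A' where A': "\<And>x. x \<in> E \<Longrightarrow> (A has_derivative blinfun_apply (A' x)) (at x)"
    "\<And>x. x \<in> E \<Longrightarrow> frechet_derivative A (at x) = blinfun_apply (A' x)"
    using C1_on_derivative[OF C(1)] by metis
  obtain B' where B': "\<And>x. x \<in> E \<Longrightarrow> (B has_derivative blinfun_apply (B' x)) (at x)"
    "\<And>x. x \<in> E \<Longrightarrow> frechet_derivative B (at x) = blinfun_apply (B' x)"
    using C1_on_derivative[OF C(2)] by metis
  have exp: "blinfun_apply T d = Re d *\<^sub>R blinfun_apply T 1 + Im d *\<^sub>R blinfun_apply T \<i>" for T :: "complex \<Rightarrow>\<^sub>L 'a" and d
  proof -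
    have "d = Re d *\<^sub>R 1 + Im d *\<^sub>R \<i>" by (simp add: complex_eq_iff)
    hence "blinfun_apply T d = blinfun_apply T (Re d *\<^sub>R 1 + Im d *\<^sub>R \<i>)" by simp
    thus ?thesis by (simp add: blinfun.add_right blinfun.scaleR_right)
  qed
  have cr: "A' w 1 = B' w \<i>" "A' w \<i> = - B' w 1"
    using assms w A'(2) B'(2) unfolding CR_pair_def by simp_all
  show "\<exists>a b. (A has_derivative (\<lambda>d. Re d *\<^sub>R a - Im d *\<^sub>R b)) (at w) \<and>
     (B has_derivative (\<lambda>d. Re d *\<^sub>R b + Im d *\<^sub>R a)) (at w)"
  proof (rule exI[of _ "A' w 1"], rule exI[of _ "B' w 1"], rule conjI)
    have "(\<lambda>d. Re d *\<^sub>R A' w 1 - Im d *\<^sub>R B' w 1) = blinfun_apply (A' w)"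
      by (rule ext, subst exp[of "A' w"]) (simp add: cr)
    thus "(A has_derivative (\<lambda>d. Re d *\<^sub>R A' w 1 - Im d *\<^sub>R B' w 1)) (at w)" using A'(1)[OF w] by simp
    have "(\<lambda>d. Re d *\<^sub>R B' w 1 + Im d *\<^sub>R A' w 1) = blinfun_apply (B' w)"
      by (rule ext, subst exp[of "B' w"]) (simp add: cr)
    thus "(B has_derivative (\<lambda>d. Re d *\<^sub>R B' w 1 + Im d *\<^sub>R A' w 1)) (at w)" using B'(1)[OF w] by simp
  qed
qed

text \<open>A real functional T turns the pair into the complex function T A + i T B, with complex
  derivative T a + i T b.\<close>

lemma CR_on_field_differentiable:
  assumes AB: "CR_on E A B" and w: "w \<in> E" and T: "bounded_linear T"
  shows "(\<lambda>w. Complex (T (A w)) (T (B w))) field_differentiable (at w)"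
proof -
  obtain a b where ab: "(A has_derivative (\<lambda>d. Re d *\<^sub>R a - Im d *\<^sub>R b)) (at w)"
    "(B has_derivative (\<lambda>d. Re d *\<^sub>R b + Im d *\<^sub>R a)) (at w)"
    using AB w unfolding CR_on_def by blast
  have lin: "linear T" by (rule bounded_linear.linear[OF T])
  have "((\<lambda>w. of_real (T (A w)) + \<i> * of_real (T (B w))) has_derivative
      (\<lambda>d. of_real (T (Re d *\<^sub>R a - Im d *\<^sub>R b)) + \<i> * of_real (T (Re d *\<^sub>R b + Im d *\<^sub>R a)))) (at w)"
    by (intro has_derivative_add has_derivative_mult_right has_derivative_of_real
        bounded_linear.has_derivative[OF T] ab)
  also have "(\<lambda>d. of_real (T (Re d *\<^sub>R a - Im d *\<^sub>R b)) + \<i> * of_real (T (Re d *\<^sub>R b + Im d *\<^sub>R a))) =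
      (*) (Complex (T a) (T b))"
    by (rule ext) (simp add: complex_eq_iff linear_diff[OF lin] linear_add[OF lin] linear_scale[OF lin] algebra_simps)
  finally show ?thesis
    unfolding field_differentiable_def has_field_derivative_def Complex_eq by blast
qed

subsection \<open>Slice regularity along sections\<close>

definition regular_stem :: "(complex ^ 'n::{finite,linorder}) set \<Rightarrow> ('m::{finite,linorder}, 'n) stem \<Rightarrow> bool" where
  "regular_stem D F \<longleftrightarrow> (\<forall>K. C1_on D (F K)) \<and>
     (\<forall>z\<in>D. \<forall>h K. h \<notin> K \<longrightarrow>
        frechet_derivative (F K) (at z) (axis h 1) =
          frechet_derivative (F (insert h K)) (at z) (axis h \<i>) \<and>
        frechet_derivative (F K) (at z) (axis h \<i>) =
          - frechet_derivative (F (insert h K)) (at z) (axis h 1))"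

lemma slice_regular_fns_alt: "slice_regular_fns D = {f. \<exists>F. induced_by D f F \<and> regular_stem D F}"
  unfolding slice_regular_fns_def regular_stem_def ..

lemma bounded_linear_axis: "bounded_linear (\<lambda>w :: complex. axis h w :: complex ^ 'n::finite)"
  unfolding linear_conv_bounded_linear[symmetric]
  by (rule linearI) (auto simp: vec_eq_iff axis_def)

lemma subst_at_affine: "subst_at h z w = subst_at h z 0 + axis h (w :: complex)"
  by (simp add: vec_eq_iff subst_at_nth axis_def)

lemma subst_at_has_derivative:
  fixes z :: "complex ^ 'n::finite"
  assumes "(f has_derivative f') (at (subst_at h z w))"
  shows "((\<lambda>w. f (subst_at h z w)) has_derivative (\<lambda>d. f' (axis h d))) (at w)"
proof -
  have "((\<lambda>w. subst_at h z 0 + axis h w) has_derivative (\<lambda>d. 0 + axis h d)) (at w)"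
    by (intro has_derivative_add has_derivative_const bounded_linear_imp_has_derivative bounded_linear_axis)
  hence "((\<lambda>w. subst_at h z w) has_derivative (\<lambda>d. axis h d)) (at w)"
    by (simp only: subst_at_affine[symmetric] add_0_left)
  from has_derivative_compose[OF this assms] show ?thesis .
qed

lemma C1_on_section: "C1_on D f \<Longrightarrow> C1_on (sec D h z) (\<lambda>w. f (subst_at h z w))"
  by (subst subst_at_affine, rule C1_on_affine_right[OF bounded_linear_axis])
    (auto simp: sec_def subst_at_affine[of h z, symmetric])

lemma regular_stem_section:
  assumes F: "regular_stem D F" and h: "h \<notin> K"
  shows "CR_pair (sec D h z) (\<lambda>w. F K (subst_at h z w)) (\<lambda>w. F (insert h K) (subst_at h z w))"
proof -
  have C: "C1_on D (F K)" for K using F by (simp add: regular_stem_def)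
  have fd: "frechet_derivative (\<lambda>w. F K (subst_at h z w)) (at w) = (\<lambda>d. frechet_derivative (F K) (at (subst_at h z w)) (axis h d))"
    if "w \<in> sec D h z" for K w
  proof -
    have "F K differentiable (at (subst_at h z w))"
      using C[of K] that unfolding C1_on_def differentiable_def sec_def by blast
    hence "(F K has_derivative frechet_derivative (F K) (at (subst_at h z w))) (at (subst_at h z w))"
      by (simp add: frechet_derivative_works)
    from frechet_derivative_at[OF subst_at_has_derivative[OF this]] show ?thesis by simp
  qed
  show ?thesis
    unfolding CR_pair_def
  proof (intro conjI ballI C1_on_section C)
    fix w assume w: "w \<in> sec D h z"
    hence "subst_at h z w \<in> D" by (simp add: sec_def)
    thus "frechet_derivative (\<lambda>w. F K (subst_at h z w)) (at w) 1 =
        frechet_derivative (\<lambda>w. F (insert h K) (subst_at h z w)) (at w) \<i>"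
      "frechet_derivative (\<lambda>w. F K (subst_at h z w)) (at w) \<i> =
        - frechet_derivative (\<lambda>w. F (insert h K) (subst_at h z w)) (at w) 1"
      using F h unfolding regular_stem_def by (simp_all add: fd[OF w])
  qed
qed

lemma linear_clifford_mult_scaleR: "bounded_linear (\<lambda>v. c * (r *\<^sub>R v) :: 'm::{finite,linorder} clifford)"
  unfolding linear_conv_bounded_linear[symmetric] by (rule linearI) (simp_all add: algebra_simps)

text \<open>As p is outside H, the coordinates in H do not change along the section, and the
  component is a combination of the F A with constant real coefficients.\<close>

lemma S_stem_section:
  assumes "K \<subseteq> H" "L \<subseteq> - H" "p \<notin> H"
  shows "S_stem H K F L (subst_at p z w) = (\<Sum>M\<in>Pow K. (inverse (\<Prod>h\<in>H. Im (z $ h)) *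
    ((\<Prod>l\<in>K - M. Re (z $ l)) * (\<Prod>l\<in>M. Im (z $ l)))) *\<^sub>R F (L \<union> (H - M)) (subst_at p z w))"
proof -
  have n: "subst_at p z w $ l = z $ l" if "l \<in> H" for l using that assms(3) by (auto simp: subst_at_nth)
  have "(\<Prod>h\<in>H. Im (subst_at p z w $ h)) = (\<Prod>h\<in>H. Im (z $ h))" by (intro prod.cong) (auto simp: n)
  moreover have "(\<Prod>l\<in>K - M. Re (subst_at p z w $ l)) = (\<Prod>l\<in>K - M. Re (z $ l))" for M
    using assms(1) by (intro prod.cong) (auto simp: n)
  moreover have "(\<Prod>l\<in>M. Im (subst_at p z w $ l)) = (\<Prod>l\<in>M. Im (z $ l))" if "M \<in> Pow K" for M
    using assms(1) that by (intro prod.cong) (auto simp: n)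
  ultimately show ?thesis
    unfolding S_stem_explicit[OF assms(1,2)] scaleR_sum_right
    by (intro sum.cong refl) simp
qed

lemma S_stem_section_CR:
  fixes F :: "('m::{finite,linorder}, 'n::{finite,linorder}) stem"
  assumes F: "\<And>A. p \<notin> A \<Longrightarrow> CR_pair E (\<lambda>w. F A (subst_at p z w)) (\<lambda>w. F (insert p A) (subst_at p z w))"
    and "K \<subseteq> H" "p \<notin> H"
  shows "CR_pair E (sec0 J (S_stem H K F) p z) (sec1 J (S_stem H K F) p z)"
  unfolding sec0_def[abs_def] sec1_def[abs_def]
proof (rule CR_pair_sum)
  fix L assume "L \<in> Pow {p<..}"
  hence pL: "p \<notin> L" by auto
  let ?T = "\<lambda>v :: 'm clifford. ordered_prod J L * (1 *\<^sub>R v)"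
  have "CR_pair E (\<lambda>w. S_stem H K F L (subst_at p z w)) (\<lambda>w. S_stem H K F (insert p L) (subst_at p z w))"
  proof (cases "L \<subseteq> - H")
    case True
    hence True': "insert p L \<subseteq> - H" using assms(3) by auto
    show ?thesis
      unfolding S_stem_section[OF assms(2) True assms(3)] S_stem_section[OF assms(2) True' assms(3)]
    proof (rule CR_pair_sum)
      fix M assume "M \<in> Pow K"
      let ?r = "inverse (\<Prod>h\<in>H. Im (z $ h)) * ((\<Prod>l\<in>K - M. Re (z $ l)) * (\<Prod>l\<in>M. Im (z $ l)))"
      have "insert p L \<union> (H - M) = insert p (L \<union> (H - M))" by auto
      thus "CR_pair E (\<lambda>w. ?r *\<^sub>R F (L \<union> (H - M)) (subst_at p z w))
          (\<lambda>w. ?r *\<^sub>R F (insert p L \<union> (H - M)) (subst_at p z w))"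
        using CR_pair_linear[OF linear_clifford_mult_scaleR[of 1 ?r] F[of "L \<union> (H - M)"]] pL assms(3) by simp
    qed
  next
    case False
    hence "\<not> insert p L \<subseteq> - H" by auto
    thus ?thesis using False by (simp add: S_stem_support CR_pair_0)
  qed
  from CR_pair_linear[OF linear_clifford_mult_scaleR[of "ordered_prod J L" 1] this]
  show "CR_pair E (\<lambda>w. ordered_prod J L * S_stem H K F L (subst_at p z w))
      (\<lambda>w. ordered_prod J L * S_stem H K F (insert p L) (subst_at p z w))" by simp
qed

lemma S_comp_regular_at_min:
  fixes f :: "('m::{finite,linorder}, 'n::{finite,linorder}) slice_fun"
  assumes D: "open D" "symmetric D" and F: "induced_by D f F" and H: "H \<noteq> UNIV" and K: "K \<subseteq> H"
    and reg: "regular_stem D F"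
  shows "S_comp D H K f \<in> slice_regular_fns_at (Min (- H)) (nonreal D H)"
  unfolding slice_regular_fns_at_def
proof (intro CollectI conjI ballI S_comp_slice_fns[OF D(2) F])
  let ?p = "Min (- H)"
  have p: "?p \<notin> H" using Min_in[of "- H"] H by auto
  fix y :: "'m clifford ^ 'n::{finite,linorder}" assume "y \<in> Omega (nonreal D H)"
  then obtain J z where y: "y = slice_pt J z" "z \<in> nonreal D H" "\<And>l. J l \<in> imag_sphere"
    using Omega_cases by blast
  let ?E = "sec (nonreal D H) ?p z"
  have "?E \<subseteq> sec D ?p z" using nonreal_subset[of D H] by (auto simp: sec_def)
  hence CR: "CR_pair ?E (sec0 J (S_stem H K F) ?p z) (sec1 J (S_stem H K F) ?p z)"
    by (intro S_stem_section_CR K p CR_pair_subset[OF regular_stem_section[OF reg]])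
  have "section_dom (nonreal D H) ?p y = Omega1 ?E"
    unfolding y(1) by (rule section_dom_eq[where J = J, OF symmetric_nonreal[OF D(2)] y(2,3)])
  moreover have "slice_pair1 ?E (\<lambda>x. S_comp D H K f (subst_at ?p y x))
      (sec0 J (S_stem H K F) ?p z) (sec1 J (S_stem H K F) ?p z)"
    unfolding y(1) by (rule S_comp_pair_at_min[where J = J, OF D F H y(2,3)])
  ultimately show "is_slice_regular1 (section_dom (nonreal D H) ?p y) (\<lambda>x. S_comp D H K f (subst_at ?p y x))"
    using CR unfolding is_slice_regular1_def CR_pair_def by blast
qed

text \<open>Adding the values at I and - I isolates G0; then G1 follows because I is
  invertible.\<close>

lemma slice_pair1_unique:
  assumes G: "slice_pair1 E g G0 G1" and H: "slice_pair1 E' g H0 H1"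
    and eq: "Omega1 E = (Omega1 E' :: 'm::{finite,linorder} clifford set)"
  shows "E = E'" "w \<in> E \<Longrightarrow> G0 w = (H0 w :: 'm clifford)" "w \<in> E \<Longrightarrow> G1 w = H1 w"
proof -
  show E: "E = E'" by (rule Omega1_inj[OF eq]) (use G H in \<open>auto simp: slice_pair1_def\<close>)
  define I :: "'m clifford" where "I = cl_gen undefined"
  have I: "I \<in> imag_sphere" "- I \<in> imag_sphere"
    by (simp_all add: I_def cl_gen_imag_sphere imag_sphere_uminus)
  assume w: "w \<in> E"
  have e: "G0 w + J * G1 w = H0 w + J * H1 w" if "J \<in> imag_sphere" for J
    using G H w that E unfolding slice_pair1_def by metis
  have "2 *\<^sub>R G0 w = (G0 w + I * G1 w) + (G0 w + (- I) * G1 w)" by (simp add: scaleR_2)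
  also have "\<dots> = (H0 w + I * H1 w) + (H0 w + (- I) * H1 w)" by (simp only: e[OF I(1)] e[OF I(2)])
  also have "\<dots> = 2 *\<^sub>R H0 w" by (simp add: scaleR_2)
  finally show 0: "G0 w = H0 w" by simp
  have "I * G1 w = I * H1 w" using e[OF I(1)] 0 by simp
  hence "(I * I) * G1 w = (I * I) * H1 w" by (simp add: mult.assoc)
  thus "G1 w = H1 w" by (simp add: imag_sphere_square[OF I(1)])
qed

subsection \<open>From slice regular components to slice regularity\<close>

lemma S_comp_regular_imp_pair:
  fixes f :: "('m::{finite,linorder}, 'n::{finite,linorder}) slice_fun"
  assumes D: "open D" "symmetric D" and F: "induced_by D f F" and H: "H \<noteq> UNIV"
    and reg: "S_comp D H K f \<in> slice_regular_fns_at (Min (- H)) (nonreal D H)"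
    and z: "z \<in> nonreal D H" and J: "\<And>l. J l \<in> imag_sphere"
  shows "CR_pair (sec (nonreal D H) (Min (- H)) z) (sec0 J (S_stem H K F) (Min (- H)) z)
    (sec1 J (S_stem H K F) (Min (- H)) z)"
proof -
  let ?p = "Min (- H)" and ?N = "nonreal D H"
  let ?E = "sec ?N ?p z"
  have "is_slice_regular1 (section_dom ?N ?p (slice_pt J z)) (\<lambda>x. S_comp D H K f (subst_at ?p (slice_pt J z) x))"
    using reg slice_pt_in_Omega[where J = J, OF z J] unfolding slice_regular_fns_at_def by blast
  then obtain E G0 G1 where E: "section_dom ?N ?p (slice_pt J z) = Omega1 E"
    and G: "slice_pair1 E (\<lambda>x. S_comp D H K f (subst_at ?p (slice_pt J z) x)) G0 G1"
    and CR: "CR_pair E G0 G1"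
    unfolding is_slice_regular1_def CR_pair_def by blast
  have S: "slice_pair1 ?E (\<lambda>x. S_comp D H K f (subst_at ?p (slice_pt J z) x))
      (sec0 J (S_stem H K F) ?p z) (sec1 J (S_stem H K F) ?p z)"
    by (rule S_comp_pair_at_min[where J = J, OF D F H z J])
  have "Omega1 E = (Omega1 ?E :: 'm clifford set)"
    using E section_dom_eq[where J = J, OF symmetric_nonreal[OF D(2)] z J] by simp
  note u = slice_pair1_unique[OF G S this]
  have "open E" using G by (simp add: slice_pair1_def)
  from CR_pair_cong[OF this CR u(2) u(3)] show ?thesis unfolding u(1) .
qed

text \<open>The functions \<open>sec0\<close> and \<open>sec1\<close> mix all L with their units.
  They are the values of F0 and F1, the parts of F without and with p cut off outside
  \<open>{p<..}\<close>, so sign flips of J separate the individual L.\<close>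

lemma S_stem_pair_of_sections:
  fixes F :: "('m::{finite,linorder}, 'n::{finite,linorder}) stem"
  assumes CR: "\<And>J. (\<And>l. J l \<in> imag_sphere) \<Longrightarrow> CR_pair E (sec0 J F p z) (sec1 J F p z)"
    and L: "L \<subseteq> {p<..}" and E: "open E"
  shows "CR_pair E (\<lambda>w. F L (subst_at p z w)) (\<lambda>w. F (insert p L) (subst_at p z w))"
proof -
  define J :: "'n \<Rightarrow> 'm clifford" where "J = (\<lambda>_. cl_gen undefined)"
  have J: "J l \<in> imag_sphere" for l by (simp add: J_def cl_gen_imag_sphere)
  obtain c where c: "\<And>F z. F L z = c * (\<Sum>S\<in>UNIV. sg S L *\<^sub>R stem_val (flip S J) F z)"
    using stem_component[of J L] J by blast
  define F0 where "F0 L' z = (if L' \<subseteq> {p<..} then F L' z else 0)" for L' z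
  define F1 where "F1 L' z = (if L' \<subseteq> {p<..} then F (insert p L') z else 0)" for L' z
  have s0: "sec0 J F p z w = stem_val J F0 (subst_at p z w)" for J and w
    unfolding sec0_def stem_val_def
    by (rule sum.mono_neutral_cong_left) (auto simp: F0_def)
  have s1: "sec1 J F p z w = stem_val J F1 (subst_at p z w)" for J and w
    unfolding sec1_def stem_val_def
    by (rule sum.mono_neutral_cong_left) (auto simp: F1_def)
  have "CR_pair E (\<lambda>w. \<Sum>S\<in>UNIV. c * (sg S L *\<^sub>R sec0 (flip S J) F p z w))
      (\<lambda>w. \<Sum>S\<in>UNIV. c * (sg S L *\<^sub>R sec1 (flip S J) F p z w))"
    by (intro CR_pair_sum CR_pair_linear[OF linear_clifford_mult_scaleR] CR flip_imag_sphere J)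
  moreover have "(\<Sum>S\<in>UNIV. c * (sg S L *\<^sub>R sec0 (flip S J) F p z w)) = F L (subst_at p z w)" for w
    using c[of F0 "subst_at p z w"] L by (simp add: s0 sum_distrib_left F0_def)
  moreover have "(\<Sum>S\<in>UNIV. c * (sg S L *\<^sub>R sec1 (flip S J) F p z w)) = F (insert p L) (subst_at p z w)" for w
    using c[of F1 "subst_at p z w"] L by (simp add: s1 sum_distrib_left F1_def)
  ultimately show ?thesis by simp
qed

text \<open>\<open>S_stem_decomposition\<close> recovers F B and F (insert p B) from the components
  with the same coefficients c K. These involve only coordinates before p, hence are constant along
  the section, and the Cauchy-Riemann equations carry over.\<close>

lemma stem_pair_of_components:
  fixes f :: "('m::{finite,linorder}, 'n::{finite,linorder}) slice_fun"
  assumes D: "open D" "symmetric D" and F: "induced_by D f F"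
    and reg: "\<And>K. K \<subseteq> {..<p} \<Longrightarrow> S_comp D {..<p} K f \<in> slice_regular_fns_at p (nonreal D {..<p})"
    and z: "z \<in> nonreal D {..<p}" and A: "p \<notin> B"
  shows "CR_pair (sec (nonreal D {..<p}) p z) (\<lambda>w. F B (subst_at p z w)) (\<lambda>w. F (insert p B) (subst_at p z w))"
proof -
  let ?H = "{..<p}"
  let ?N = "nonreal D ?H"
  let ?E = "sec ?N p z"
  have H: "?H \<noteq> UNIV" by auto
  have min: "Min (- ?H) = p" by (rule Min_eqI) auto
  have E: "open ?E" by (intro open_sec open_nonreal D)
  have S: "CR_pair ?E (\<lambda>w. S_stem ?H K F L (subst_at p z w)) (\<lambda>w. S_stem ?H K F (insert p L) (subst_at p z w))"
    if "K \<subseteq> ?H" "L \<subseteq> {p<..}" for K L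
  proof (rule S_stem_pair_of_sections[OF _ that(2) E])
    fix J :: "'n \<Rightarrow> 'm clifford" assume J: "\<And>l. J l \<in> imag_sphere"
    show "CR_pair ?E (sec0 J (S_stem ?H K F) p z) (sec1 J (S_stem ?H K F) p z)"
      using S_comp_regular_imp_pair[where J = J and H = ?H and K = K, OF D F H _ z J] reg[OF that(1)]
      unfolding min by blast
  qed
  define L where "L = B - ?H"
  have L: "L \<subseteq> {p<..}" "L \<subseteq> - ?H" "insert p L \<subseteq> - ?H"
    using A by (auto simp: L_def not_less order.strict_iff_order)
  define c where "c K = (- 1) ^ card (?H - K) * ((\<Prod>l\<in>?H - K - B \<inter> ?H. Re (z $ l)) * (\<Prod>l\<in>B \<inter> ?H. - Im (z $ l)))" for K
  have rep: "(\<Sum>K\<in>Pow (?H - B \<inter> ?H). 1 * (c K *\<^sub>R S_stem ?H K F L' (subst_at p z w))) = F (B \<inter> ?H \<union> L') (subst_at p z w)"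
    if "w \<in> ?E" "L' \<subseteq> - ?H" for w L'
  proof -
    have n: "subst_at p z w $ l = z $ l" if "l \<in> ?H" for l using that by (auto simp: subst_at_nth)
    have cK: "c K = (- 1) ^ card (?H - K) * ((\<Prod>l\<in>?H - K - B \<inter> ?H. Re (subst_at p z w $ l)) *
        (\<Prod>l\<in>B \<inter> ?H. - Im (subst_at p z w $ l)))" for K
      unfolding c_def by (intro arg_cong2[where f = "(*)"] prod.cong refl) (auto simp: n)
    have "subst_at p z w \<in> ?N" using that(1) by (simp add: sec_def)
    from S_stem_decomposition[OF this _ that(2), of "B \<inter> ?H" F] show ?thesis by (simp add: cK)
  qed
  have "CR_pair ?E (\<lambda>w. \<Sum>K\<in>Pow (?H - B \<inter> ?H). 1 * (c K *\<^sub>R S_stem ?H K F L (subst_at p z w)))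
      (\<lambda>w. \<Sum>K\<in>Pow (?H - B \<inter> ?H). 1 * (c K *\<^sub>R S_stem ?H K F (insert p L) (subst_at p z w)))"
    by (intro CR_pair_sum CR_pair_linear[OF linear_clifford_mult_scaleR] S L(1)) auto
  hence "CR_pair ?E (\<lambda>w. F (B \<inter> ?H \<union> L) (subst_at p z w)) (\<lambda>w. F (B \<inter> ?H \<union> insert p L) (subst_at p z w))"
    by (rule CR_pair_cong[OF E]) (use rep L in auto)
  moreover have "B \<inter> ?H \<union> L = B" "B \<inter> ?H \<union> insert p L = insert p B" by (auto simp: L_def)
  ultimately show ?thesis by simp
qed

text \<open>The stem components are the real combinations of the values of one complex function at the
  partial conjugates of a point.\<close>

definition cx_stem :: "('m::{finite,linorder}, 'n::finite) stem \<Rightarrow> 'm set \<Rightarrow> complex ^ 'n \<Rightarrow> complex" where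
  "cx_stem F C z = (\<Sum>K\<in>UNIV. \<i> ^ card K * of_real (cl_coeff (F K z) C))"

lemma sum_insert_split:
  fixes g :: "'n::finite set \<Rightarrow> 'a::comm_monoid_add"
  shows "(\<Sum>K\<in>UNIV. g K) = (\<Sum>K\<in>{K. q \<notin> K}. g K + g (insert q K))"
proof -
  have "(\<Sum>K\<in>UNIV. g K) = (\<Sum>K\<in>{K. q \<notin> K}. g K) + (\<Sum>K\<in>insert q ` {K. q \<notin> K}. g K)"
  proof -
    have "K \<in> insert q ` {K. q \<notin> K}" if "q \<in> K" for K
      by (rule image_eqI[of _ _ "K - {q}"]) (use that in auto)
    hence "UNIV = {K. q \<notin> K} \<union> insert q ` {K. q \<notin> K}" by auto
    thus ?thesis using sum.union_disjoint[of "{K. q \<notin> K}" "insert q ` {K. q \<notin> K}" g] by auto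
  qed
  also have "(\<Sum>K\<in>insert q ` {K. q \<notin> K}. g K) = (\<Sum>K\<in>{K. q \<notin> K}. g (insert q K))"
    by (subst sum.reindex) (auto simp: inj_on_def o_def insert_eq_iff)
  finally show ?thesis by (simp add: sum.distrib)
qed

text \<open>Pairing K with insert q K gives terms i^|K| (F_K + i F_(insert q K)), each of which is
  holomorphic in the variable q by the Cauchy-Riemann equations.\<close>

lemma cx_stem_field_differentiable:
  fixes F :: "('m::{finite,linorder}, 'n::{finite,linorder}) stem"
  assumes "\<And>B. q \<notin> B \<Longrightarrow> CR_pair E (\<lambda>w. F B (subst_at q z w)) (\<lambda>w. F (insert q B) (subst_at q z w))" "w \<in> E"
  shows "(\<lambda>w. cx_stem F C (subst_at q z w)) field_differentiable (at w)"
proof -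
  have "cx_stem F C (subst_at q z w) = (\<Sum>K\<in>{K. q \<notin> K}. \<i> ^ card K *
      Complex (cl_coeff (F K (subst_at q z w)) C) (cl_coeff (F (insert q K) (subst_at q z w)) C))" for w
    unfolding cx_stem_def sum_insert_split[of _ q]
    by (intro sum.cong refl) (simp add: Complex_eq algebra_simps)
  moreover have "(\<lambda>w. \<Sum>K\<in>{K. q \<notin> K}. \<i> ^ card K *
      Complex (cl_coeff (F K (subst_at q z w)) C) (cl_coeff (F (insert q K) (subst_at q z w)) C)) field_differentiable (at w)"
    by (intro derivative_intros CR_on_field_differentiable[OF CR_pair_imp_CR_on[OF assms(1)] assms(2) linear_cl_coeff]) auto
  ultimately show ?thesis by simp
qed

text \<open>Conjugation on S multiplies F L by \<open>sg S L\<close>, so orthogonality of the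
  characters isolates L = K. The power of - i removes the phase i^|K|.\<close>

lemma cx_stem_recover:
  fixes F :: "('m::{finite,linorder}, 'n::{finite,linorder}) stem"
  assumes "symmetric D" "is_stem D F" "z \<in> D"
  shows "cl_coeff (F K z) C = Re (inverse (2 ^ CARD('n)) * (- \<i>) ^ card K *
    (\<Sum>S\<in>UNIV. of_real (sg S K) * cx_stem F C (cnj_set S z)))"
proof -
  have "(\<Sum>S\<in>UNIV. of_real (sg S K) * cx_stem F C (cnj_set S z)) =
      (\<Sum>S\<in>UNIV. \<Sum>L\<in>UNIV. \<i> ^ card L * of_real (cl_coeff (F L z) C) * of_real (sg S K * sg S L))"
    unfolding cx_stem_def sum_distrib_left
    by (intro sum.cong refl) (simp add: cnj_set_stem[OF assms] mult_ac)
  also have "\<dots> = (\<Sum>L\<in>UNIV. \<i> ^ card L * of_real (cl_coeff (F L z) C) * of_real (\<Sum>S\<in>UNIV. sg S K * sg S L))"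
    by (subst sum.swap) (simp add: sum_distrib_left)
  also have "\<dots> = \<i> ^ card K * of_real (cl_coeff (F K z) C) * 2 ^ CARD('n)"
    unfolding sg_orthogonal by (simp add: if_distrib cong: if_cong)
  finally have "inverse (2 ^ CARD('n)) * (- \<i>) ^ card K * (\<Sum>S\<in>UNIV. of_real (sg S K) * cx_stem F C (cnj_set S z))
      = ((- \<i>) ^ card K * \<i> ^ card K) * of_real (cl_coeff (F K z) C)"
    by (simp add: field_simps)
  also have "(- \<i>) ^ card K * \<i> ^ card K = 1" by (simp flip: power_mult_distrib)
  finally show ?thesis by simp
qed

lemma clifford_expand: "a = (\<Sum>C\<in>UNIV. cl_coeff a C *\<^sub>R Clifford (axis C 1))"
  by (rule clifford_eqI) (simp add: cl_coeff_sum, simp add: cl_coeff_def Clifford_inverse axis_def if_distrib cong: if_cong)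

lemma hol_n_imp_C1_on:
  fixes \<Phi> :: "complex ^ 'n::finite \<Rightarrow> complex"
  assumes "hol_n D \<Phi>"
  shows "C1_on D \<Phi>"
proof -
  have bl: "bounded_linear (\<lambda>v :: complex ^ 'n. v $ l)" for l by (rule bounded_linear_vec_nth)
  define f' where "f' z = (\<Sum>l\<in>UNIV. blinfun_mult_right (pdiff \<Phi> l z) o\<^sub>L Blinfun (\<lambda>v :: complex ^ 'n. v $ l))" for z
  have "blinfun_apply (f' z) = (\<lambda>v. \<Sum>l\<in>UNIV. v $ l * pdiff \<Phi> l z)" for z
    by (rule ext) (simp add: f'_def blinfun.sum_left bounded_linear_Blinfun_apply[OF bl] mult.commute)
  moreover have "continuous_on D f'"
    unfolding f'_def
    by (intro continuous_intros bounded_linear.continuous_on[OF bounded_linear_blinfun_mult_right])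
      (use assms in \<open>simp add: hol_n_def\<close>)
  ultimately show ?thesis using assms unfolding C1_on_def hol_n_def by (intro exI[of _ f']) simp
qed

lemma bounded_linear_cnj_set: "bounded_linear (cnj_set S :: complex ^ 'n::finite \<Rightarrow> complex ^ 'n)"
  unfolding linear_conv_bounded_linear[symmetric]
  by (rule linearI) (auto simp: cnj_set_def vec_eq_iff)

theorem regular_stem_of_pairs:
  fixes F :: "('m::{finite,linorder}, 'n::{finite,linorder}) stem"
  assumes D: "open D" "symmetric D" and F: "is_stem D F"
    and CR: "\<And>p z B. z \<in> nonreal D {..<p} \<Longrightarrow> p \<notin> B \<Longrightarrow>
      CR_pair (sec (nonreal D {..<p}) p z) (\<lambda>w. F B (subst_at p z w)) (\<lambda>w. F (insert p B) (subst_at p z w))"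
  shows "regular_stem D F"
proof -
  have hol: "hol_n D (cx_stem F C)" for C
  proof (rule Hartogs[OF D(1)])
    fix q :: 'n and z :: "complex ^ 'n::{finite,linorder}" assume z: "z \<in> D" and im: "\<And>l. l < q \<Longrightarrow> Im (z $ l) \<noteq> 0"
    have zN: "z \<in> nonreal D {..<q}" using z im by (simp add: nonreal_def)
    hence "z $ q \<in> sec (nonreal D {..<q}) q z" by (simp add: sec_def)
    with CR[OF zN] have "(\<lambda>w. cx_stem F C (subst_at q z w)) field_differentiable (at (z $ q))"
      by (rule cx_stem_field_differentiable)
    then obtain d where "((\<lambda>w. cx_stem F C (subst_at q z w)) has_field_derivative d) (at (0 + z $ q))"
      unfolding field_differentiable_def by auto
    hence "((\<lambda>w. cx_stem F C (subst_at q z (w + z $ q))) has_field_derivative d) (at 0)"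
      by (simp only: DERIV_shift)
    moreover have "subst_at q z (w + z $ q) = z + axis q w" for w
      by (simp add: vec_eq_iff subst_at_nth axis_def)
    ultimately show "(\<lambda>w. cx_stem F C (z + axis q w)) field_differentiable at 0"
      unfolding field_differentiable_def by auto
  qed
  have C1: "C1_on D (F K)" for K
  proof (rule C1_on_cong_open[OF D(1)])
    define r where "r S C v = Re (inverse (2 ^ CARD('n)) * (- \<i>) ^ card K * (of_real (sg S K) * v)) *\<^sub>R Clifford (axis C 1)"
      for S and C :: "'m set" and v
    have r: "bounded_linear (r S C)" for S C
      unfolding linear_conv_bounded_linear[symmetric]
      by (rule linearI) (simp_all add: r_def algebra_simps scaleR_add_left)
    \<comment> \<open>Partial conjugations and the recovery formula are real linear, so continuous
      differentiability passes from \<open>cx_stem\<close> to F K.\<close>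
    show "C1_on D (\<lambda>z. \<Sum>C\<in>UNIV. \<Sum>S\<in>UNIV. r S C (cx_stem F C (0 + cnj_set S z)))"
    proof (intro C1_on_sum C1_on_linear_left[OF r] C1_on_affine_right[OF bounded_linear_cnj_set hol_n_imp_C1_on[OF hol]])
      show "0 + cnj_set S z \<in> D" if "z \<in> D" for S z using cnj_set_stem[OF D(2) F that] by simp
    qed
    fix z assume z: "z \<in> D"
    have "F K z = (\<Sum>C\<in>UNIV. cl_coeff (F K z) C *\<^sub>R Clifford (axis C 1))" by (rule clifford_expand)
    also have "\<dots> = (\<Sum>C\<in>UNIV. \<Sum>S\<in>UNIV. r S C (cx_stem F C (0 + cnj_set S z)))"
      unfolding cx_stem_recover[OF D(2) F z] r_def scaleR_sum_left[symmetric] Re_sum[symmetric] sum_distrib_left[symmetric]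
      by simp
    finally show "(\<Sum>C\<in>UNIV. \<Sum>S\<in>UNIV. r S C (cx_stem F C (0 + cnj_set S z))) = F K z" ..
  qed
  define DF where "DF K z v = frechet_derivative (F K) (at z) v" for K z v
  have cont: "continuous_on D (\<lambda>z. DF K z v)" for K v
  proof -
    obtain f' where f': "continuous_on D f'" "\<And>x. x \<in> D \<Longrightarrow> frechet_derivative (F K) (at x) = blinfun_apply (f' x)"
      using C1_on_derivative[OF C1] by metis
    have "continuous_on D (\<lambda>z. blinfun_apply (f' z) v)" using f'(1) by (intro continuous_intros)
    thus ?thesis by (simp add: DF_def f'(2) cong: continuous_on_cong)
  qed
  have sec: "frechet_derivative (\<lambda>w. F K (subst_at h z w)) (at (z $ h)) = (\<lambda>d. DF K z (axis h d))" if "z \<in> D" for K h z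
  proof -
    have "F K differentiable (at (subst_at h z (z $ h)))"
      using C1[of K] that unfolding C1_on_def differentiable_def by auto
    hence "(F K has_derivative DF K z) (at (subst_at h z (z $ h)))"
      unfolding DF_def by (simp add: frechet_derivative_works)
    from frechet_derivative_at[OF subst_at_has_derivative[OF this]] show ?thesis by simp
  qed
  have "DF K z (axis h 1) - DF (insert h K) z (axis h \<i>) = 0 \<and> DF K z (axis h \<i>) + DF (insert h K) z (axis h 1) = 0"
    if z: "z \<in> D" and h: "h \<notin> K" for z h K
  proof -
    have *: "DF K z (axis h 1) - DF (insert h K) z (axis h \<i>) = 0 \<and> DF K z (axis h \<i>) + DF (insert h K) z (axis h 1) = 0"
      if "z \<in> nonreal D UNIV" for z
    proof -
      have zN: "z \<in> nonreal D {..<h}" and zD: "z \<in> D" using that by (auto simp: nonreal_def)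
      hence "z $ h \<in> sec (nonreal D {..<h}) h z" by (simp add: sec_def)
      with CR[OF zN h] show ?thesis unfolding CR_pair_def by (auto simp: sec[OF zD])
    qed
    show ?thesis
    proof
      show "DF K z (axis h 1) - DF (insert h K) z (axis h \<i>) = 0"
        by (rule continuous_zero_on_nonreal[OF D(1) _ _ z]) (use * in \<open>auto intro!: continuous_intros cont\<close>)
      show "DF K z (axis h \<i>) + DF (insert h K) z (axis h 1) = 0"
        by (rule continuous_zero_on_nonreal[OF D(1) _ _ z]) (use * in \<open>auto intro!: continuous_intros cont\<close>)
    qed
  qed
  thus ?thesis using C1 unfolding regular_stem_def DF_def by (auto simp: eq_neg_iff_add_eq_0)
qed

theorem slice_regular_iff_components:
  fixes f :: "('m::{finite,linorder}, 'n::{finite,linorder}) slice_fun"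
  assumes D: "open D" "symmetric D" and f: "f \<in> slice_fns D"
  shows "f \<in> slice_regular_fns D \<longleftrightarrow> (\<forall>H. H \<noteq> UNIV \<longrightarrow> (\<forall>K\<subseteq>H.
    S_comp D H K f \<in> slice_regular_fns_at (Min (- H)) (nonreal D H)))"
proof
  assume "f \<in> slice_regular_fns D"
  thus "\<forall>H. H \<noteq> UNIV \<longrightarrow> (\<forall>K\<subseteq>H. S_comp D H K f \<in> slice_regular_fns_at (Min (- H)) (nonreal D H))"
    unfolding slice_regular_fns_alt using S_comp_regular_at_min[OF D] by blast
next
  assume R: "\<forall>H. H \<noteq> UNIV \<longrightarrow> (\<forall>K\<subseteq>H. S_comp D H K f \<in> slice_regular_fns_at (Min (- H)) (nonreal D H))"
  obtain F where F: "induced_by D f F" using f by (auto simp: slice_fns_def)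
  have "regular_stem D F"
  proof (rule regular_stem_of_pairs[OF D])
    show "is_stem D F" using F by (simp add: induced_by_def)
    fix p :: 'n and z B assume z: "z \<in> nonreal D {..<p}" and B: "p \<notin> B"
    have "{..<p} \<noteq> UNIV" "Min (- {..<p}) = p" by (auto intro: Min_eqI)
    hence "S_comp D {..<p} K f \<in> slice_regular_fns_at p (nonreal D {..<p})" if "K \<subseteq> {..<p}" for K
      using R that by metis
    thus "CR_pair (sec (nonreal D {..<p}) p z) (\<lambda>w. F B (subst_at p z w)) (\<lambda>w. F (insert p B) (subst_at p z w))"
      by (rule stem_pair_of_components[OF D F _ z B])
  qed
  thus "f \<in> slice_regular_fns D" unfolding slice_regular_fns_alt using F by blast
qed

subsection \<open>Cauchy-Riemann pairs\<close>

lemma CR_on_linear: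
  assumes T: "bounded_linear T" and AB: "CR_on E A B"
  shows "CR_on E (\<lambda>w. T (A w)) (\<lambda>w. T (B w))"
  unfolding CR_on_def
proof
  fix w assume "w \<in> E"
  then obtain a b where ab: "(A has_derivative (\<lambda>d. Re d *\<^sub>R a - Im d *\<^sub>R b)) (at w)"
    "(B has_derivative (\<lambda>d. Re d *\<^sub>R b + Im d *\<^sub>R a)) (at w)"
    using AB unfolding CR_on_def by blast
  have lin: "linear T" by (rule bounded_linear.linear[OF T])
  have "((\<lambda>w. T (A w)) has_derivative (\<lambda>d. Re d *\<^sub>R T a - Im d *\<^sub>R T b)) (at w)"
    "((\<lambda>w. T (B w)) has_derivative (\<lambda>d. Re d *\<^sub>R T b + Im d *\<^sub>R T a)) (at w)"
    using bounded_linear.has_derivative[OF T ab(1)] bounded_linear.has_derivative[OF T ab(2)]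
    by (simp_all add: linear_diff[OF lin] linear_add[OF lin] linear_scale[OF lin])
  thus "\<exists>a b. ((\<lambda>w. T (A w)) has_derivative (\<lambda>d. Re d *\<^sub>R a - Im d *\<^sub>R b)) (at w) \<and>
     ((\<lambda>w. T (B w)) has_derivative (\<lambda>d. Re d *\<^sub>R b + Im d *\<^sub>R a)) (at w)" by blast
qed

lemma CR_on_add:
  assumes "CR_on E A B" "CR_on E A' B'"
  shows "CR_on E (\<lambda>w. A w + A' w) (\<lambda>w. B w + B' w)"
  unfolding CR_on_def
proof
  fix w assume w: "w \<in> E"
  obtain a b where ab: "(A has_derivative (\<lambda>d. Re d *\<^sub>R a - Im d *\<^sub>R b)) (at w)"
    "(B has_derivative (\<lambda>d. Re d *\<^sub>R b + Im d *\<^sub>R a)) (at w)"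
    using assms(1) w unfolding CR_on_def by blast
  obtain a' b' where ab': "(A' has_derivative (\<lambda>d. Re d *\<^sub>R a' - Im d *\<^sub>R b')) (at w)"
    "(B' has_derivative (\<lambda>d. Re d *\<^sub>R b' + Im d *\<^sub>R a')) (at w)"
    using assms(2) w unfolding CR_on_def by blast
  have "((\<lambda>w. A w + A' w) has_derivative (\<lambda>d. Re d *\<^sub>R (a + a') - Im d *\<^sub>R (b + b'))) (at w)"
    "((\<lambda>w. B w + B' w) has_derivative (\<lambda>d. Re d *\<^sub>R (b + b') + Im d *\<^sub>R (a + a'))) (at w)"
    using has_derivative_add[OF ab(1) ab'(1)] has_derivative_add[OF ab(2) ab'(2)]
    by (simp_all add: algebra_simps)
  thus "\<exists>a b. ((\<lambda>w. A w + A' w) has_derivative (\<lambda>d. Re d *\<^sub>R a - Im d *\<^sub>R b)) (at w) \<and>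
     ((\<lambda>w. B w + B' w) has_derivative (\<lambda>d. Re d *\<^sub>R b + Im d *\<^sub>R a)) (at w)" by blast
qed

lemma CR_on_sum:
  assumes "\<And>i. i \<in> I \<Longrightarrow> CR_on E (A i) (B i)"
  shows "CR_on E (\<lambda>w. \<Sum>i\<in>I. A i w) (\<lambda>w. \<Sum>i\<in>I. B i w)"
proof -
  have 0: "CR_on E (\<lambda>w. 0) (\<lambda>w. 0)"
    unfolding CR_on_def by (auto intro!: exI[of _ 0])
  show ?thesis
    using assms
  proof (induction I rule: infinite_finite_induct)
    case (insert i I)
    thus ?case using CR_on_add[of E "A i" "B i" "\<lambda>w. \<Sum>i\<in>I. A i w" "\<lambda>w. \<Sum>i\<in>I. B i w"] by simp
  qed (simp_all add: 0)
qed

text \<open>The real and imaginary parts of w times (A + i B).\<close>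

lemma CR_on_mult_ident:
  assumes "CR_on E A B"
  shows "CR_on E (\<lambda>w. Re w *\<^sub>R A w - Im w *\<^sub>R B w) (\<lambda>w. Re w *\<^sub>R B w + Im w *\<^sub>R A w)"
  unfolding CR_on_def
proof
  fix w assume "w \<in> E"
  then obtain a b where ab: "(A has_derivative (\<lambda>d. Re d *\<^sub>R a - Im d *\<^sub>R b)) (at w)"
    "(B has_derivative (\<lambda>d. Re d *\<^sub>R b + Im d *\<^sub>R a)) (at w)"
    using assms unfolding CR_on_def by blast
  have ri: "(Re has_derivative Re) (at w)" "(Im has_derivative Im) (at w)"
    by (auto intro!: bounded_linear_imp_has_derivative bounded_linear_Re bounded_linear_Im)
  let ?a = "A w + (Re w *\<^sub>R a - Im w *\<^sub>R b)" and ?b = "B w + (Re w *\<^sub>R b + Im w *\<^sub>R a)"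
  have "((\<lambda>w. Re w *\<^sub>R A w - Im w *\<^sub>R B w) has_derivative (\<lambda>d. Re d *\<^sub>R ?a - Im d *\<^sub>R ?b)) (at w)"
    using has_derivative_diff[OF has_derivative_scaleR[OF ri(1) ab(1)] has_derivative_scaleR[OF ri(2) ab(2)]]
    by (rule has_derivative_eq_rhs) (simp add: fun_eq_iff algebra_simps)
  moreover have "((\<lambda>w. Re w *\<^sub>R B w + Im w *\<^sub>R A w) has_derivative (\<lambda>d. Re d *\<^sub>R ?b + Im d *\<^sub>R ?a)) (at w)"
    using has_derivative_add[OF has_derivative_scaleR[OF ri(1) ab(2)] has_derivative_scaleR[OF ri(2) ab(1)]]
    by (rule has_derivative_eq_rhs) (simp add: fun_eq_iff algebra_simps)
  ultimately show "\<exists>a b. ((\<lambda>w. Re w *\<^sub>R A w - Im w *\<^sub>R B w) has_derivative (\<lambda>d. Re d *\<^sub>R a - Im d *\<^sub>R b)) (at w) \<and>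
     ((\<lambda>w. Re w *\<^sub>R B w + Im w *\<^sub>R A w) has_derivative (\<lambda>d. Re d *\<^sub>R b + Im d *\<^sub>R a)) (at w)" by blast
qed

text \<open>For k = h this is multiplication by the variable w; for other k the weights Re and Im of
  z $ k are constant along the section.\<close>

lemma CR_on_xmul:
  fixes F :: "('m::{finite,linorder}, 'n::{finite,linorder}) stem"
  assumes F: "\<And>B. h \<notin> B \<Longrightarrow> CR_on E (\<lambda>w. F B (subst_at h z w)) (\<lambda>w. F (insert h B) (subst_at h z w))"
    and B: "h \<notin> B"
  shows "CR_on E (\<lambda>w. xmul k F B (subst_at h z w)) (\<lambda>w. xmul k F (insert h B) (subst_at h z w))"
proof (cases "k = h")
  case True
  have "insert h B - {h} = B" using B by auto
  thus ?thesis using CR_on_mult_ident[OF F[OF B]] B True by (simp add: xmul_def subst_at_nth)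
next
  case False
  have l: "bounded_linear (\<lambda>v :: 'm clifford. r *\<^sub>R v)" for r by (rule bounded_linear_scaleR_right)
  show ?thesis
  proof (cases "k \<in> B")
    case True
    have "insert h B - {k} = insert h (B - {k})" using False by auto
    moreover have "h \<notin> B - {k}" using B by auto
    ultimately show ?thesis
      using CR_on_add[OF CR_on_linear[OF l F[OF B]] CR_on_linear[OF l F[of "B - {k}"]], of "Re (z $ k)" "Im (z $ k)"] True False
      by (simp add: xmul_def subst_at_nth)
  next
    case F': False
    have "insert k (insert h B) = insert h (insert k B)" by auto
    moreover have "h \<notin> insert k B" using B False by auto
    ultimately show ?thesis
      using CR_on_add[OF CR_on_linear[OF l F[OF B]] CR_on_linear[OF l F[of "insert k B"]], of "Re (z $ k)" "- Im (z $ k)"] F' False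
      by (simp add: xmul_def subst_at_nth)
  qed
qed

lemma CR_on_foldr_xmul:
  fixes F :: "('m::{finite,linorder}, 'n::{finite,linorder}) stem"
  assumes F: "\<And>B. h \<notin> B \<Longrightarrow> CR_on E (\<lambda>w. F B (subst_at h z w)) (\<lambda>w. F (insert h B) (subst_at h z w))"
    and B: "h \<notin> B"
  shows "CR_on E (\<lambda>w. foldr xmul ks F B (subst_at h z w)) (\<lambda>w. foldr xmul ks F (insert h B) (subst_at h z w))"
  using B by (induction ks arbitrary: B) (simp_all add: F CR_on_xmul)

text \<open>A j and B j stand for the real and imaginary parts of the j-th complex derivative.
  Having all orders at hand keeps the later formulas closed under differentiation.\<close>

definition CR_chain :: "complex set \<Rightarrow> (nat \<Rightarrow> complex \<Rightarrow> 'b::real_normed_vector) \<Rightarrow> (nat \<Rightarrow> complex \<Rightarrow> 'b) \<Rightarrow> bool" where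
  "CR_chain E A B \<longleftrightarrow> (\<forall>w\<in>E. \<forall>j.
     (A j has_derivative (\<lambda>d. Re d *\<^sub>R A (Suc j) w - Im d *\<^sub>R B (Suc j) w)) (at w) \<and>
     (B j has_derivative (\<lambda>d. Re d *\<^sub>R B (Suc j) w + Im d *\<^sub>R A (Suc j) w)) (at w))"

text \<open>Each coordinate along \<open>Basis\<close> is a holomorphic function and so has
  derivatives of every order; the vectors are assembled from these.\<close>

lemma CR_on_chain:
  fixes A0 B0 :: "complex \<Rightarrow> 'b::euclidean_space"
  assumes E: "open E" and AB: "CR_on E A0 B0"
  obtains A B where "CR_chain E A B" "A 0 = A0" "B 0 = B0"
proof -
  define \<Phi> where "\<Phi> b w = Complex (A0 w \<bullet> b) (B0 w \<bullet> b)" for b w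
  have "\<Phi> b field_differentiable (at w)" if "w \<in> E" for b w
    unfolding \<Phi>_def[abs_def] by (rule CR_on_field_differentiable[OF AB that bounded_linear_inner_left])
  hence hol: "\<Phi> b holomorphic_on E" for b
    unfolding holomorphic_on_def by (blast intro: field_differentiable_at_within)
  have d: "(((deriv ^^ j) (\<Phi> b)) has_derivative (\<lambda>d. (deriv ^^ Suc j) (\<Phi> b) w * d)) (at w)" if "w \<in> E" for j b w
  proof -
    have "(deriv ^^ j) (\<Phi> b) field_differentiable (at w)"
      using holomorphic_on_imp_differentiable_at[OF holomorphic_higher_deriv[OF hol E] E that] .
    thus ?thesis by (simp add: DERIV_deriv_iff_field_differentiable[symmetric] has_field_derivative_def)
  qed
  define A where "A j w = (\<Sum>b\<in>Basis. Re ((deriv ^^ j) (\<Phi> b) w) *\<^sub>R b)" for j w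
  define B where "B j w = (\<Sum>b\<in>Basis. Im ((deriv ^^ j) (\<Phi> b) w) *\<^sub>R b)" for j w
  show ?thesis
  proof (rule that)
    show "CR_chain E A B"
      unfolding CR_chain_def
    proof (intro ballI allI conjI)
      fix w j assume w: "w \<in> E"
      have "(A j has_derivative (\<lambda>d. \<Sum>b\<in>Basis. Re ((deriv ^^ Suc j) (\<Phi> b) w * d) *\<^sub>R b)) (at w)"
        unfolding A_def[abs_def] by (intro has_derivative_sum has_derivative_scaleR_left has_derivative_Re d w)
      thus "(A j has_derivative (\<lambda>d. Re d *\<^sub>R A (Suc j) w - Im d *\<^sub>R B (Suc j) w)) (at w)"
        by (rule has_derivative_eq_rhs)
          (simp add: fun_eq_iff A_def B_def scaleR_sum_right sum_subtractf[symmetric] algebra_simps)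
      have "(B j has_derivative (\<lambda>d. \<Sum>b\<in>Basis. Im ((deriv ^^ Suc j) (\<Phi> b) w * d) *\<^sub>R b)) (at w)"
        unfolding B_def[abs_def] by (intro has_derivative_sum has_derivative_scaleR_left has_derivative_Im d w)
      thus "(B j has_derivative (\<lambda>d. Re d *\<^sub>R B (Suc j) w + Im d *\<^sub>R A (Suc j) w)) (at w)"
        by (rule has_derivative_eq_rhs)
          (simp add: fun_eq_iff A_def B_def scaleR_sum_right sum.distrib[symmetric] algebra_simps)
    qed
    show "A 0 = A0" "B 0 = B0"
      by (simp_all add: fun_eq_iff A_def B_def \<Phi>_def euclidean_representation)
  qed
qed

text \<open>\<open>psi A B k j\<close> is \<open>((1/r) \<partial>\<^sub>r)\<^sup>k (B j / r)\<close> at \<open>\<alpha> + i r\<close>. As \<open>B j\<close> is harmonic, this function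
  satisfies \<open>\<partial>\<^sub>\<alpha>\<^sup>2 + \<partial>\<^sub>r\<^sup>2 + ((2 k + 2) / r) \<partial>\<^sub>r = 0\<close>, which is the recursion below.\<close>

fun psi :: "(nat \<Rightarrow> complex \<Rightarrow> 'b::real_vector) \<Rightarrow> (nat \<Rightarrow> complex \<Rightarrow> 'b) \<Rightarrow> nat \<Rightarrow> nat \<Rightarrow> complex \<Rightarrow> 'b" where
  "psi A B 0 j w = inverse (Im w) *\<^sub>R B j w"
| "psi A B (Suc 0) j w = inverse (Im w) ^ 2 *\<^sub>R A (Suc j) w - inverse (Im w) ^ 3 *\<^sub>R B j w"
| "psi A B (Suc (Suc k)) j w =
    - (inverse (Im w) ^ 2) *\<^sub>R ((2 * real k + 3) *\<^sub>R psi A B (Suc k) j w + psi A B k (Suc (Suc j)) w)"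

lemma has_derivative_inverse_Im_power:
  assumes "Im w \<noteq> 0"
  shows "((\<lambda>w. inverse (Im w) ^ n) has_derivative (\<lambda>d. - real n * inverse (Im w) ^ Suc n * Im d)) (at w)"
proof -
  have i: "(Im has_derivative Im) (at w)" by (intro bounded_linear_imp_has_derivative bounded_linear_Im)
  have "((\<lambda>x. inverse x ^ n) has_real_derivative - real n * inverse (Im w) ^ Suc n) (at (Im w))"
    by (rule derivative_eq_intros refl assms)+ (cases n, auto simp: algebra_simps)
  from has_derivative_compose[OF i this[unfolded has_field_derivative_def]] show ?thesis .
qed

text \<open>Differentiation in \<alpha> raises j, and differentiation in r = Im w raises k and
  multiplies by r. As the recursion has three terms, the induction rests on the cases k = 0 and k =
  1, which are computed directly.\<close>

lemma psi_has_derivative: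
  fixes A B :: "nat \<Rightarrow> complex \<Rightarrow> 'b::euclidean_space"
  assumes AB: "CR_chain E A B" and w: "w \<in> E" "Im w \<noteq> 0"
  shows "(psi A B k j has_derivative
    (\<lambda>d. Re d *\<^sub>R psi A B k (Suc j) w + Im d *\<^sub>R (Im w *\<^sub>R psi A B (Suc k) j w))) (at w)"
proof -
  define P where "P k j \<longleftrightarrow> (psi A B k j has_derivative
      (\<lambda>d. Re d *\<^sub>R psi A B k (Suc j) w + Im d *\<^sub>R (Im w *\<^sub>R psi A B (Suc (k)) j w))) (at w)" for k j
  have dA: "(A j has_derivative (\<lambda>d. Re d *\<^sub>R A (Suc j) w - Im d *\<^sub>R B (Suc j) w)) (at w)"
    and dB: "(B j has_derivative (\<lambda>d. Re d *\<^sub>R B (Suc j) w + Im d *\<^sub>R A (Suc j) w)) (at w)" for j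
    using AB w(1) unfolding CR_chain_def by blast+
  note dI = has_derivative_inverse_Im_power[OF w(2)]
  have base0: "P 0 j" for j
  proof -
    have "((\<lambda>w. inverse (Im w) ^ 1 *\<^sub>R B j w) has_derivative (\<lambda>d. inverse (Im w) ^ 1 *\<^sub>R (Re d *\<^sub>R B (Suc j) w + Im d *\<^sub>R A (Suc j) w)
        + (- real 1 * inverse (Im w) ^ Suc 1 * Im d) *\<^sub>R B j w)) (at w)"
      by (rule has_derivative_scaleR[OF dI dB])
    also have "(\<lambda>w. inverse (Im w) ^ 1 *\<^sub>R B j w) = psi A B 0 j" by (simp add: fun_eq_iff)
    finally show "P 0 j" unfolding P_def
      by (rule has_derivative_eq_rhs)
        (rule ext, rule euclidean_eqI, use w(2) in \<open>simp add: inner_add_left inner_diff_left field_simps power2_eq_square power3_eq_cube\<close>)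
  qed
  have base1: "P (Suc 0) j" for j
  proof -
    have "((\<lambda>w. inverse (Im w) ^ 2 *\<^sub>R A (Suc j) w - inverse (Im w) ^ 3 *\<^sub>R B j w) has_derivative
      (\<lambda>d. (inverse (Im w) ^ 2 *\<^sub>R (Re d *\<^sub>R A (Suc (Suc j)) w - Im d *\<^sub>R B (Suc (Suc j)) w)
          + (- real 2 * inverse (Im w) ^ Suc 2 * Im d) *\<^sub>R A (Suc j) w) -
        (inverse (Im w) ^ 3 *\<^sub>R (Re d *\<^sub>R B (Suc j) w + Im d *\<^sub>R A (Suc j) w)
          + (- real 3 * inverse (Im w) ^ Suc 3 * Im d) *\<^sub>R B j w))) (at w)"
      by (intro has_derivative_diff has_derivative_scaleR dI dA dB)
    also have "(\<lambda>w. inverse (Im w) ^ 2 *\<^sub>R A (Suc j) w - inverse (Im w) ^ 3 *\<^sub>R B j w) = psi A B (Suc 0) j"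
      by (simp add: fun_eq_iff)
    finally show "P (Suc 0) j" unfolding P_def
      by (rule has_derivative_eq_rhs)
        (rule ext, rule euclidean_eqI, use w(2) in
          \<open>simp add: inner_add_left inner_diff_left field_simps power2_eq_square power3_eq_cube power4_eq_xxxx\<close>)
  qed
  have step: "P (Suc (Suc k)) j" if IH: "\<And>j. P k j" "\<And>j. P (Suc k) j" for k j
  proof -
    let ?c = "2 * real k + 3" and ?q = "inverse (Im w) ^ 2"
    let ?X = "psi A B (Suc k)" and ?Y = "psi A B k (Suc (Suc j))" and ?Z = "psi A B (Suc (Suc k))"
    have "((\<lambda>w. inverse (Im w) ^ 2 *\<^sub>R (?c *\<^sub>R ?X j w + ?Y w)) has_derivative
      (\<lambda>d. ?q *\<^sub>R (?c *\<^sub>R (Re d *\<^sub>R ?X (Suc j) w + Im d *\<^sub>R (Im w *\<^sub>R ?Z j w))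
          + (Re d *\<^sub>R psi A B k (Suc (Suc (Suc j))) w + Im d *\<^sub>R (Im w *\<^sub>R ?X (Suc (Suc j)) w)))
        + (- real 2 * inverse (Im w) ^ Suc 2 * Im d) *\<^sub>R (?c *\<^sub>R ?X j w + ?Y w))) (at w)"
      by (intro has_derivative_scaleR has_derivative_add has_derivative_scaleR_right dI IH[unfolded P_def])
    hence "((\<lambda>w. - (inverse (Im w) ^ 2 *\<^sub>R (?c *\<^sub>R ?X j w + ?Y w))) has_derivative
      (\<lambda>d. - (?q *\<^sub>R (?c *\<^sub>R (Re d *\<^sub>R ?X (Suc j) w + Im d *\<^sub>R (Im w *\<^sub>R ?Z j w))
          + (Re d *\<^sub>R psi A B k (Suc (Suc (Suc j))) w + Im d *\<^sub>R (Im w *\<^sub>R ?X (Suc (Suc j)) w)))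
        + (- real 2 * inverse (Im w) ^ Suc 2 * Im d) *\<^sub>R (?c *\<^sub>R ?X j w + ?Y w)))) (at w)"
      by (rule has_derivative_minus)
    also have "(\<lambda>w. - (inverse (Im w) ^ 2 *\<^sub>R (?c *\<^sub>R ?X j w + ?Y w))) = ?Z j" by (simp add: fun_eq_iff)
    finally show "P (Suc (Suc k)) j" unfolding P_def
    proof (rule has_derivative_eq_rhs, intro ext)
      fix d
      have 1: "(- real 2 * inverse (Im w) ^ Suc 2 * Im d) *\<^sub>R (?c *\<^sub>R ?X j w + ?Y w) = (2 * inverse (Im w) * Im d) *\<^sub>R ?Z j w"
        by (simp add: numeral_3_eq_3 power2_eq_square mult_ac)
      have 2: "?Z (Suc j) w = - ?q *\<^sub>R (?c *\<^sub>R ?X (Suc j) w + psi A B k (Suc (Suc (Suc j))) w)" by simp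
      \<comment> \<open>The next instance of the recursion: 2 (k + 1) + 3 is ?c + 2.\<close>
      have 3: "psi A B (Suc (Suc (Suc k))) j w = - ?q *\<^sub>R ((?c + 2) *\<^sub>R ?Z j w + ?X (Suc (Suc j)) w)"
        by (subst psi.simps) (simp add: algebra_simps)
      show "- (?q *\<^sub>R (?c *\<^sub>R (Re d *\<^sub>R ?X (Suc j) w + Im d *\<^sub>R (Im w *\<^sub>R ?Z j w))
          + (Re d *\<^sub>R psi A B k (Suc (Suc (Suc j))) w + Im d *\<^sub>R (Im w *\<^sub>R ?X (Suc (Suc j)) w)))
        + (- real 2 * inverse (Im w) ^ Suc 2 * Im d) *\<^sub>R (?c *\<^sub>R ?X j w + ?Y w)) =
        Re d *\<^sub>R ?Z (Suc j) w + Im d *\<^sub>R (Im w *\<^sub>R psi A B (Suc (Suc (Suc k))) j w)"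
        unfolding 1 2 3
        by (rule euclidean_eqI) (use w(2) in \<open>simp add: inner_add_left inner_diff_left field_simps power2_eq_square del: psi.simps\<close>)
    qed
  qed
  have "P k j"
    by (induction k arbitrary: j rule: induct_nat_012) (fact base0 base1 step)+
  thus ?thesis unfolding P_def .
qed

subsection \<open>The iterated Laplacian\<close>

definition para :: "real \<Rightarrow> ('m::{finite,linorder} \<Rightarrow> real) \<Rightarrow> 'm clifford" where
  "para a u = of_real a + (\<Sum>i\<in>UNIV. u i *\<^sub>R cl_gen i)"

definition nrm :: "('m::finite \<Rightarrow> real) \<Rightarrow> real" where
  "nrm u = sqrt (\<Sum>i\<in>UNIV. (u i)\<^sup>2)"

lemma nrm_square: "(nrm u)\<^sup>2 = (\<Sum>i\<in>UNIV. (u i)\<^sup>2)"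
  by (simp add: nrm_def sum_nonneg)

lemma nrm_ge_0: "0 \<le> nrm u"
  by (simp add: nrm_def sum_nonneg)

lemma para_eq_slice_pt1:
  fixes u :: "'m::{finite,linorder} \<Rightarrow> real"
  assumes "0 < nrm u"
  obtains I where "I \<in> imag_sphere" "para a u = slice_pt1 I (Complex a (nrm u))"
proof (rule that)
  let ?I = "\<Sum>i\<in>UNIV. (u i / nrm u) *\<^sub>R cl_gen i"
  have "(\<Sum>i\<in>UNIV. (u i / nrm u)\<^sup>2) = 1"
    using assms by (simp add: power_divide sum_divide_distrib[symmetric] nrm_square[symmetric])
  thus "?I \<in> imag_sphere" unfolding imag_sphere_def
    by (intro CollectI exI[of _ "\<lambda>i. u i / nrm u"]) simp
  show "para a u = slice_pt1 ?I (Complex a (nrm u))"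
    using assms by (simp add: para_def slice_pt1_alt scaleR_sum_right)
qed

lemma slice_pt1_eq_para:
  fixes I :: "'m::{finite,linorder} clifford"
  assumes "I \<in> imag_sphere"
  obtains u where "slice_pt1 I w = para (Re w) u" "nrm u = \<bar>Im w\<bar>"
proof -
  obtain v :: "'m \<Rightarrow> real" where I: "I = (\<Sum>i\<in>UNIV. v i *\<^sub>R cl_gen i)" and v: "(\<Sum>i\<in>UNIV. (v i)\<^sup>2) = 1"
    using assms by (auto simp: imag_sphere_def)
  show ?thesis
  proof (rule that[of "\<lambda>i. Im w * v i"])
    show "slice_pt1 I w = para (Re w) (\<lambda>i. Im w * v i)"
      by (simp add: para_def slice_pt1_alt I scaleR_sum_right)
    show "nrm (\<lambda>i. Im w * v i) = \<bar>Im w\<bar>"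
      using v by (simp add: nrm_def power_mult_distrib flip: sum_distrib_left)
  qed
qed

lemma nrm_upd:
  fixes u :: "'m::finite \<Rightarrow> real"
  shows "nrm (u(i := u i + t)) = sqrt ((nrm u)\<^sup>2 + 2 * t * u i + t\<^sup>2)"
proof -
  have "(\<Sum>j\<in>UNIV. ((u(i := u i + t)) j)\<^sup>2) = (\<Sum>j\<in>UNIV. (u j)\<^sup>2 + (if j = i then 2 * t * u i + t\<^sup>2 else 0))"
    by (intro sum.cong) (auto simp: power2_eq_square algebra_simps)
  thus ?thesis unfolding nrm_square by (simp add: nrm_def sum.distrib algebra_simps)
qed

lemma nrm_upd_derivative:
  assumes "0 < nrm u"
  shows "((\<lambda>t. nrm (u(i := u i + t))) has_real_derivative u i / nrm u) (at 0)"
  unfolding nrm_upd using assms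
  by (auto intro!: derivative_eq_intros simp: field_simps)

lemma para_add_1: "para a u + t *\<^sub>R 1 = para (a + t) u"
  by (simp add: para_def of_real_def algebra_simps)

lemma para_add_gen: "para a u + t *\<^sub>R cl_gen i = para a (u(i := u i + t))"
proof -
  have "(\<Sum>j\<in>UNIV. (u(i := u i + t)) j *\<^sub>R cl_gen j) =
      (\<Sum>j\<in>UNIV. u j *\<^sub>R cl_gen j + (if j = i then t *\<^sub>R cl_gen i else 0))"
    by (intro sum.cong) (auto simp: algebra_simps)
  thus ?thesis by (simp add: para_def sum.distrib)
qed

lemma subst_at_add_axis:
  fixes x0 :: "'m::{finite,linorder} clifford ^ 'n::finite"
  shows "subst_at h x0 \<xi> + t *\<^sub>R axis h v = subst_at h x0 (\<xi> + t *\<^sub>R v)"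
  by (simp add: vec_eq_iff subst_at_nth axis_def)

text \<open>Only the germ at t = 0 matters, so a function whose values are significant on the domain
  alone may be replaced by an explicit formula.\<close>

lemma partial_dir_eq:
  assumes ev: "\<forall>\<^sub>F t in nhds 0. g (x + t *\<^sub>R axis h v) = \<phi> t" and d: "(\<phi> has_vector_derivative d) (at 0)"
  shows "partial_dir h v g x = d"
proof -
  have "((\<lambda>t. g (x + t *\<^sub>R axis h v)) has_derivative (\<lambda>t. t *\<^sub>R d)) (at 0)"
  proof (rule has_derivative_transform_eventually[OF d[unfolded has_vector_derivative_def]])
    show "\<forall>\<^sub>F t in at 0. \<phi> t = g (x + t *\<^sub>R axis h v)"
      using ev unfolding eventually_at_filter by eventually_elim simp
    show "\<phi> 0 = g (x + 0 *\<^sub>R axis h v)" using eventually_nhds_x_imp_x[OF ev] by simp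
  qed simp
  thus ?thesis unfolding partial_dir_def
    by (intro vector_derivative_at) (simp add: has_vector_derivative_def)
qed

text \<open>The points where the radial formulas hold. By \<open>eventually_radial_dom\<close> this
  set is open along each coordinate direction, so the formulas may be differentiated
  repeatedly.\<close>

definition radial_dom :: "complex set \<Rightarrow> real \<Rightarrow> ('m::finite \<Rightarrow> real) \<Rightarrow> bool" where
  "radial_dom E a u \<longleftrightarrow> 0 < nrm u \<and> Complex a (nrm u) \<in> E"

lemma eventually_radial_dom:
  assumes E: "open E" and g: "radial_dom E a u"
  shows "\<forall>\<^sub>F t in nhds 0. radial_dom E (a + t) u" "\<forall>\<^sub>F t in nhds 0. radial_dom E a (u(i := u i + t))"
proof -
  have "((\<lambda>t. Complex (a + t) (nrm u)) \<longlongrightarrow> Complex (a + 0) (nrm u)) (nhds 0)"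
    by (intro tendsto_intros filterlim_ident)
  hence "\<forall>\<^sub>F t in nhds 0. Complex (a + t) (nrm u) \<in> E"
    using E g by (intro topological_tendstoD) (auto simp: radial_dom_def)
  thus "\<forall>\<^sub>F t in nhds 0. radial_dom E (a + t) u"
    by eventually_elim (use g in \<open>simp add: radial_dom_def\<close>)
  have "((\<lambda>t. nrm (u(i := u i + t))) \<longlongrightarrow> sqrt ((nrm u)\<^sup>2 + 2 * 0 * u i + 0\<^sup>2)) (nhds 0)"
    unfolding nrm_upd by (intro tendsto_intros filterlim_ident)
  hence l: "((\<lambda>t. nrm (u(i := u i + t))) \<longlongrightarrow> nrm u) (nhds 0)" using nrm_ge_0[of u] by simp
  hence 1: "\<forall>\<^sub>F t in nhds 0. 0 < nrm (u(i := u i + t))"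
    using g by (intro order_tendstoD(1)) (auto simp: radial_dom_def)
  have "((\<lambda>t. Complex a (nrm (u(i := u i + t)))) \<longlongrightarrow> Complex a (nrm u)) (nhds 0)"
    by (intro tendsto_intros l)
  hence "\<forall>\<^sub>F t in nhds 0. Complex a (nrm (u(i := u i + t))) \<in> E"
    using E g by (intro topological_tendstoD) (auto simp: radial_dom_def)
  with 1 show "\<forall>\<^sub>F t in nhds 0. radial_dom E a (u(i := u i + t))"
    by eventually_elim (simp add: radial_dom_def)
qed

text \<open>Up to the factor c, the real direction gives \<open>psi A B k 2\<close>, and the m
  generators together give m psi_(k+1) + r^2 psi_(k+2). The recursion rewrites the last term and
  leaves (m - (2 k + 3)) psi_(k+1).\<close>

lemma laplacian_radial:
  fixes x0 :: "'m::{finite,linorder} clifford ^ 'n::finite"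
  assumes E: "open E" and AB: "CR_chain E A B"
    and G: "\<And>a u. radial_dom E a u \<Longrightarrow> G (subst_at h x0 (para a u)) = c *\<^sub>R psi A B k 0 (Complex a (nrm u))"
    and g: "radial_dom E a u"
  shows "laplacian h G (subst_at h x0 (para a u)) =
    (c * (real CARD('m) - (2 * real k + 3))) *\<^sub>R psi A B (Suc k) 0 (Complex a (nrm u))"
proof -
  note psi' = psi_has_derivative[OF AB]
  have D1: "partial_dir h 1 G' (subst_at h x0 (para a u)) = c *\<^sub>R psi A B k (Suc j) (Complex a (nrm u))"
    if G': "\<And>a u. radial_dom E a u \<Longrightarrow> G' (subst_at h x0 (para a u)) = c *\<^sub>R psi A B k j (Complex a (nrm u))"
      and g: "radial_dom E a u" for G' :: "('m, 'n) slice_fun" and j a u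
  proof (rule partial_dir_eq)
    let ?w = "Complex a (nrm u)"
    show "\<forall>\<^sub>F t in nhds 0. G' (subst_at h x0 (para a u) + t *\<^sub>R axis h 1) = c *\<^sub>R psi A B k j (?w + of_real t)"
      using eventually_radial_dom(1)[OF E g]
    proof eventually_elim
      case (elim t)
      have "?w + of_real t = Complex (a + t) (nrm u)" by (simp add: complex_eq_iff)
      thus ?case unfolding subst_at_add_axis para_add_1 G'[OF elim] by simp
    qed
    have w: "?w + of_real 0 \<in> E" "Im (?w + of_real 0) \<noteq> 0" using g by (simp_all add: radial_dom_def)
    have "((\<lambda>t. ?w + of_real t) has_derivative (\<lambda>t. 0 + of_real t)) (at 0)"
      by (intro derivative_intros)
    from has_derivative_scaleR_right[OF has_derivative_compose[OF this psi'[OF w]]]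
    show "((\<lambda>t. c *\<^sub>R psi A B k j (?w + of_real t)) has_vector_derivative c *\<^sub>R psi A B k (Suc j) ?w) (at 0)"
      unfolding has_vector_derivative_def by (rule has_derivative_eq_rhs) (simp add: fun_eq_iff mult.commute)
  qed
  have cx: "((\<lambda>t. Complex a (nrm (u(i := u i + t)))) has_derivative (\<lambda>t. \<i> * of_real (u i / nrm u * t))) (at 0)"
    if g: "radial_dom E a u" for a u and i :: 'm
  proof -
    have "((\<lambda>t. nrm (u(i := u i + t))) has_derivative (\<lambda>t. u i / nrm u * t)) (at 0)"
      using nrm_upd_derivative[of u i] g unfolding radial_dom_def has_field_derivative_def by blast
    hence "((\<lambda>t. of_real a + \<i> * of_real (nrm (u(i := u i + t)))) has_derivative (\<lambda>t. 0 + \<i> * of_real (u i / nrm u * t))) (at 0)"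
      by (intro has_derivative_add has_derivative_const has_derivative_mult_right has_derivative_of_real)
    thus ?thesis by (simp add: Complex_eq)
  qed
  have psi_cx: "((\<lambda>t. psi A B k 0 (Complex a (nrm (u(i := u i + t))))) has_derivative
      (\<lambda>t. t *\<^sub>R (u i *\<^sub>R psi A B (Suc k) 0 (Complex a (nrm u))))) (at 0)"
    if g: "radial_dom E a u" for k a u and i :: 'm
  proof -
    have w: "Complex a (nrm (u(i := u i + 0))) \<in> E" "Im (Complex a (nrm (u(i := u i + 0)))) \<noteq> 0" "nrm u \<noteq> 0"
      using g by (simp_all add: radial_dom_def)
    show ?thesis
      using has_derivative_compose[OF cx[OF g] psi'[OF w(1,2)]]
      by (rule has_derivative_eq_rhs) (use w(3) in \<open>simp add: fun_eq_iff\<close>)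
  qed
  have D2: "partial_dir h (cl_gen i) G (subst_at h x0 (para a u)) = c *\<^sub>R (u i *\<^sub>R psi A B (Suc k) 0 (Complex a (nrm u)))"
    if g: "radial_dom E a u" for a u and i :: 'm
  proof (rule partial_dir_eq)
    show "\<forall>\<^sub>F t in nhds 0. G (subst_at h x0 (para a u) + t *\<^sub>R axis h (cl_gen i)) =
        c *\<^sub>R psi A B k 0 (Complex a (nrm (u(i := u i + t))))"
      using eventually_radial_dom(2)[OF E g, of i]
      by eventually_elim (simp only: subst_at_add_axis para_add_gen G)
    show "((\<lambda>t. c *\<^sub>R psi A B k 0 (Complex a (nrm (u(i := u i + t))))) has_vector_derivative
        c *\<^sub>R (u i *\<^sub>R psi A B (Suc k) 0 (Complex a (nrm u)))) (at 0)"
      unfolding has_vector_derivative_def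
      using has_derivative_scaleR_right[OF psi_cx[OF g]] by (rule has_derivative_eq_rhs) (simp add: fun_eq_iff mult_ac)
  qed
  have D3: "partial_dir h (cl_gen i) (partial_dir h (cl_gen i) G) (subst_at h x0 (para a u)) =
      c *\<^sub>R (psi A B (Suc k) 0 (Complex a (nrm u)) + (u i)\<^sup>2 *\<^sub>R psi A B (Suc (Suc k)) 0 (Complex a (nrm u)))"
    for i :: 'm
  proof (rule partial_dir_eq)
    show "\<forall>\<^sub>F t in nhds 0. partial_dir h (cl_gen i) G (subst_at h x0 (para a u) + t *\<^sub>R axis h (cl_gen i)) =
        c *\<^sub>R ((u i + t) *\<^sub>R psi A B (Suc k) 0 (Complex a (nrm (u(i := u i + t)))))"
      using eventually_radial_dom(2)[OF E g, of i]
      by eventually_elim (simp only: subst_at_add_axis para_add_gen D2 fun_upd_same)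
    have "((\<lambda>t. u i + t) has_derivative (\<lambda>t. 0 + t)) (at 0)" by (intro derivative_intros)
    from has_derivative_scaleR_right[OF has_derivative_scaleR[OF this psi_cx[OF g, of "Suc k" i]], of c]
    show "((\<lambda>t. c *\<^sub>R ((u i + t) *\<^sub>R psi A B (Suc k) 0 (Complex a (nrm (u(i := u i + t)))))) has_vector_derivative
        c *\<^sub>R (psi A B (Suc k) 0 (Complex a (nrm u)) + (u i)\<^sup>2 *\<^sub>R psi A B (Suc (Suc k)) 0 (Complex a (nrm u)))) (at 0)"
      unfolding has_vector_derivative_def
      by (rule has_derivative_eq_rhs) (simp add: fun_eq_iff algebra_simps power2_eq_square del: psi.simps)
  qed
  let ?w = "Complex a (nrm u)"
  have "partial_dir h 1 (partial_dir h 1 G) (subst_at h x0 (para a u)) = c *\<^sub>R psi A B k (Suc (Suc 0)) ?w"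
    by (rule D1[OF D1[OF G]]) (use g in auto)
  hence "laplacian h G (subst_at h x0 (para a u)) = c *\<^sub>R psi A B k (Suc (Suc 0)) ?w +
      (\<Sum>i\<in>(UNIV::'m set). c *\<^sub>R (psi A B (Suc k) 0 ?w + (u i)\<^sup>2 *\<^sub>R psi A B (Suc (Suc k)) 0 ?w))"
    unfolding laplacian_def by (simp only: D3)
  also have "(\<Sum>i\<in>(UNIV::'m set). c *\<^sub>R (psi A B (Suc k) 0 ?w + (u i)\<^sup>2 *\<^sub>R psi A B (Suc (Suc k)) 0 ?w)) =
      c *\<^sub>R (real CARD('m) *\<^sub>R psi A B (Suc k) 0 ?w + (nrm u)\<^sup>2 *\<^sub>R psi A B (Suc (Suc k)) 0 ?w)"
    unfolding scaleR_sum_right[symmetric] sum.distrib nrm_square scaleR_sum_left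
    by (simp only: sum_constant_scaleR)
  also have "(nrm u)\<^sup>2 *\<^sub>R psi A B (Suc (Suc k)) 0 ?w = - ((2 * real k + 3) *\<^sub>R psi A B (Suc k) 0 ?w + psi A B k (Suc (Suc 0)) ?w)"
    using g by (simp add: radial_dom_def power_inverse)
  finally show ?thesis by (simp add: algebra_simps del: psi.simps)
qed

lemma laplacian_iterate_radial:
  fixes x0 :: "'m::{finite,linorder} clifford ^ 'n::finite"
  assumes E: "open E" and AB: "CR_chain E A B"
    and G: "\<And>a u. radial_dom E a u \<Longrightarrow> G (subst_at h x0 (para a u)) = psi A B 0 0 (Complex a (nrm u))"
    and g: "radial_dom E a u"
  shows "(laplacian h ^^ k) G (subst_at h x0 (para a u)) =
    (\<Prod>i<k. real CARD('m) - (2 * real i + 3)) *\<^sub>R psi A B k 0 (Complex a (nrm u))"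
  using g
proof (induction k arbitrary: a u)
  case 0
  thus ?case using G by simp
next
  case (Suc k)
  have "laplacian h ((laplacian h ^^ k) G) (subst_at h x0 (para a u)) =
    ((\<Prod>i<k. real CARD('m) - (2 * real i + 3)) * (real CARD('m) - (2 * real k + 3))) *\<^sub>R psi A B (Suc k) 0 (Complex a (nrm u))"
    by (rule laplacian_radial[OF E AB Suc.IH Suc.prems])
  thus ?case by (simp del: psi.simps)
qed

text \<open>With the other variables fixed, the component is B0 divided by Im w. Its harmonic
  partner A0 is obtained by leaving h out of the index sets, and (A0, B0) inherits the
  Cauchy-Riemann equations from F.\<close>

theorem Fueter_Sce:
  fixes f :: "('m::{finite,linorder}, 'n::{finite,linorder}) slice_fun"
  assumes odd: "odd CARD('m)" "CARD('m) \<noteq> 1" and D: "open D" "symmetric D" and f: "f \<in> slice_regular_fns D"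
    and h: "h \<in> H" and x: "x \<in> Omega (nonreal D H)"
  shows "(laplacian h ^^ ((CARD('m) - 1) div 2)) (S_comp D H K f) x = 0"
proof -
  obtain F where F: "induced_by D f F" and reg: "regular_stem D F"
    using f unfolding slice_regular_fns_alt by blast
  obtain J z where x: "x = slice_pt J z" and z: "z \<in> nonreal D H" and J: "\<And>l. J l \<in> imag_sphere"
    using x Omega_cases by blast
  let ?N = "nonreal D H"
  let ?S = "S_comp D H K f"
  let ?E = "sec ?N h z"
  have E: "open ?E" by (intro open_sec open_nonreal D)
  have Im0: "Im w \<noteq> 0" if "w \<in> ?E" for w using that h by (auto simp: sec_def nonreal_def subst_at_nth)
  define Fk where "Fk = foldr xmul (sorted_list_of_set K) F"
  define q where "q = inverse (\<Prod>l\<in>H - {h}. Im (z $ l))"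
  define A0 where "A0 w = (\<Sum>L\<in>Pow (- H). ordered_prod J L * (q *\<^sub>R Fk (L \<union> (H - {h})) (subst_at h z w)))" for w
  define B0 where "B0 w = (\<Sum>L\<in>Pow (- H). ordered_prod J L * (q *\<^sub>R Fk (insert h (L \<union> (H - {h}))) (subst_at h z w)))" for w
  have base: "CR_on ?E (\<lambda>w. F B (subst_at h z w)) (\<lambda>w. F (insert h B) (subst_at h z w))" if "h \<notin> B" for B
    by (rule CR_pair_imp_CR_on, rule CR_pair_subset[OF regular_stem_section[OF reg that]])
      (use nonreal_subset[of D H] in \<open>auto simp: sec_def\<close>)
  have "CR_on ?E A0 B0"
    unfolding A0_def[abs_def] B0_def[abs_def] Fk_def
    by (intro CR_on_sum CR_on_linear[OF linear_clifford_mult_scaleR] CR_on_foldr_xmul base) (use h in auto)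
  then obtain A B where AB: "CR_chain ?E A B" "A 0 = A0" "B 0 = B0"
    using CR_on_chain[OF E] by metis
  have val: "stem_val J (S_stem H K F) (subst_at h z w) = inverse (Im w) *\<^sub>R B0 w" for w
  proof -
    have "(\<Prod>l\<in>H. Im (subst_at h z w $ l)) = Im w * (\<Prod>l\<in>H - {h}. Im (subst_at h z w $ l))"
      using h by (subst prod.remove[of H h]) (auto simp: subst_at_nth)
    also have "(\<Prod>l\<in>H - {h}. Im (subst_at h z w $ l)) = (\<Prod>l\<in>H - {h}. Im (z $ l))"
      by (intro prod.cong) (auto simp: subst_at_nth)
    finally have p: "inverse (\<Prod>l\<in>H. Im (subst_at h z w $ l)) = inverse (Im w) * q" by (simp add: q_def)
    have "stem_val J (S_stem H K F) (subst_at h z w) =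
        (\<Sum>L\<in>Pow (- H). ordered_prod J L * S_stem H K F L (subst_at h z w))"
      unfolding stem_val_def by (rule sum.mono_neutral_right) (auto simp: S_stem_support)
    also have "\<dots> = (\<Sum>L\<in>Pow (- H). inverse (Im w) *\<^sub>R
        (ordered_prod J L * (q *\<^sub>R Fk (insert h (L \<union> (H - {h}))) (subst_at h z w))))"
    proof (intro sum.cong refl)
      fix L assume L: "L \<in> Pow (- H)"
      have "insert h (L \<union> (H - {h})) = L \<union> H" using h by auto
      thus "ordered_prod J L * S_stem H K F L (subst_at h z w) =
          inverse (Im w) *\<^sub>R (ordered_prod J L * (q *\<^sub>R Fk (insert h (L \<union> (H - {h}))) (subst_at h z w)))"
        using L by (simp add: S_stem_alt p Fk_def)
    qed
    finally show ?thesis by (simp add: B0_def scaleR_sum_right)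
  qed
  have pair: "slice_pair1 ?E (\<lambda>\<xi>. ?S (subst_at h x \<xi>)) (\<lambda>w. stem_val J (S_stem H K F) (subst_at h z w)) (\<lambda>_. 0)"
    unfolding x
  proof (rule circular_section[where J = J, OF open_nonreal[OF D(1)] symmetric_nonreal[OF D(2)] S_comp_induced_by[OF D(2) F] z J])
    show "S_stem H K F L z = 0" if "h \<in> L" for L z
      by (rule S_stem_support) (use that h in auto)
  qed
  have G: "?S (subst_at h x (para a u)) = psi A B 0 0 (Complex a (nrm u))" if g: "radial_dom ?E a u" for a and u :: "'m \<Rightarrow> real"
  proof -
    obtain I where I: "I \<in> imag_sphere" "para a u = slice_pt1 I (Complex a (nrm u))"
      using para_eq_slice_pt1[of u a] g by (auto simp: radial_dom_def)
    have "?S (subst_at h x (slice_pt1 I (Complex a (nrm u)))) =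
        stem_val J (S_stem H K F) (subst_at h z (Complex a (nrm u))) + I * 0"
      using pair g I(1) unfolding slice_pair1_def radial_dom_def by blast
    thus ?thesis by (simp add: I(2) val AB(3))
  qed
  obtain u where u: "slice_pt1 (J h) (z $ h) = para (Re (z $ h)) u" "nrm u = \<bar>Im (z $ h)\<bar>"
    using slice_pt1_eq_para[OF J] by blast
  have zE: "z $ h \<in> ?E" using z by (simp add: sec_def)
  \<comment> \<open>A radius is never negative, so the radial description meets z $ h or its
    conjugate; the section contains both.\<close>
  have "Complex (Re (z $ h)) \<bar>Im (z $ h)\<bar> = z $ h \<or> Complex (Re (z $ h)) \<bar>Im (z $ h)\<bar> = cnj (z $ h)"
    by (auto simp: complex_eq_iff abs_if)
  hence "Complex (Re (z $ h)) (nrm u) \<in> ?E"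
    using zE cnj_sec[OF symmetric_nonreal[OF D(2)] zE] u(2) by auto
  hence g: "radial_dom ?E (Re (z $ h)) u" using Im0[OF zE] u(2) by (simp add: radial_dom_def)
  have xs: "x = subst_at h x (para (Re (z $ h)) u)"
    unfolding u(1)[symmetric] x subst_at_slice_pt by simp
  define \<gamma> where "\<gamma> = (CARD('m) - 1) div 2"
  have m: "CARD('m) = 2 * \<gamma> + 1" unfolding \<gamma>_def using odd(1) by (auto elim!: oddE)
  hence \<gamma>: "0 < \<gamma>" using odd(2) by simp
  have "(laplacian h ^^ \<gamma>) ?S (subst_at h x (para (Re (z $ h)) u)) =
      (\<Prod>i<\<gamma>. real CARD('m) - (2 * real i + 3)) *\<^sub>R psi A B \<gamma> 0 (Complex (Re (z $ h)) (nrm u))"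
    by (rule laplacian_iterate_radial[OF E AB(1) G g])
  \<comment> \<open>The factor with i = \<gamma> - 1 is m - (2 \<gamma> + 1) = 0.\<close>
  also have "(\<Prod>i<\<gamma>. real CARD('m) - (2 * real i + 3)) = 0"
    using \<gamma> m by (intro prod_zero bexI[of _ "\<gamma> - 1"]) auto
  finally show ?thesis using xs unfolding \<gamma>_def by simp
qed

text \<open>For m = 1 the exponent in part 3 is 0 and the claim would read S_comp = 0, which fails
  for f = 1 and H = K = {h}, where the component is 1 on a non-empty domain. In part 5 the
  components do not see real coordinates: for n = 1 and D the whole plane, the stem whose even part
  is \<open>cl_gen i\<close> on the real axis and 0 elsewhere, with zero odd part, has real
  components without being slice preserving. Hence the converse on D assumes continuity, and the
  equivalence is stated on \<open>nonreal D UNIV\<close>.\<close>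

theorem theorem4p3:
  fixes D :: "(complex ^ 'n::{finite,linorder}) set"
    and f :: "'m::{finite,linorder} clifford ^ 'n::{finite,linorder} \<Rightarrow> 'm clifford"
    and H :: "'n set"
  assumes m_odd: "odd CARD('m)"
    and D_open: "open D"
    and D_sym: "symmetric D"
    and f_slice: "f \<in> slice_fns D"
  shows
    \<comment> \<open>1\<close>
    "(\<forall>x\<in>Omega (nonreal D H).
        f x = (\<Sum>K\<in>Pow H. (- 1) ^ card (H - K) *
          slice_prod (nonreal D H) (coord_cnj_prod (nonreal D H) (H - K)) (S_comp D H K f) x)) \<and>
     (\<forall>q. 1 \<le> q \<and> q \<le> CARD('n) \<and> H = first_indices q \<longrightarrow>
        (\<forall>x\<in>Omega (nonreal D H).
          f x = (\<Sum>K\<in>Pow H. (- 1) ^ card (H - K) *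
            (coord_cnj_prod (nonreal D H) (H - K) x * S_comp D H K f x)))) \<and>
    \<comment> \<open>2\<close>
     (H \<noteq> UNIV \<longrightarrow> (\<forall>K\<subseteq>H. S_comp D H K f
        \<in> circular_fns H (nonreal D H) \<inter> slice_fns_at (Min (- H)) (nonreal D H))) \<and>
     (\<forall>K. S_comp D UNIV K f \<in> circular_fns UNIV (nonreal D UNIV)) \<and>
    \<comment> \<open>3\<close>
     (f \<in> slice_regular_fns D \<longrightarrow> CARD('m) \<noteq> 1 \<longrightarrow>
        (\<forall>h\<in>H. \<forall>K\<subseteq>H. \<forall>x\<in>Omega (nonreal D H).
          (laplacian h ^^ ((CARD('m) - 1) div 2)) (S_comp D H K f) x = 0)) \<and>
    \<comment> \<open>4\<close>
     (f \<in> slice_regular_fns D \<longleftrightarrow>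
        (\<forall>H'. H' \<noteq> UNIV \<longrightarrow> (\<forall>K\<subseteq>H'. S_comp D H' K f
          \<in> slice_regular_fns_at (Min (- H')) (nonreal D H')))) \<and>
    \<comment> \<open>5\<close>
     (f \<in> slice_preserving_fns D \<longrightarrow>
        (\<forall>K. \<forall>x\<in>Omega (nonreal D UNIV). S_comp D UNIV K f x \<in> \<real>)) \<and>
     (continuous_on (Omega D) f \<longrightarrow>
        (\<forall>K. \<forall>x\<in>Omega (nonreal D UNIV). S_comp D UNIV K f x \<in> \<real>) \<longrightarrow>
        f \<in> slice_preserving_fns D) \<and>
     (f \<in> slice_preserving_fns (nonreal D UNIV) \<longleftrightarrow>
        (\<forall>K. \<forall>x\<in>Omega (nonreal D UNIV). S_comp D UNIV K f x \<in> \<real>))"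
proof -
  obtain F where F: "induced_by D f F" using f_slice by (auto simp: slice_fns_def)
  have N: "symmetric (nonreal D UNIV)" using D_sym by (rule symmetric_nonreal)
  have FN: "induced_by (nonreal D UNIV) f F"
    by (rule induced_by_subset[OF F D_sym N nonreal_subset])
  show ?thesis
  proof (intro conjI)
    show "\<forall>x\<in>Omega (nonreal D H). f x = (\<Sum>K\<in>Pow H. (- 1) ^ card (H - K) *
        slice_prod (nonreal D H) (coord_cnj_prod (nonreal D H) (H - K)) (S_comp D H K f) x)"
      using decomposition[OF D_sym F] by blast
    show "\<forall>q. 1 \<le> q \<and> q \<le> CARD('n) \<and> H = first_indices q \<longrightarrow>
        (\<forall>x\<in>Omega (nonreal D H). f x = (\<Sum>K\<in>Pow H. (- 1) ^ card (H - K) *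
          (coord_cnj_prod (nonreal D H) (H - K) x * S_comp D H K f x)))"
      using decomposition_pointwise[OF D_sym F] by blast
    show "H \<noteq> UNIV \<longrightarrow> (\<forall>K\<subseteq>H. S_comp D H K f
        \<in> circular_fns H (nonreal D H) \<inter> slice_fns_at (Min (- H)) (nonreal D H))"
      using S_comp_circular[OF D_open D_sym F] S_comp_slice_at_min[OF D_open D_sym F] by blast
    show "\<forall>K. S_comp D UNIV K f \<in> circular_fns UNIV (nonreal D UNIV)"
      using S_comp_circular[OF D_open D_sym F] by blast
    show "f \<in> slice_regular_fns D \<longrightarrow> CARD('m) \<noteq> 1 \<longrightarrow>
        (\<forall>h\<in>H. \<forall>K\<subseteq>H. \<forall>x\<in>Omega (nonreal D H).
          (laplacian h ^^ ((CARD('m) - 1) div 2)) (S_comp D H K f) x = 0)"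
      using Fueter_Sce[OF m_odd _ D_open D_sym] by blast
    show "f \<in> slice_regular_fns D \<longleftrightarrow>
        (\<forall>H'. H' \<noteq> UNIV \<longrightarrow> (\<forall>K\<subseteq>H'. S_comp D H' K f
          \<in> slice_regular_fns_at (Min (- H')) (nonreal D H')))"
      by (rule slice_regular_iff_components[OF D_open D_sym f_slice])
    show "f \<in> slice_preserving_fns D \<longrightarrow>
        (\<forall>K. \<forall>x\<in>Omega (nonreal D UNIV). S_comp D UNIV K f x \<in> \<real>)"
      unfolding S_comp_UNIV_real_iff[OF D_sym F] slice_preserving_iff[OF D_sym F]
      using nonreal_subset[of D UNIV] by blast
    show "continuous_on (Omega D) f \<longrightarrow>
        (\<forall>K. \<forall>x\<in>Omega (nonreal D UNIV). S_comp D UNIV K f x \<in> \<real>) \<longrightarrow>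
        f \<in> slice_preserving_fns D"
      using slice_preserving_of_continuous[OF D_open D_sym F] by blast
    show "f \<in> slice_preserving_fns (nonreal D UNIV) \<longleftrightarrow>
        (\<forall>K. \<forall>x\<in>Omega (nonreal D UNIV). S_comp D UNIV K f x \<in> \<real>)"
      unfolding S_comp_UNIV_real_iff[OF D_sym F] by (rule slice_preserving_iff[OF N FN])
  qed
qed

end
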